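(* Let $\mathcal X$ and $\mathcal Y_i$, $i=0,\dots,N-1$, be reflexive Banach spaces with each $\mathcal Y_i$ uniformly smooth, and let $\Theta$ and $F_i$, $i=0,\dots,N-1$, satisfy assumption (A1) of the context, and $S_\varepsilon$ assumption (A2). Let $\{\varepsilon_n\}_{n\ge0}$ be a sequence of positive numbers with $16\sum_{n=0}^\infty\varepsilon_n\le c_0\rho^p$. Let $\beta>1$ be a constant with $\beta\gamma<1$, let $\beta_1>0$, let $\beta_0>0$ and $\tau>1$ be such that $$\frac1\beta-\gamma-\frac{1+\gamma}{\tau}-\frac2{p^*}\Big(\frac{\beta_0}{2c_0}\Big)^{p^*-1}>0,$$ and let $\sigma>0$ be such that $\kappa\beta_1\sigma\le1$, where $\kappa=1$ if $p\ge s$ and $\kappa=(\beta^{\frac p{s-p}}-1)^{\frac{p-s}p}$ if $p<s$. For noise levels $\delta>0$ let $y_i^\delta\in\mathcal Y_i$ satisfy $\|y_i^\delta-y_i\|\le\delta$ for $i=0,\dots,N-1$, and let $(\xi_n^\delta,x_n^\delta)$ and the stopping index $n_\delta$ be generated by the Landweber-Kaczmarz method with noisy data described in the context. Then there is a solution $x_*$ of the system $F_i(x)=y_i$, $i=0,\dots,N-1$, in $B_{2\rho}(x_0)\cap\mathscr D(\Theta)$ such that $$\lim_{\delta\to0}\|x^\delta_{n_\delta}-x_*\|=0\quad\text{and}\quad\lim_{\delta\to0}D^{\varepsilon_{n_\delta}}_{\xi^\delta_{n_\delta}}\Theta(x_*,x^\delta_{n_\delta})=0.$$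
   Context: All Banach spaces are real; $\mathcal X^*$ is the dual, $\langle\xi,x\rangle=\xi(x)$ for $\xi\in\mathcal X^*$, $x\in\mathcal X$. $B_r(x_0)=\{x\in\mathcal X:\|x-x_0\|\le r\}$. For $\Theta:\mathcal X\to(-\infty,\infty]$, $\mathscr D(\Theta)=\{x:\Theta(x)<\infty\}$. For $\varepsilon\ge0$, the $\varepsilon$-subdifferential is $\partial_\varepsilon\Theta(x)=\{\xi\in\mathcal X^*:\Theta(\bar x)\ge\Theta(x)+\langle\xi,\bar x-x\rangle-\varepsilon\ \forall\bar x\in\mathcal X\}$, and $\partial\Theta=\partial_0\Theta$. For $\xi\in\partial_\varepsilon\Theta(x)$ the $\varepsilon$-Bregman distance is $D^\varepsilon_\xi\Theta(\bar x,x)=\Theta(\bar x)-\Theta(x)-\langle\xi,\bar x-x\rangle+\varepsilon$; $D_\xi\Theta=D^0_\xi\Theta$. $\Theta$ is $p$-convex ($p\ge2$) with constant $c_0>0$ if $\Theta(t\bar x+(1-t)x)+c_0t(1-t)\|\bar x-x\|^p\le t\Theta(\bar x)+(1-t)\Theta(x)$ for all $0\le t\le1$, $\bar x,x\in\mathcal X$. $p^*$ is the conjugate exponent, $1/p+1/p^*=1$. For $1<s<\infty$ fixed, $J_s^{\mathcal Y_i}(y)=\{\zeta\in\mathcal Y_i^*:\|\zeta\|=\|y\|^{s-1},\ \langle\zeta,y\rangle=\|y\|^s\}$ is the duality mapping, single valued since $\mathcal Y_i$ is uniformly smooth. Problem: $F_i(x)=y_i$, $i=0,\dots,N-1$, with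 $F_i:\mathscr D(F_i)\subset\mathcal X\to\mathcal Y_i$; put $\mathscr D=\bigcap_{i=0}^{N-1}\mathscr D(F_i)$. Assumption (A1): (a) $\Theta:\mathcal X\to(-\infty,\infty]$ is proper, lower semi-continuous and $p$-convex with constant $c_0$. (b) There exist $\rho>0$, $x_0\in\mathcal X$, $\xi_0\in\partial\Theta(x_0)$ such that $B_{2\rho}(x_0)\subset\mathscr D$ and the system has a solution $x^\dagger\in\mathscr D(\Theta)$ with $D_{\xi_0}\Theta(x^\dagger,x_0)\le\frac14c_0\rho^p$. (c) For each $i$ there is a family of bounded linear operators $L_i(x):\mathcal X\to\mathcal Y_i$, $x\in B_{2\rho}(x_0)$, such that $x\mapsto L_i(x)$ is continuous on $B_{2\rho}(x_0)$ (operator norm), and there is $0\le\gamma<1$ with $\|F_i(\bar x)-F_i(x)-L_i(x)(\bar x-x)\|\le\gamma\|F_i(\bar x)-F_i(x)\|$ for all $\bar x,x\in B_{2\rho}(x_0)$ and all $i$. Assumption (A2): for each $\varepsilon>0$, $S_\varepsilon:\mathcal X^*\to\mathcal X$ is a continuous mapping such that for every $\xi\in\mathcal X^*$, $x=S_\varepsilon(\xi)$ satisfies $\Theta(x)-\langle\xi,x\rangle\le\min_{z\in\mathcal X}\{\Theta(z)-\langle\xi,z\rangle\}+\varepsilon$. Landweber-Kaczmarz method with noisy data: set $x_0^\delta=x_0$, $\xi_0^\delta=\xi_0$ (those of (A1)(b)), $q_{-1}=0$, $i_n=n\ (\mathrm{mod}\ N)$. For $n\ge0$ let $r_n^\delta=F_{i_n}(x_n^\delta)-y_{i_n}^\delta$;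 $q_n=q_{n-1}+1$ if $\|r_n^\delta\|^p+\sigma\varepsilon_n\le(\tau\delta)^p$, and $q_n=0$ otherwise; $$\tilde\mu_n^\delta=\min\Big\{\frac{\beta_0\|r_n^\delta\|^{p(s-1)}}{\|L_{i_n}(x_n^\delta)^*J_s^{\mathcal Y_{i_n}}(r_n^\delta)\|^p},\beta_1\Big\}$$ (with $\tilde\mu_n^\delta=\beta_1$ when the denominator is zero); $\mu_n^\delta=\tilde\mu_n^\delta(\|r_n^\delta\|^p+\sigma\varepsilon_n)^{1-\frac sp}$ if $\|r_n^\delta\|^p+\sigma\varepsilon_n>(\tau\delta)^p$, and $\mu_n^\delta=0$ otherwise; and $$\xi_{n+1}^\delta=\xi_n^\delta-\mu_n^\delta L_{i_n}(x_n^\delta)^*J_s^{\mathcal Y_{i_n}}(r_n^\delta),\qquad x_{n+1}^\delta=S_{\varepsilon_{n+1}}(\xi_{n+1}^\delta).$$ The stopping index $n_\delta$ is the first integer with $q_{n_\delta}=N$. All parameters ($\beta_0,\beta_1,\tau,\sigma,\{\varepsilon_n\},S_\varepsilon,x_0,\xi_0$) are independent of $\delta$. Consequently $\xi_n^\delta\in\partial_{\varepsilon_n}\Theta(x_n^\delta)$. *)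

theory Defs
  imports "HOL-Analysis.Analysis"
begin

text \<open>
  The spaces \<open>Y\<^sub>0, \<dots>, Y\<^sub>N\<^sub>-\<^sub>1\<close> are different Banach spaces whose number varies. They are modelled as
  closed subspaces of one Banach space type \<open>'b\<close>, which is no restriction up to isometric
  isomorphism: finitely many Banach spaces embed isometrically into their direct sum.
  The notions below refer to the subspace \<open>V\<close> as a normed space in its own right. In particular,
  the dual of \<open>V\<close> consists of functionals on \<open>V\<close> only; as they are represented by total functions,
  they are required to be 0 outside \<open>V\<close>, so that each functional has exactly one representative
  and pointwise sums and multiples of representatives are again representatives.
\<close>

definition dual_on :: "'b::real_normed_vector set \<Rightarrow> ('b \<Rightarrow> real) set" where
  "dual_on V = {f. (\<forall>u\<in>V. \<forall>v\<in>V. f (u + v) = f u + f v) \<and>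
                   (\<forall>c. \<forall>v\<in>V. f (c *\<^sub>R v) = c * f v) \<and>
                   (\<exists>K. \<forall>v\<in>V. \<bar>f v\<bar> \<le> K * norm v) \<and>
                   (\<forall>v. v \<notin> V \<longrightarrow> f v = 0)}"

definition dual_norm_on :: "'b::real_normed_vector set \<Rightarrow> ('b \<Rightarrow> real) \<Rightarrow> real" where
  "dual_norm_on V f = (SUP v\<in>{v \<in> V. norm v \<le> 1}. \<bar>f v\<bar>)"

text \<open>Every bounded linear functional on the dual of \<open>V\<close> is evaluation at a point of \<open>V\<close>.\<close>

definition reflexive_on :: "'b::real_normed_vector set \<Rightarrow> bool" where
  "reflexive_on V \<longleftrightarrow>
     (\<forall>\<phi> :: ('b \<Rightarrow> real) \<Rightarrow> real.
        (\<forall>f\<in>dual_on V. \<forall>g\<in>dual_on V. \<phi> (\<lambda>v. f v + g v) = \<phi> f + \<phi> g) \<and>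
        (\<forall>c. \<forall>f\<in>dual_on V. \<phi> (\<lambda>v. c * f v) = c * \<phi> f) \<and>
        (\<exists>K. \<forall>f\<in>dual_on V. \<bar>\<phi> f\<bar> \<le> K * dual_norm_on V f)
        \<longrightarrow> (\<exists>v\<in>V. \<forall>f\<in>dual_on V. \<phi> f = f v))"

definition uniformly_smooth_on :: "'b::real_normed_vector set \<Rightarrow> bool" where
  "uniformly_smooth_on V \<longleftrightarrow>
     (\<forall>e>0. \<exists>d>0. \<forall>u\<in>V. \<forall>v\<in>V. norm u = 1 \<and> norm v \<le> d \<longrightarrow>
        norm (u + v) + norm (u - v) \<le> 2 + e * norm v)"

definition duality_mapping_on ::
    "'b::real_normed_vector set \<Rightarrow> real \<Rightarrow> 'b \<Rightarrow> ('b \<Rightarrow> real) set" where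
  "duality_mapping_on V s y =
     {\<zeta> \<in> dual_on V. dual_norm_on V \<zeta> = norm y powr (s - 1) \<and> \<zeta> y = norm y powr s}"

text \<open>
  The Banach space adjoint of a bounded operator \<open>A : X \<rightarrow> V\<close>, applied to a functional on \<open>V\<close>.
  It is meaningful if \<open>range A \<subseteq> V\<close> and \<open>\<zeta> \<in> dual_on V\<close>.
\<close>

definition adjoint_apply ::
    "('a::real_normed_vector \<Rightarrow>\<^sub>L 'b::real_normed_vector) \<Rightarrow> ('b \<Rightarrow> real) \<Rightarrow> 'a \<Rightarrow>\<^sub>L real" where
  "adjoint_apply A \<zeta> = Blinfun (\<lambda>h. \<zeta> (blinfun_apply A h))"

definition eff_dom :: "('a \<Rightarrow> ereal) \<Rightarrow> 'a set" where
  "eff_dom \<Theta> = {x. \<Theta> x < \<infinity>}"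

definition proper_fun :: "('a \<Rightarrow> ereal) \<Rightarrow> bool" where
  "proper_fun \<Theta> \<longleftrightarrow> (\<forall>x. \<Theta> x \<noteq> -\<infinity>) \<and> eff_dom \<Theta> \<noteq> {}"

definition lower_semicont :: "('a::topological_space \<Rightarrow> ereal) \<Rightarrow> bool" where
  "lower_semicont \<Theta> \<longleftrightarrow> (\<forall>x. \<Theta> x \<le> Liminf (at x) \<Theta>)"

definition p_convex :: "real \<Rightarrow> real \<Rightarrow> ('a::real_normed_vector \<Rightarrow> ereal) \<Rightarrow> bool" where
  "p_convex p c0 \<Theta> \<longleftrightarrow>
     (\<forall>t x' x. 0 \<le> t \<and> t \<le> 1 \<longrightarrow>
        \<Theta> (t *\<^sub>R x' + (1 - t) *\<^sub>R x) + ereal (c0 * t * (1 - t) * norm (x' - x) powr p)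
        \<le> ereal t * \<Theta> x' + ereal (1 - t) * \<Theta> x)"

definition eps_subdiff ::
    "real \<Rightarrow> ('a::real_normed_vector \<Rightarrow> ereal) \<Rightarrow> 'a \<Rightarrow> ('a \<Rightarrow>\<^sub>L real) set" where
  "eps_subdiff e \<Theta> x =
     {\<xi>. \<forall>x'. \<Theta> x' \<ge> \<Theta> x + ereal (blinfun_apply \<xi> (x' - x)) - ereal e}"

text \<open>\<open>bregman e \<Theta> \<xi> x' x\<close> is the \<open>e\<close>-Bregman distance from \<open>x\<close> to \<open>x'\<close>, for \<open>\<xi> \<in> eps_subdiff e \<Theta> x\<close>.\<close>

definition bregman ::
    "real \<Rightarrow> ('a::real_normed_vector \<Rightarrow> ereal) \<Rightarrow> ('a \<Rightarrow>\<^sub>L real) \<Rightarrow> 'a \<Rightarrow> 'a \<Rightarrow> ereal" where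
  "bregman e \<Theta> \<xi> x' x = \<Theta> x' - \<Theta> x - ereal (blinfun_apply \<xi> (x' - x)) + ereal e"

definition solves_system ::
    "nat \<Rightarrow> (nat \<Rightarrow> 'a set) \<Rightarrow> (nat \<Rightarrow> 'a \<Rightarrow> 'b) \<Rightarrow> (nat \<Rightarrow> 'b) \<Rightarrow> 'a \<Rightarrow> bool" where
  "solves_system N D F y x \<longleftrightarrow> (\<forall>i<N. x \<in> D i \<and> F i x = y i)"

text \<open>
  The sequences \<open>\<xi>\<close>, \<open>x\<close>, \<open>q\<close> are those generated by the Landweber-Kaczmarz method from the data \<open>yd\<close>
  of noise level \<open>\<delta>\<close>. The recursion determines them uniquely. The convention \<open>q\<^sub>-\<^sub>1 = 0\<close> is
  expressed by the inner conditional. In the proper setting the duality mapping is single valued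
  on \<open>Y i\<close>, and \<open>the_elem\<close> extracts its value.
\<close>

definition landweber_kaczmarz ::
    "nat \<Rightarrow> (nat \<Rightarrow> 'b::real_normed_vector set) \<Rightarrow> (nat \<Rightarrow> 'a::real_normed_vector \<Rightarrow> 'b) \<Rightarrow>
     (nat \<Rightarrow> 'a \<Rightarrow> ('a \<Rightarrow>\<^sub>L 'b)) \<Rightarrow> (real \<Rightarrow> ('a \<Rightarrow>\<^sub>L real) \<Rightarrow> 'a) \<Rightarrow> (nat \<Rightarrow> real) \<Rightarrow>
     real \<Rightarrow> real \<Rightarrow> real \<Rightarrow> real \<Rightarrow> real \<Rightarrow> real \<Rightarrow> 'a \<Rightarrow> ('a \<Rightarrow>\<^sub>L real) \<Rightarrow>
     real \<Rightarrow> (nat \<Rightarrow> 'b) \<Rightarrow> (nat \<Rightarrow> 'a \<Rightarrow>\<^sub>L real) \<Rightarrow> (nat \<Rightarrow> 'a) \<Rightarrow> (nat \<Rightarrow> nat) \<Rightarrow> bool" where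
  "landweber_kaczmarz N Y F L S \<epsilon> p s \<beta>\<^sub>0 \<beta>\<^sub>1 \<tau> \<sigma> x\<^sub>0 \<xi>\<^sub>0 \<delta> yd \<xi> x q \<longleftrightarrow>
     x 0 = x\<^sub>0 \<and> \<xi> 0 = \<xi>\<^sub>0 \<and>
     (\<forall>n. let i = n mod N;
              r = F i (x n) - yd i;
              h = norm r powr p + \<sigma> * \<epsilon> n;
              g = adjoint_apply (L i (x n)) (the_elem (duality_mapping_on (Y i) s r));
              \<mu>' = (if norm g powr p = 0 then \<beta>\<^sub>1
                    else min (\<beta>\<^sub>0 * norm r powr (p * (s - 1)) / norm g powr p) \<beta>\<^sub>1);
              \<mu> = (if h > (\<tau> * \<delta>) powr p then \<mu>' * h powr (1 - s / p) else 0)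
          in q n = (if h \<le> (\<tau> * \<delta>) powr p then (if n = 0 then 0 else q (n - 1)) + 1 else 0) \<and>
             \<xi> (Suc n) = \<xi> n - \<mu> *\<^sub>R g \<and>
             x (Suc n) = S (\<epsilon> (Suc n)) (\<xi> (Suc n)))"

end

theory Submission
  imports Defs
begin

text \<open>
  The proof measures progress by the \<open>\<epsilon>\<close>-Bregman distance from the iterates to a solution \<open>z\<close> in the
  ball. When the base point moves from \<open>x n\<close> to \<open>x (Suc n)\<close>, this distance changes by the pairing of
  \<open>\<xi> n - \<xi> (Suc n)\<close> with \<open>z - x n\<close>, plus the distance between the two iterates
  (\<open>breg_three_point\<close>). By \<open>p\<close>-convexity and Young's inequality the latter is at most a multiple of
  \<open>norm (\<xi> n - \<xi> (Suc n)) powr ps\<close> plus terms in \<open>\<epsilon>\<close> (\<open>breg_upper\<close>), and the minimum in the step size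
  keeps it proportional to \<open>h n\<close>, the shifted power of the residual (\<open>relax_step\<close>). By the
  tangential cone condition the pairing is, up to a multiple of \<open>\<epsilon> n\<close>, negative of the same order. The condition on the
  constants says that the negative term wins, so the distance increases by at most
  \<open>2 * \<epsilon> n + \<epsilon> (Suc n)\<close> and, at an active step, decreases by a fixed multiple of \<open>h n\<close> (\<open>one_step\<close>).
  The errors are summable. Hence the iterates stay in the ball, the distances are almost monotone
  (\<open>quasi_monotone\<close>), and the \<open>h n\<close> at active steps are summable, which forces termination for
  noisy data.

  For exact data every step is active, so \<open>h\<close> is summable. Its sums over the cycles of length \<open>N\<close>, with the errors
  added, reach new minima infinitely often. Up to such a cycle \<open>b\<close>, the dual increments pair with
  \<open>x (b * N) - z\<close> to a quantity that the sums over the intermediate cycles bound (\<open>pairing\<close>), since the residuals at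
  \<open>x (b * N)\<close> are then among the smallest. This makes the iterates at these minima a Cauchy sequence. Its limit is a
  solution, and the distance to it tends to 0 along the multiples of \<open>N\<close> (\<open>exact_convergence\<close>).

  For noisy data, the \<open>n\<close>-th iterate with \<open>n\<close> fixed depends continuously on the noise level at 0
  (\<open>iterates_tendsto\<close>), because the duality mapping of a uniformly smooth space is continuous. The
  shift \<open>\<sigma> * \<epsilon> n\<close> is positive, so a fixed step is active as soon as \<open>\<delta>\<close> is small, and the stopping
  index tends to infinity (\<open>stop_at_top\<close>). Given a tolerance, fix \<open>n\<close> such that the exact iterate and the
  tail of the error series are within it. For small \<open>\<delta>\<close> the noisy \<open>n\<close>-th iterate is as close
  as the exact one, and almost monotonicity transports this from \<open>n\<close> to the stopping index.
\<close>

section \<open>The duality mapping of a uniformly smooth subspace\<close>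

lemma dual_on_bdd_above:
  assumes "f \<in> dual_on V"
  shows "bdd_above ((\<lambda>v. \<bar>f v\<bar>) ` {v \<in> V. norm v \<le> 1})"
proof -
  obtain K where K: "\<forall>v\<in>V. \<bar>f v\<bar> \<le> K * norm v" using assms unfolding dual_on_def by blast
  show ?thesis
  proof (rule bdd_aboveI2)
    fix w assume "w \<in> {v \<in> V. norm v \<le> 1}"
    then have w: "w \<in> V" "norm w \<le> 1" by auto
    have "\<bar>f w\<bar> \<le> K * norm w" using K w by blast
    also have "\<dots> \<le> \<bar>K\<bar> * 1" using w by (intro mult_mono) auto
    finally show "\<bar>f w\<bar> \<le> \<bar>K\<bar>" by simp
  qed
qed

lemma dual_norm_on_nonneg:
  assumes "subspace V" "f \<in> dual_on V"
  shows "0 \<le> dual_norm_on V f"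
proof -
  have "\<bar>f 0\<bar> \<le> dual_norm_on V f" unfolding dual_norm_on_def
    using subspace_0[OF assms(1)] by (intro cSUP_upper dual_on_bdd_above assms) auto
  then show ?thesis by simp
qed

lemma dual_on_bound:
  fixes V :: "'b::real_normed_vector set"
  assumes "subspace V" "f \<in> dual_on V" "v \<in> V"
  shows "\<bar>f v\<bar> \<le> dual_norm_on V f * norm v"
proof (cases "v = 0")
  case True
  have "f (0 *\<^sub>R v) = 0 * f v" using assms(2,3) unfolding dual_on_def by blast
  then show ?thesis using True by simp
next
  case False
  let ?u = "inverse (norm v) *\<^sub>R v"
  have u: "?u \<in> {v \<in> V. norm v \<le> 1}" using False assms by (simp add: subspace_scale)
  have "\<bar>f ?u\<bar> \<le> dual_norm_on V f"
    unfolding dual_norm_on_def by (rule cSUP_upper[OF u dual_on_bdd_above[OF assms(2)]])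
  moreover have "f ?u = inverse (norm v) * f v" using assms(2,3) unfolding dual_on_def by blast
  ultimately have "inverse (norm v) * \<bar>f v\<bar> \<le> dual_norm_on V f" by (simp add: abs_mult)
  then show ?thesis using False by (simp add: field_simps)
qed

lemma dual_norm_on_le:
  fixes V :: "'b::real_normed_vector set"
  assumes "subspace V" "0 \<le> K" "\<And>v. v \<in> V \<Longrightarrow> \<bar>f v\<bar> \<le> K * norm v"
  shows "dual_norm_on V f \<le> K"
  unfolding dual_norm_on_def
proof (rule cSUP_least)
  show "{v \<in> V. norm v \<le> 1} \<noteq> {}" using subspace_0[OF assms(1)] by force
  fix v assume v: "v \<in> {v \<in> V. norm v \<le> 1}"
  have "\<bar>f v\<bar> \<le> K * norm v" using assms v by auto
  also have "\<dots> \<le> K * 1" using v assms by (intro mult_left_mono) auto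
  finally show "\<bar>f v\<bar> \<le> K" by simp
qed

text \<open>
  The functional is the directional derivative of the norm at \<open>u\<close>, which exists because the
  difference quotients \<open>Q t v\<close> are monotone in \<open>t\<close>. It is sublinear since the norm is convex, and smoothness
  bounds \<open>f v + f (- v)\<close> by 0, which makes it odd and hence linear.
\<close>

lemma uniformly_smooth_norming_functional:
  fixes V :: "'b::real_normed_vector set"
  assumes V: "subspace V" and us: "uniformly_smooth_on V" and u: "u \<in> V" "norm u = 1"
  shows "\<exists>f\<in>dual_on V. (\<forall>v\<in>V. \<bar>f v\<bar> \<le> norm v) \<and> f u = 1"
proof -
  define Q where "Q t v = (norm (u + t *\<^sub>R v) - 1) / t" for t :: real and v
  define f where "f v = (INF t\<in>{0<..}. Q t v)" for v
  have lower: "- norm v \<le> Q t v" if "0 < t" for t v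
  proof -
    have "norm u \<le> norm (u + t *\<^sub>R v) + norm (t *\<^sub>R v)"
      using norm_triangle_ineq4[of "u + t *\<^sub>R v" "t *\<^sub>R v"] by simp
    then show ?thesis using that u unfolding Q_def by (simp add: divide_simps mult.commute)
  qed
  have upper: "Q t v \<le> norm v" if "0 < t" for t v
    using norm_triangle_ineq[of u "t *\<^sub>R v"] that u
    unfolding Q_def by (simp add: divide_simps mult.commute)
  have bdd: "bdd_below ((\<lambda>t. Q t v) ` {0<..})" for v
    using lower by (intro bdd_belowI2[where m="- norm v"]) auto
  have f_le: "f v \<le> Q t v" if "0 < t" for t v
    unfolding f_def using that by (intro cINF_lower bdd) auto
  have le_f: "c \<le> f v" if "\<And>t. 0 < t \<Longrightarrow> c \<le> Q t v" for c v
    unfolding f_def using that by (intro cINF_greatest) auto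
  have mono: "Q t v \<le> Q t' v" if t: "0 < t" "t \<le> t'" for t t' v
  proof -
    have "u + t *\<^sub>R v = (1 - t / t') *\<^sub>R u + (t / t') *\<^sub>R (u + t' *\<^sub>R v)"
      using t by (simp add: algebra_simps)
    then have "norm (u + t *\<^sub>R v) \<le> norm ((1 - t / t') *\<^sub>R u) + norm ((t / t') *\<^sub>R (u + t' *\<^sub>R v))"
      using norm_triangle_ineq by metis
    also have "\<dots> = (1 - t / t') + t / t' * norm (u + t' *\<^sub>R v)"
      using t u by simp
    finally have "(norm (u + t *\<^sub>R v) - 1) / t \<le> (t / t' * (norm (u + t' *\<^sub>R v) - 1)) / t"
      using t by (intro divide_right_mono) (auto simp: algebra_simps)
    then show ?thesis using t unfolding Q_def by simp
  qed
  have approx: "\<exists>t0>0. \<forall>t. 0 < t \<and> t \<le> t0 \<longrightarrow> Q t v < f v + e" if "0 < e" for e v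
  proof -
    have "(INF t\<in>{0<..}. Q t v) < f v + e" using that unfolding f_def by simp
    then obtain t0 where "0 < t0" "Q t0 v < f v + e"
      using cINF_less_iff[OF _ bdd, of v "f v + e"] by auto
    then show ?thesis using mono by (meson le_less_trans)
  qed
  have sub: "f (v + w) \<le> f v + f w" for v w
  proof (rule field_le_epsilon)
    fix e :: real assume "0 < e"
    then obtain a b where ab: "0 < a" "\<forall>t. 0 < t \<and> t \<le> a \<longrightarrow> Q t v < f v + e / 2"
        "0 < b" "\<forall>t. 0 < t \<and> t \<le> b \<longrightarrow> Q t w < f w + e / 2"
      using approx[of "e/2" v] approx[of "e/2" w] by auto
    define t where "t = min a b / 2"
    have t: "0 < t" "2 * t \<le> a" "2 * t \<le> b" using ab unfolding t_def by auto
    have "u + t *\<^sub>R (v + w) = (1/2) *\<^sub>R (u + (2 * t) *\<^sub>R v) + (1/2) *\<^sub>R (u + (2 * t) *\<^sub>R w)"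
      by (simp add: algebra_simps flip: scaleR_add_left)
    then have "norm (u + t *\<^sub>R (v + w)) \<le>
        norm ((1/2) *\<^sub>R (u + (2 * t) *\<^sub>R v)) + norm ((1/2) *\<^sub>R (u + (2 * t) *\<^sub>R w))"
      using norm_triangle_ineq by metis
    then have "Q t (v + w) \<le> Q (2 * t) v + Q (2 * t) w"
      using t unfolding Q_def by (simp add: divide_simps)
    moreover have "Q (2 * t) v < f v + e / 2" "Q (2 * t) w < f w + e / 2" using ab t by auto
    ultimately show "f (v + w) \<le> f v + f w + e" using f_le[OF t(1), of "v + w"] by linarith
  qed
  have scale_le: "f (c *\<^sub>R v) \<le> c * f v" if "0 < c" for c v
  proof (rule field_le_epsilon)
    fix e :: real assume "0 < e"
    then obtain a where a: "0 < a" "Q a v < f v + e / c" using approx[of "e/c" v] divide_pos_pos[OF \<open>0 < e\<close> \<open>0 < c\<close>] by auto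
    have "Q (a / c) (c *\<^sub>R v) = c * Q a v" using that a unfolding Q_def by (simp add: divide_simps)
    moreover have "c * Q a v \<le> c * (f v + e / c)" using a that by (intro mult_left_mono) auto
    ultimately have "Q (a / c) (c *\<^sub>R v) \<le> c * f v + e" using that by (simp add: algebra_simps)
    then show "f (c *\<^sub>R v) \<le> c * f v + e" using f_le[of "a / c" "c *\<^sub>R v"] that a by simp
  qed
  have f0: "f 0 = 0"
  proof -
    have "Q t 0 = 0" for t using u unfolding Q_def by simp
    then show ?thesis unfolding f_def by simp
  qed
  have scale: "f (c *\<^sub>R v) = c * f v" if "0 < c" for c v
    using scale_le[OF that, of v] scale_le[of "inverse c" "c *\<^sub>R v"] that
    by (simp add: divide_simps mult.commute)
  have odd1: "f v + f (- v) \<le> 0" if v: "v \<in> V" for v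
  proof (rule field_le_epsilon)
    fix e :: real assume e: "0 < e"
    \<comment> \<open>Adding 1 covers \<open>v = 0\<close>.\<close>
    define e' where "e' = e / (norm v + 1)"
    have e': "0 < e'" using e unfolding e'_def by (simp add: add_nonneg_pos)
    obtain d where d: "0 < d" "\<And>w. w \<in> V \<Longrightarrow> norm w \<le> d \<Longrightarrow> norm (u + w) + norm (u - w) \<le> 2 + e' * norm w"
      using us e' u unfolding uniformly_smooth_on_def by meson
    define t where "t = d / (norm v + 1)"
    have t: "0 < t" using d unfolding t_def by (simp add: add_nonneg_pos)
    have "t * norm v \<le> d"
      using d unfolding t_def by (simp add: divide_simps mult_left_mono add_nonneg_pos)
    then have "norm (u + t *\<^sub>R v) + norm (u - t *\<^sub>R v) \<le> 2 + e' * (t * norm v)"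
      using d(2)[of "t *\<^sub>R v"] v V t by (simp add: subspace_scale)
    moreover have "t * Q t v = norm (u + t *\<^sub>R v) - 1" "t * Q t (- v) = norm (u - t *\<^sub>R v) - 1"
      using t unfolding Q_def by auto
    ultimately have "t * (Q t v + Q t (- v)) \<le> t * (e' * norm v)"
      by (simp add: algebra_simps)
    then have "Q t v + Q t (- v) \<le> e' * norm v" using t by simp
    also have "\<dots> \<le> e" using e unfolding e'_def by (simp add: divide_simps mult_left_mono add_nonneg_pos)
    finally show "f v + f (- v) \<le> 0 + e" using f_le[OF t, of v] f_le[OF t, of "- v"] by linarith
  qed
  have odd: "f (- v) = - f v" if "v \<in> V" for v
    using odd1[OF that] sub[of v "- v"] f0 by simp
  have add: "f (v + w) = f v + f w" if "v \<in> V" "w \<in> V" for v w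
    using sub[of v w] sub[of "- v" "- w"] odd[OF that(1)] odd[OF that(2)] odd[of "v + w"] that V
    by (simp add: subspace_add add.commute)
  have hom: "f (c *\<^sub>R v) = c * f v" if v: "v \<in> V" for c v
  proof -
    consider "c > 0" | "c = 0" | "c < 0" by linarith
    then show ?thesis
    proof cases
      case 3
      have "f (c *\<^sub>R v) = f (- ((- c) *\<^sub>R v))" by simp
      also have "\<dots> = - f ((- c) *\<^sub>R v)" using v V by (intro odd) (simp add: subspace_neg subspace_scale)
      also have "\<dots> = c * f v" using scale[of "- c" v] 3 by simp
      finally show ?thesis .
    qed (use scale f0 in auto)
  qed
  have bound: "\<bar>f v\<bar> \<le> norm v" for v
    using f_le[of 1 v] upper[of 1 v] le_f[OF lower, of v] by force
  have fu: "f u = 1"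
  proof -
    have "Q t u = 1" if "0 < t" for t
    proof -
      have "u + t *\<^sub>R u = (1 + t) *\<^sub>R u" by (simp add: algebra_simps)
      then show ?thesis using that u unfolding Q_def by simp
    qed
    then show ?thesis using f_le[of 1 u] le_f[of 1 u] by simp
  qed
  define g where "g v = (if v \<in> V then f v else 0)" for v
  have "g \<in> dual_on V" unfolding dual_on_def
  proof (intro CollectI conjI ballI allI impI)
    show "\<exists>K. \<forall>v\<in>V. \<bar>g v\<bar> \<le> K * norm v"
      using bound by (intro exI[of _ 1]) (simp add: g_def)
  qed (use add hom V in \<open>auto simp: g_def subspace_add subspace_scale\<close>)
  then show ?thesis using bound fu u by (intro bexI[of _ g]) (auto simp: g_def)
qed

text \<open>
  For small \<open>v\<close>, adding \<open>f' (u + v) \<le> norm (u + v)\<close> and \<open>f (u - v) \<le> norm (u - v)\<close> bounds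
  \<open>f' v - f v\<close> by \<open>1 - f' u\<close> plus the modulus of smoothness at \<open>v\<close>, and \<open>1 - f' u \<le> norm (w - u)\<close>. With \<open>w = u\<close> this
  gives uniqueness of the norming functional, with \<open>w\<close> tending to \<open>u\<close> its norm continuity.
\<close>

lemma uniformly_smooth_norming_close:
  fixes V :: "'b::real_normed_vector set"
  assumes V: "subspace V" and us: "uniformly_smooth_on V" and e: "0 < e"
  obtains d where "0 < d"
    "\<And>u w f f' v. u \<in> V \<Longrightarrow> norm u = 1 \<Longrightarrow> w \<in> V \<Longrightarrow> norm (w - u) \<le> d \<Longrightarrow>
       f \<in> dual_on V \<Longrightarrow> (\<And>v. v \<in> V \<Longrightarrow> \<bar>f v\<bar> \<le> norm v) \<Longrightarrow> f u = 1 \<Longrightarrow>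
       f' \<in> dual_on V \<Longrightarrow> (\<And>v. v \<in> V \<Longrightarrow> \<bar>f' v\<bar> \<le> norm v) \<Longrightarrow> f' w = 1 \<Longrightarrow>
       v \<in> V \<Longrightarrow> \<bar>f' v - f v\<bar> \<le> e * norm v"
proof -
  have "0 < e / 2" using e by simp
  then obtain d0 where d0: "0 < d0" "\<And>u v. u \<in> V \<Longrightarrow> v \<in> V \<Longrightarrow> norm u = 1 \<Longrightarrow> norm v \<le> d0 \<Longrightarrow>
      norm (u + v) + norm (u - v) \<le> 2 + e / 2 * norm v"
    using us unfolding uniformly_smooth_on_def by meson
  show ?thesis
  proof (rule that[of "e / 2 * d0"])
    show "0 < e / 2 * d0" using d0 e by simp
    fix u w f f' v
    assume u: "u \<in> V" "norm u = 1" and w: "w \<in> V" "norm (w - u) \<le> e / 2 * d0"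
      and f: "f \<in> dual_on V" "\<And>v. v \<in> V \<Longrightarrow> \<bar>f v\<bar> \<le> norm v" "f u = 1"
      and f': "f' \<in> dual_on V" "\<And>v. v \<in> V \<Longrightarrow> \<bar>f' v\<bar> \<le> norm v" "f' w = 1" and v: "v \<in> V"
    have lin: "f (a *\<^sub>R x + b *\<^sub>R y) = a * f x + b * f y" "f' (a *\<^sub>R x + b *\<^sub>R y) = a * f' x + b * f' y"
      if "x \<in> V" "y \<in> V" for a b x y
      using f(1) f'(1) that V unfolding dual_on_def by (auto simp: subspace_scale)
    have key: "f' v - f v \<le> e * norm v" if v: "v \<in> V" "norm v = d0" for v
    proof -
      have "f' (1 *\<^sub>R u + 1 *\<^sub>R v) \<le> norm (u + v)" "f (1 *\<^sub>R u + (-1) *\<^sub>R v) \<le> norm (u - v)"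
        using f(2)[of "u - v"] f'(2)[of "u + v"] u v V by (auto simp: subspace_add subspace_diff)
      moreover have "f' (1 *\<^sub>R w + (-1) *\<^sub>R u) \<le> norm (w - u)"
        using f'(2)[of "w - u"] u w V by (auto simp: subspace_diff)
      moreover have "norm (u + v) + norm (u - v) \<le> 2 + e / 2 * norm v"
        using d0(2)[OF u(1) v(1) u(2)] v(2) by simp
      ultimately show ?thesis
        using lin(2)[OF u(1) v(1), of 1 1] lin(1)[OF u(1) v(1), of 1 "-1"] lin(2)[OF w(1) u(1), of 1 "-1"]
          f(3) f'(3) w(2) v(2) by (simp only:)
    qed
    show "\<bar>f' v - f v\<bar> \<le> e * norm v"
    proof (cases "v = 0")
      case True
      then show ?thesis using f(2)[OF v] f'(2)[OF v] by simp
    next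
      case False
      define c where "c = d0 / norm v"
      have c: "0 < c" using d0 False unfolding c_def by simp
      have cv: "c *\<^sub>R v \<in> V" "norm (c *\<^sub>R v) = d0" "- c *\<^sub>R v \<in> V" "norm (- c *\<^sub>R v) = d0"
        using v V d0 False unfolding c_def by (auto simp: subspace_scale subspace_neg)
      have "c * (f' v - f v) \<le> c * (e * norm v)" "c * (f v - f' v) \<le> c * (e * norm v)"
        using key[OF cv(1,2)] key[OF cv(3,4)] lin[OF v v, of c 0] lin[OF v v, of "- c" 0] cv c
        by (auto simp: algebra_simps)
      then show ?thesis using c by (simp add: abs_le_iff)
    qed
  qed
qed

abbreviation jmap :: "'b::real_normed_vector set \<Rightarrow> real \<Rightarrow> 'b \<Rightarrow> 'b \<Rightarrow> real" where
  "jmap V s r \<equiv> the_elem (duality_mapping_on V s r)"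

text \<open>
  Away from 0 a value of the duality mapping is a positive multiple of a norming functional, so questions about
  the duality mapping reduce to unit vectors.
\<close>

lemma duality_mapping_normalize:
  assumes V: "subspace V" and r: "r \<in> V" "r \<noteq> 0" and z: "\<zeta> \<in> duality_mapping_on V s r"
  defines "f \<equiv> (\<lambda>v. \<zeta> v / norm r powr (s - 1))"
  shows "f \<in> dual_on V" "\<And>v. v \<in> V \<Longrightarrow> \<bar>f v\<bar> \<le> norm v" "f (r /\<^sub>R norm r) = 1"
    "\<zeta> v = norm r powr (s - 1) * f v"
proof -
  have z': "\<zeta> \<in> dual_on V" "dual_norm_on V \<zeta> = norm r powr (s - 1)" "\<zeta> r = norm r powr s"
    using z unfolding duality_mapping_on_def by auto
  show b: "\<bar>f v\<bar> \<le> norm v" if "v \<in> V" for v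
    using dual_on_bound[OF V z'(1) that] z'(2) r unfolding f_def by (simp add: abs_mult divide_simps mult.commute)
  show "f \<in> dual_on V" unfolding dual_on_def
  proof (intro CollectI conjI ballI allI impI)
    show "\<exists>K. \<forall>v\<in>V. \<bar>f v\<bar> \<le> K * norm v" using b by (intro exI[of _ 1]) simp
  qed (use z'(1) in \<open>auto simp: f_def dual_on_def add_divide_distrib\<close>)
  have "\<zeta> (r /\<^sub>R norm r) = \<zeta> r / norm r"
    using z'(1) r unfolding dual_on_def by (simp add: divide_inverse mult.commute)
  also have "\<dots> = norm r powr s / norm r powr 1" using z' r by simp
  also have "\<dots> = norm r powr (s - 1)" by (simp only: powr_diff)
  finally show "f (r /\<^sub>R norm r) = 1" using r unfolding f_def by simp
  show "\<zeta> v = norm r powr (s - 1) * f v" using r unfolding f_def by simp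
qed

lemma duality_mapping_exists:
  assumes V: "subspace V" and us: "uniformly_smooth_on V" and r: "r \<in> V" and s: "1 < s"
  shows "\<exists>\<zeta>. \<zeta> \<in> duality_mapping_on V s r"
proof (cases "r = 0")
  case True
  have "dual_norm_on V (\<lambda>v. 0) = 0"
    unfolding dual_norm_on_def using subspace_0[OF V] by (auto intro!: cSUP_const)
  then have "(\<lambda>v. 0) \<in> duality_mapping_on V s r"
    using True unfolding duality_mapping_on_def by (auto simp: dual_on_def intro!: exI[of _ 0])
  then show ?thesis by blast
next
  case False
  obtain f where f: "f \<in> dual_on V" "\<And>v. v \<in> V \<Longrightarrow> \<bar>f v\<bar> \<le> norm v" "f (r /\<^sub>R norm r) = 1"
    using uniformly_smooth_norming_functional[OF V us, of "r /\<^sub>R norm r"] V r False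
    by (auto simp: subspace_scale)
  define c where "c = norm r powr (s - 1)"
  define \<zeta> where "\<zeta> v = c * f v" for v
  have c: "0 < c" using False unfolding c_def by simp
  have zd: "\<zeta> \<in> dual_on V" unfolding dual_on_def
  proof (intro CollectI conjI ballI allI impI)
    show "\<exists>K. \<forall>v\<in>V. \<bar>\<zeta> v\<bar> \<le> K * norm v"
      using f(2) c by (intro exI[of _ c]) (simp add: \<zeta>_def abs_mult mult_left_mono)
  qed (use f(1) in \<open>auto simp: \<zeta>_def dual_on_def algebra_simps\<close>)
  have "f r / norm r = 1" using f(1,3) r unfolding dual_on_def by (simp add: divide_inverse mult.commute)
  then have "f r = norm r" using False by (simp add: divide_simps split: if_splits)
  then have "\<zeta> r = norm r powr (s - 1) * norm r powr 1" using False unfolding \<zeta>_def c_def by simp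
  also have "\<dots> = norm r powr s" by (simp only: powr_add[symmetric]) simp
  finally have zr: "\<zeta> r = norm r powr s" .
  have "dual_norm_on V \<zeta> \<le> c"
    using f(2) c by (intro dual_norm_on_le[OF V]) (auto simp: \<zeta>_def abs_mult mult_left_mono)
  moreover have "c \<le> dual_norm_on V \<zeta>"
    using dual_on_bound[OF V zd, of "r /\<^sub>R norm r"] f(3) c r V False by (simp add: \<zeta>_def subspace_scale)
  ultimately show ?thesis using zd zr unfolding duality_mapping_on_def c_def by (intro exI[of _ \<zeta>]) auto
qed

lemma duality_mapping_unique:
  assumes V: "subspace V" and us: "uniformly_smooth_on V" and r: "r \<in> V" and s: "1 < s"
    and z: "\<zeta> \<in> duality_mapping_on V s r" "\<zeta>' \<in> duality_mapping_on V s r"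
  shows "\<zeta> = \<zeta>'"
proof
  fix v
  show "\<zeta> v = \<zeta>' v"
  proof (cases "v \<in> V \<and> r \<noteq> 0")
    case False
    then show ?thesis
    proof (cases "v \<in> V")
      case True
      then show ?thesis using False z dual_on_bound[OF V, of \<zeta> v] dual_on_bound[OF V, of \<zeta>' v] s
        unfolding duality_mapping_on_def by auto
    qed (use z in \<open>auto simp: duality_mapping_on_def dual_on_def\<close>)
  next
    case True
    note n = duality_mapping_normalize[OF V r conjunct2[OF True] z(1)]
      duality_mapping_normalize[OF V r conjunct2[OF True] z(2)]
    have u: "r /\<^sub>R norm r \<in> V" "norm (r /\<^sub>R norm r) = 1" using True V r by (auto simp: subspace_scale)
    let ?f = "\<zeta> v / norm r powr (s - 1)" and ?f' = "\<zeta>' v / norm r powr (s - 1)"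
    have "\<bar>?f' - ?f\<bar> \<le> e" if e: "0 < e" for e
    proof -
      define e' where "e' = e / (norm v + 1)"
      have e': "0 < e'" using e unfolding e'_def by (simp add: add_nonneg_pos)
      have "\<bar>?f' - ?f\<bar> \<le> e' * norm v"
      proof (rule uniformly_smooth_norming_close[OF V us e'])
        fix d :: real assume d: "0 < d" and *: "\<And>u w f f' v. u \<in> V \<Longrightarrow> norm u = 1 \<Longrightarrow> w \<in> V \<Longrightarrow> norm (w - u) \<le> d \<Longrightarrow>
           f \<in> dual_on V \<Longrightarrow> (\<And>v. v \<in> V \<Longrightarrow> \<bar>f v\<bar> \<le> norm v) \<Longrightarrow> f u = 1 \<Longrightarrow>
           f' \<in> dual_on V \<Longrightarrow> (\<And>v. v \<in> V \<Longrightarrow> \<bar>f' v\<bar> \<le> norm v) \<Longrightarrow> f' w = 1 \<Longrightarrow>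
           v \<in> V \<Longrightarrow> \<bar>f' v - f v\<bar> \<le> e' * norm v"
        show ?thesis using *[OF u u(1) _ n(1,2,3) n(5,6,7)] d True by simp
      qed
      also have "\<dots> \<le> e" using e unfolding e'_def by (simp add: divide_simps mult_left_mono add_nonneg_pos)
      finally show ?thesis .
    qed
    then have "?f' = ?f" using field_le_epsilon[of "\<bar>?f' - ?f\<bar>" 0] by simp
    then show ?thesis using True by simp
  qed
qed

lemma jmap_in:
  assumes "subspace V" "uniformly_smooth_on V" "r \<in> V" "1 < s"
  shows "jmap V s r \<in> duality_mapping_on V s r"
proof -
  have "\<exists>!\<zeta>. \<zeta> \<in> duality_mapping_on V s r"
    using duality_mapping_exists[OF assms] duality_mapping_unique[OF assms] by blast
  then have "is_singleton (duality_mapping_on V s r)" by (auto simp: is_singleton_def)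
  then show ?thesis using is_singleton_the_elem by (metis insertI1)
qed

lemma jmap_bound:
  assumes "subspace V" "uniformly_smooth_on V" "r \<in> V" "1 < s" "v \<in> V"
  shows "\<bar>jmap V s r v\<bar> \<le> norm r powr (s - 1) * norm v"
  using dual_on_bound[OF assms(1), of "jmap V s r" v] jmap_in[OF assms(1-4)] assms(5)
  unfolding duality_mapping_on_def by simp

text \<open>
  At 0 this norm-to-norm continuity follows from the growth bound, since \<open>s > 1\<close>. Elsewhere both the factor \<open>norm (w k) powr (s - 1)\<close> and the norming functional
  converge.
\<close>

lemma jmap_continuous:
  fixes V :: "'b::real_normed_vector set"
  assumes V: "subspace V" and us: "uniformly_smooth_on V" and s: "1 < s"
    and r: "r \<in> V" and w: "\<forall>\<^sub>F k in G. w k \<in> V" "(w \<longlongrightarrow> r) G" and e: "0 < e"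
  shows "\<forall>\<^sub>F k in G. \<forall>v\<in>V. \<bar>jmap V s (w k) v - jmap V s r v\<bar> \<le> e * norm v"
proof (cases "r = 0")
  case True
  have "((\<lambda>k. norm (w k) powr (s - 1)) \<longlongrightarrow> norm r powr (s - 1)) G"
    using s by (intro tendsto_powr2 tendsto_norm w tendsto_const) auto
  then have "\<forall>\<^sub>F k in G. norm (w k) powr (s - 1) < e" using True e by (auto dest: order_tendstoD)
  with w(1) show ?thesis
  proof eventually_elim
    case (elim k)
    show ?case
    proof
      fix v assume v: "v \<in> V"
      have "jmap V s r v = 0" using jmap_bound[OF V us r s v] True by simp
      moreover have "norm (w k) powr (s - 1) * norm v \<le> e * norm v" using elim by (intro mult_right_mono) auto
      ultimately show "\<bar>jmap V s (w k) v - jmap V s r v\<bar> \<le> e * norm v"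
        using jmap_bound[OF V us elim(1) s v] by simp
    qed
  qed
next
  case False
  define a where "a = norm r powr (s - 1)"
  have a: "0 < a" using False unfolding a_def by simp
  have e2: "0 < e / (2 * a)" using e a by simp
  obtain d where d: "0 < d"
    "\<And>u w f f' v. u \<in> V \<Longrightarrow> norm u = 1 \<Longrightarrow> w \<in> V \<Longrightarrow> norm (w - u) \<le> d \<Longrightarrow>
       f \<in> dual_on V \<Longrightarrow> (\<And>v. v \<in> V \<Longrightarrow> \<bar>f v\<bar> \<le> norm v) \<Longrightarrow> f u = 1 \<Longrightarrow>
       f' \<in> dual_on V \<Longrightarrow> (\<And>v. v \<in> V \<Longrightarrow> \<bar>f' v\<bar> \<le> norm v) \<Longrightarrow> f' w = 1 \<Longrightarrow>
       v \<in> V \<Longrightarrow> \<bar>f' v - f v\<bar> \<le> e / (2 * a) * norm v"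
    using uniformly_smooth_norming_close[OF V us e2] by blast
  have "((\<lambda>k. norm (w k) powr (s - 1)) \<longlongrightarrow> a) G"
    unfolding a_def using s by (intro tendsto_powr2 tendsto_norm w tendsto_const) auto
  then have ev1: "\<forall>\<^sub>F k in G. \<bar>norm (w k) powr (s - 1) - a\<bar> < e / 2"
    using e unfolding tendsto_iff dist_real_def by (meson half_gt_zero)
  have ev2: "\<forall>\<^sub>F k in G. w k \<noteq> 0" using w(2) False by (rule tendsto_imp_eventually_ne)
  have "((\<lambda>k. w k /\<^sub>R norm (w k)) \<longlongrightarrow> r /\<^sub>R norm r) G"
    using w(2) False by (intro tendsto_intros) auto
  then have ev3: "\<forall>\<^sub>F k in G. norm (w k /\<^sub>R norm (w k) - r /\<^sub>R norm r) < d"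
    using d(1) by (auto simp: tendsto_iff dist_norm)
  note nr = duality_mapping_normalize[OF V r False jmap_in[OF V us r s]]
  from w(1) ev1 ev2 ev3 show ?thesis
  proof eventually_elim
    case (elim k)
    note nk = duality_mapping_normalize[OF V elim(1) elim(3) jmap_in[OF V us elim(1) s]]
    show ?case
    proof
      fix v assume v: "v \<in> V"
      define fr where "fr = jmap V s r v / norm r powr (s - 1)"
      define fk where "fk = jmap V s (w k) v / norm (w k) powr (s - 1)"
      have "\<bar>fk - fr\<bar> \<le> e / (2 * a) * norm v" unfolding fr_def fk_def
        using elim v V r False
        by (intro d(2)[OF _ _ _ _ nr(1,2,3) nk(1,2,3)]) (auto simp: subspace_scale)
      then have 1: "a * \<bar>fk - fr\<bar> \<le> e / 2 * norm v"
        using a by (simp add: field_simps)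
      have "\<bar>fk\<bar> \<le> norm v" unfolding fk_def by (rule nk(2)[OF v])
      then have 2: "\<bar>norm (w k) powr (s - 1) - a\<bar> * \<bar>fk\<bar> \<le> e / 2 * norm v"
        using elim e by (intro mult_mono) auto
      have "jmap V s (w k) v - jmap V s r v = (norm (w k) powr (s - 1) - a) * fk + a * (fk - fr)"
        using nk(4)[of v] nr(4)[of v] unfolding fr_def[symmetric] fk_def[symmetric] a_def
        by (simp add: algebra_simps)
      also have "\<bar>\<dots>\<bar> \<le> \<bar>norm (w k) powr (s - 1) - a\<bar> * \<bar>fk\<bar> + a * \<bar>fk - fr\<bar>"
        using a by (metis abs_mult abs_of_pos abs_triangle_ineq)
      finally show "\<bar>jmap V s (w k) v - jmap V s r v\<bar> \<le> e * norm v" using 1 2 by (simp add: field_simps)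
    qed
  qed
qed

lemma adjoint_apply_eq:
  fixes A :: "'a::real_normed_vector \<Rightarrow>\<^sub>L 'b::real_normed_vector"
  assumes "subspace V" "\<zeta> \<in> dual_on V" "\<And>h. blinfun_apply A h \<in> V"
  shows "blinfun_apply (adjoint_apply A \<zeta>) h = \<zeta> (blinfun_apply A h)"
proof -
  have "bounded_linear (\<lambda>h. \<zeta> (blinfun_apply A h))"
  proof (rule bounded_linear_intro[where K="dual_norm_on V \<zeta> * norm A"])
    fix h h' show "\<zeta> (blinfun_apply A (h + h')) = \<zeta> (blinfun_apply A h) + \<zeta> (blinfun_apply A h')"
      using assms by (simp add: dual_on_def blinfun.add_right)
  next
    fix c h show "\<zeta> (blinfun_apply A (c *\<^sub>R h)) = c *\<^sub>R \<zeta> (blinfun_apply A h)"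
      using assms by (simp add: dual_on_def blinfun.scaleR_right)
  next
    fix h
    have "\<bar>\<zeta> (blinfun_apply A h)\<bar> \<le> dual_norm_on V \<zeta> * norm (blinfun_apply A h)"
      using assms by (intro dual_on_bound) auto
    also have "\<dots> \<le> dual_norm_on V \<zeta> * (norm A * norm h)"
    proof (rule mult_left_mono[OF norm_blinfun])
      show "0 \<le> dual_norm_on V \<zeta>" using assms by (intro dual_norm_on_nonneg)
    qed
    finally show "norm (\<zeta> (blinfun_apply A h)) \<le> norm h * (dual_norm_on V \<zeta> * norm A)"
      by (simp add: ac_simps)
  qed
  then show ?thesis unfolding adjoint_apply_def by (simp add: bounded_linear_Blinfun_apply)
qed

lemma adjoint_jmap_tendsto:
  fixes A :: "'k \<Rightarrow> ('a::real_normed_vector \<Rightarrow>\<^sub>L 'b::real_normed_vector)"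
  assumes V: "subspace V" and us: "uniformly_smooth_on V" and s: "1 < s"
    and r: "r \<in> V" and w: "\<forall>\<^sub>F k in G. w k \<in> V" "(w \<longlongrightarrow> r) G"
    and A: "\<forall>\<^sub>F k in G. \<forall>h. blinfun_apply (A k) h \<in> V" "(A \<longlongrightarrow> B) G" "\<And>h. blinfun_apply B h \<in> V"
  shows "((\<lambda>k. adjoint_apply (A k) (jmap V s (w k))) \<longlongrightarrow> adjoint_apply B (jmap V s r)) G"
proof (rule tendstoI)
  fix e :: real assume e: "0 < e"
  define M where "M = norm B + 1"
  define R where "R = norm r powr (s - 1) + 1"
  have M: "0 < M" unfolding M_def by (simp add: add_nonneg_pos)
  have R: "0 < R" "norm r powr (s - 1) \<le> R" unfolding R_def by (auto simp: add_nonneg_pos)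
  have e1: "0 < e / (4 * M)" "0 < e / (4 * R)" using e M R by auto
  have "((\<lambda>k. norm (A k)) \<longlongrightarrow> norm B) G" using A(2) by (rule tendsto_norm)
  then have ev1: "\<forall>\<^sub>F k in G. norm (A k) < M" unfolding M_def by (rule order_tendstoD) simp
  have ev2: "\<forall>\<^sub>F k in G. norm (A k - B) < e / (4 * R)"
    using A(2) e1 by (auto simp: tendsto_iff dist_norm)
  from w(1) A(1) ev1 ev2 jmap_continuous[OF V us s r w e1(1)]
  show "\<forall>\<^sub>F k in G. dist (adjoint_apply (A k) (jmap V s (w k))) (adjoint_apply B (jmap V s r)) < e"
  proof eventually_elim
    case (elim k)
    have dk: "jmap V s (w k) \<in> dual_on V" and dr: "jmap V s r \<in> dual_on V"
      using jmap_in[OF V us elim(1) s] jmap_in[OF V us r s] unfolding duality_mapping_on_def by auto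
    have "norm (adjoint_apply (A k) (jmap V s (w k)) - adjoint_apply B (jmap V s r)) \<le> e / 2"
    proof (rule norm_blinfun_bound)
      show "0 \<le> e / 2" using e by simp
      fix h
      let ?a = "blinfun_apply (A k) h" and ?b = "blinfun_apply B h"
      have inV: "?a \<in> V" "?b \<in> V" using elim A by auto
      have "\<bar>jmap V s (w k) ?a - jmap V s r ?a\<bar> \<le> e / (4 * M) * norm ?a" using elim inV by blast
      also have "\<dots> \<le> e / (4 * M) * (M * norm h)"
      proof (rule mult_left_mono)
        show "norm ?a \<le> M * norm h"
          using norm_blinfun[of "A k" h] elim(3) mult_right_mono[of "norm (A k)" M "norm h"] by simp
      qed (use e1 in simp)
      finally have 1: "\<bar>jmap V s (w k) ?a - jmap V s r ?a\<bar> \<le> e / 4 * norm h" using M by simp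
      have "jmap V s r ?a = jmap V s r (?b + (?a - ?b))" by simp
      also have "\<dots> = jmap V s r ?b + jmap V s r (?a - ?b)"
        using dr inV V unfolding dual_on_def by (blast intro: subspace_diff)
      finally have "\<bar>jmap V s r ?a - jmap V s r ?b\<bar> = \<bar>jmap V s r (?a - ?b)\<bar>" by simp
      also have "\<dots> \<le> norm r powr (s - 1) * norm (?a - ?b)"
        using inV V by (intro jmap_bound[OF V us r s]) (simp add: subspace_diff)
      also have "\<dots> \<le> R * (e / (4 * R) * norm h)"
      proof (rule mult_mono)
        have "norm (?a - ?b) \<le> norm (A k - B) * norm h"
          using norm_blinfun[of "A k - B" h] by (simp add: blinfun.diff_left)
        also have "\<dots> \<le> e / (4 * R) * norm h" using elim by (intro mult_right_mono) auto
        finally show "norm (?a - ?b) \<le> e / (4 * R) * norm h" .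
      qed (use R in auto)
      finally have 2: "\<bar>jmap V s r ?a - jmap V s r ?b\<bar> \<le> e / 4 * norm h" using R by simp
      have "blinfun_apply (adjoint_apply (A k) (jmap V s (w k)) - adjoint_apply B (jmap V s r)) h
          = jmap V s (w k) ?a - jmap V s r ?b"
        using elim A(3) by (simp add: blinfun.diff_left adjoint_apply_eq[OF V dk] adjoint_apply_eq[OF V dr])
      then show "norm (blinfun_apply (adjoint_apply (A k) (jmap V s (w k)) - adjoint_apply B (jmap V s r)) h)
          \<le> e / 2 * norm h" using 1 2 unfolding real_norm_def by linarith
    qed
    then show ?case using e by (simp add: dist_norm)
  qed
qed

section \<open>Scalar inequalities\<close>

text \<open>
  The constant \<open>\<kappa>\<close> for \<open>p < s\<close> comes from convexity of \<open>x powr \<alpha>\<close> when 1 is split into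
  \<open>1 - v\<close> and \<open>v\<close> with weights such that the factor of \<open>(1 - v) powr \<alpha>\<close> is \<open>\<beta>\<close>.
\<close>

lemma one_minus_powr_bound:
  fixes \<alpha> \<beta> v :: real
  assumes v: "0 \<le> v" "v \<le> 1" and \<alpha>: "1 < \<alpha>" and \<beta>: "1 < \<beta>"
  shows "1 / \<beta> \<le> (1 - v) powr \<alpha> + (\<beta> powr (1 / (\<alpha> - 1)) - 1) powr (1 - \<alpha>) * v"
proof -
  define b where "b = \<beta> powr (1 / (\<alpha> - 1))"
  define \<kappa> where "\<kappa> = (b - 1) powr (1 - \<alpha>)"
  have b: "1 < b" unfolding b_def using \<alpha> \<beta> by (intro gr_one_powr) auto
  have bp: "b powr (\<alpha> - 1) = \<beta>" unfolding b_def using \<alpha> \<beta> by (simp add: powr_powr)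
  have \<kappa>: "0 < \<kappa>" unfolding \<kappa>_def using b by simp
  consider "v = 0" | "v = 1" | "0 < v" "v < 1" using v by linarith
  then have "1 / \<beta> \<le> (1 - v) powr \<alpha> + \<kappa> * v"
  proof cases
    case 1
    then show ?thesis using \<beta> by simp
  next
    case 2
    have "1 / \<beta> = b powr (1 - \<alpha>)" using bp b by (metis minus_diff_eq powr_minus_divide)
    also have "\<dots> \<le> \<kappa>" unfolding \<kappa>_def using b \<alpha> by (intro powr_mono2') auto
    finally show ?thesis using 2 by simp
  next
    case 3
    have cvx: "convex_on {0<..} (\<lambda>x::real. x powr \<alpha>)" using \<alpha> by (intro powr_convex) simp
    \<comment> \<open>The weights \<open>1 / b\<close> and \<open>1 - 1 / b\<close> are chosen because \<open>(1 / b) powr (1 - \<alpha>) = \<beta>\<close>.\<close>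
    have "(1 - (1 - 1 / b)) * ((1 - v) * b) + (1 - 1 / b) * (v * b / (b - 1)) = 1"
      using b by (simp add: field_simps)
    moreover have "((1 - (1 - 1 / b)) *\<^sub>R ((1 - v) * b) + (1 - 1 / b) *\<^sub>R (v * b / (b - 1))) powr \<alpha>
        \<le> (1 - (1 - 1 / b)) * ((1 - v) * b) powr \<alpha> + (1 - 1 / b) * (v * b / (b - 1)) powr \<alpha>"
      using b 3 by (intro convex_onD[OF cvx]) auto
    ultimately have "1 \<le> 1 / b * ((1 - v) * b) powr \<alpha> + (b - 1) / b * (v * b / (b - 1)) powr \<alpha>"
      using b by (simp add: diff_divide_distrib)
    also have "1 / b * ((1 - v) * b) powr \<alpha> = \<beta> * (1 - v) powr \<alpha>"
      unfolding bp[symmetric] using b 3 by (simp add: powr_mult powr_diff)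
    also have "(b - 1) / b * (v * b / (b - 1)) powr \<alpha> = \<beta> * (\<kappa> * v powr \<alpha>)"
      unfolding \<kappa>_def bp[symmetric] using b 3 by (simp add: powr_mult powr_divide powr_diff)
    also have "v powr \<alpha> \<le> v powr 1" using 3 \<alpha> by (intro powr_mono') auto
    finally have "1 \<le> \<beta> * ((1 - v) powr \<alpha> + \<kappa> * v)"
      using \<kappa> \<beta> 3 by (simp add: algebra_simps)
    then show ?thesis using \<beta> by (simp add: field_simps)
  qed
  then show ?thesis unfolding \<kappa>_def b_def .
qed

text \<open>
  The step size contains a power of \<open>h = a powr p + w\<close>, whereas the descent produces the power \<open>a powr s\<close> of the
  residual alone. After division by \<open>h\<close> only the fraction \<open>v = w / h\<close> matters. This is where \<open>\<beta>\<close> and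
  \<open>\<kappa>\<close> come from.
\<close>

lemma perturbed_power_bound:
  fixes p s a w h \<beta> \<kappa> :: real
  assumes p: "0 < p" and s: "0 < s" and a: "0 \<le> a" and w: "0 \<le> w" and h: "h = a powr p + w" "0 < h"
    and \<beta>: "1 < \<beta>" and \<kappa>: "\<kappa> = (if p \<ge> s then 1 else (\<beta> powr (p / (s - p)) - 1) powr ((p - s) / p))"
  shows "h / \<beta> - \<kappa> * w \<le> h powr (1 - s / p) * a powr s"
proof -
  define v where "v = w / h"
  have v: "0 \<le> v" "v \<le> 1" "w = v * h" using w h unfolding v_def by simp_all
  have "a powr p = h * (1 - v)" using h(1) v(3) by (simp add: algebra_simps)
  then have "(h * (1 - v)) powr (s / p) = (a powr p) powr (s / p)" by simp
  also have "\<dots> = a powr (p * (s / p))" by (rule powr_powr)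
  finally have "a powr s = h powr (s / p) * (1 - v) powr (s / p)"
    using p v(1,2) h(2) by (simp add: powr_mult)
  then have "h powr (1 - s / p) * a powr s = (h powr (1 - s / p) * h powr (s / p)) * (1 - v) powr (s / p)"
    by simp
  also have "h powr (1 - s / p) * h powr (s / p) = h"
    using h(2) by (simp flip: powr_add)
  finally have eq: "h powr (1 - s / p) * a powr s = h * (1 - v) powr (s / p)" .
  have "1 / \<beta> \<le> (1 - v) powr (s / p) + \<kappa> * v"
  proof (cases "p \<ge> s")
    case True
    have "(1 - v) powr 1 \<le> (1 - v) powr (s / p)" using True p v by (intro powr_mono') auto
    moreover have "1 / \<beta> \<le> 1" using \<beta> by simp
    ultimately show ?thesis using True \<kappa> v by simp
  next
    case False
    have "1 / (s / p - 1) = p / (s - p)" "1 - s / p = (p - s) / p"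
      using False p by (auto simp: field_simps)
    then show ?thesis using one_minus_powr_bound[OF v(1,2) _ \<beta>, of "s / p"] False p \<kappa> by simp
  qed
  then have "h * (1 / \<beta>) \<le> h * ((1 - v) powr (s / p) + \<kappa> * v)" using h(2) by (intro mult_left_mono) auto
  then show ?thesis using eq v(3) by (simp add: algebra_simps)
qed

lemma conjugate_exponent:
  fixes p ps :: real
  assumes p: "2 \<le> p" and ps: "1 / p + 1 / ps = 1"
  shows "1 < ps" "ps \<le> 2" "ps * p = ps + p" "ps / p = ps - 1"
proof -
  have "ps \<noteq> 0" using p ps by auto
  then have *: "ps * p = ps + p" using p ps by (simp add: field_simps)
  then have "ps * (p - 1) = p" by (simp add: algebra_simps)
  then have psv: "ps = p / (p - 1)" using p by (simp add: eq_divide_eq)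
  show "1 < ps" "ps \<le> 2" using p unfolding psv by (auto simp: divide_simps)
  show "ps * p = ps + p" by fact
  have "ps = (ps - 1) * p" using * by (simp add: algebra_simps)
  then show "ps / p = ps - 1" using p by (metis nonzero_mult_div_cancel_right not_numeral_le_zero)
qed

text \<open>
  Young's inequality for \<open>a * l\<close> and \<open>b / l\<close> with \<open>l powr p = c\<close>. The resulting constant is slightly enlarged, by means of
  \<open>p \<ge> 2\<close> and \<open>ps \<le> 2\<close>, to the form that occurs in the condition on \<open>\<beta>\<^sub>0\<close>.
\<close>

lemma young_pconvex:
  fixes p ps c a b :: real
  assumes p: "2 \<le> p" and ps: "1 / p + 1 / ps = 1" and c: "0 < c" and ab: "0 \<le> a" "0 \<le> b"
  shows "b * a - c / 2 * a powr p \<le> 2 / ps * (1 / (2 * c)) powr (ps - 1) * b powr ps"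
proof -
  note ps1 = conjugate_exponent[OF p ps]
  define l where "l = c powr (1 / p)"
  have l: "0 < l" using c unfolding l_def by simp
  have "(a * l) * (b / l) \<le> (a * l) powr p / p + (b / l) powr ps / ps"
    using p ps ps1 ab l by (intro Youngs_inequality) auto
  moreover have "(a * l) powr p = c * a powr p"
    using ab l c p by (simp add: powr_mult l_def powr_powr)
  moreover have "(b / l) powr ps = b powr ps / c powr (ps - 1)"
    using ab l c p ps1 by (simp add: powr_divide l_def powr_powr)
  ultimately have "b * a \<le> c * a powr p / p + b powr ps / (c powr (ps - 1)) / ps"
    using l by (simp add: ac_simps)
  also have "c * a powr p / p \<le> c * a powr p / 2" using p c by (intro divide_left_mono) auto
  also have "b powr ps / (c powr (ps - 1)) / ps \<le> 2 / ps * (1 / (2 * c)) powr (ps - 1) * b powr ps"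
  proof -
    have "(2::real) powr (ps - 1) \<le> 2 powr 1" using ps1 by (intro powr_mono) auto
    then have "1 / c powr (ps - 1) \<le> 2 * (1 / (2 * c)) powr (ps - 1)"
      using c by (simp add: powr_divide powr_mult divide_simps)
    then have "b powr ps / ps * (1 / c powr (ps - 1)) \<le> b powr ps / ps * (2 * (1 / (2 * c)) powr (ps - 1))"
      using ps1 by (intro mult_left_mono) auto
    then show ?thesis by (simp add: ac_simps)
  qed
  finally show ?thesis by simp
qed

section \<open>Bregman distances of a p-convex functional\<close>

locale pconvex_functional =
  fixes \<Theta> :: "'a::real_normed_vector \<Rightarrow> ereal" and p ps c\<^sub>0 :: real
  assumes p: "2 \<le> p" and ps: "1 / p + 1 / ps = 1" and c0: "0 < c\<^sub>0"
    and proper: "proper_fun \<Theta>" and lsc: "lower_semicont \<Theta>" and pconvex: "p_convex p c\<^sub>0 \<Theta>"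
begin

lemma ps_props: "1 < ps" "ps * p = ps + p" "0 < p"
  using conjugate_exponent[OF p ps] p by auto

lemma le_root:
  assumes a: "0 \<le> a" "a powr p \<le> b"
  shows "a \<le> b powr (1 / p)"
proof -
  have "a = (a powr p) powr (1 / p)" using a ps_props(3) by (simp add: powr_powr)
  also have "\<dots> \<le> b powr (1 / p)" using a ps_props(3) by (intro powr_mono2) auto
  finally show ?thesis .
qed

abbreviation dom where "dom \<equiv> eff_dom \<Theta>"

definition \<theta> where "\<theta> z = real_of_ereal (\<Theta> z)"

definition K\<^sub>0 where "K\<^sub>0 = 2 / ps * (1 / (2 * c\<^sub>0)) powr (ps - 1)"

text \<open>
  The real-valued counterpart of \<open>bregman\<close>; the two agree on the effective domain.
\<close>

definition breg where "breg e \<xi> z x = \<theta> z - \<theta> x - blinfun_apply \<xi> (z - x) + e"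

definition subgrad where "subgrad e \<xi> x \<longleftrightarrow>
  x \<in> dom \<and> (\<forall>z\<in>dom. \<theta> x + blinfun_apply \<xi> (z - x) - e \<le> \<theta> z)"

lemma \<Theta>_eq: "z \<in> dom \<Longrightarrow> \<Theta> z = ereal (\<theta> z)"
  using proper unfolding proper_fun_def eff_dom_def \<theta>_def
  by (cases "\<Theta> z") auto

lemma in_dom_iff: "z \<in> dom \<longleftrightarrow> \<Theta> z \<noteq> \<infinity>"
  unfolding eff_dom_def by (cases "\<Theta> z") auto

lemma bregman_eq: "z \<in> dom \<Longrightarrow> x \<in> dom \<Longrightarrow> bregman e \<Theta> \<xi> z x = ereal (breg e \<xi> z x)"
  unfolding bregman_def breg_def by (simp add: \<Theta>_eq)

lemma pconvexD:
  assumes "z \<in> dom" "x \<in> dom" "0 \<le> t" "t \<le> 1"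
  shows "t *\<^sub>R z + (1 - t) *\<^sub>R x \<in> dom"
    "\<theta> (t *\<^sub>R z + (1 - t) *\<^sub>R x) + c\<^sub>0 * t * (1 - t) * norm (z - x) powr p \<le> t * \<theta> z + (1 - t) * \<theta> x"
proof -
  have *: "\<Theta> (t *\<^sub>R z + (1 - t) *\<^sub>R x) + ereal (c\<^sub>0 * t * (1 - t) * norm (z - x) powr p)
      \<le> ereal (t * \<theta> z + (1 - t) * \<theta> x)"
    using pconvex[unfolded p_convex_def, rule_format, of t z x] assms
    by (simp add: \<Theta>_eq[OF assms(1)] \<Theta>_eq[OF assms(2)])
  then show d: "t *\<^sub>R z + (1 - t) *\<^sub>R x \<in> dom" unfolding in_dom_iff by auto
  show "\<theta> (t *\<^sub>R z + (1 - t) *\<^sub>R x) + c\<^sub>0 * t * (1 - t) * norm (z - x) powr p \<le> t * \<theta> z + (1 - t) * \<theta> x"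
    using * by (simp add: \<Theta>_eq[OF d])
qed

lemma \<Theta>_gt_eventually:
  assumes "ereal C < \<Theta> z" "(w \<longlongrightarrow> z) G"
  shows "\<forall>\<^sub>F k in G. ereal C < \<Theta> (w k)"
proof -
  have "ereal C < Liminf (at z) \<Theta>" using lsc assms(1) unfolding lower_semicont_def by (metis less_le_trans)
  then have "\<forall>\<^sub>F u in at z. ereal C < \<Theta> u" by (rule less_LiminfD)
  then have "\<forall>\<^sub>F u in nhds z. ereal C < \<Theta> u"
    using assms(1) unfolding eventually_nhds_conv_at by simp
  then show ?thesis using assms(2) unfolding filterlim_iff by blast
qed

lemma \<theta>_lsc:
  assumes "z \<in> dom" "(w \<longlongrightarrow> z) G" "0 < e" "\<forall>\<^sub>F k in G. w k \<in> dom"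
  shows "\<forall>\<^sub>F k in G. \<theta> z - e < \<theta> (w k)"
proof -
  have "ereal (\<theta> z - e) < \<Theta> z" using assms by (simp add: \<Theta>_eq)
  then have "\<forall>\<^sub>F k in G. ereal (\<theta> z - e) < \<Theta> (w k)" using \<Theta>_gt_eventually assms(2) by blast
  with assms(4) show ?thesis by eventually_elim (simp add: \<Theta>_eq)
qed

text \<open>
  Lower semicontinuity in the form that recovers membership in the effective domain: a limit of points with bounded
  values has a finite value.
\<close>

lemma sublevel_limit:
  assumes "(w \<longlongrightarrow> z) G" "G \<noteq> bot" "\<forall>\<^sub>F k in G. w k \<in> dom" "\<forall>\<^sub>F k in G. \<theta> (w k) \<le> C"
  shows "z \<in> dom" "\<theta> z \<le> C"
proof -
  have "\<Theta> z \<le> ereal C"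
  proof (rule ccontr)
    assume "\<not> \<Theta> z \<le> ereal C"
    then have "\<forall>\<^sub>F k in G. ereal C < \<Theta> (w k)" using \<Theta>_gt_eventually[OF _ assms(1)] by simp
    with assms(3,4) have "\<forall>\<^sub>F k in G. False" by eventually_elim (simp add: \<Theta>_eq)
    then show False using assms(2) by (simp add: trivial_limit_def)
  qed
  then show d: "z \<in> dom" unfolding in_dom_iff by auto
  show "\<theta> z \<le> C" using \<open>\<Theta> z \<le> ereal C\<close> by (simp add: \<Theta>_eq[OF d])
qed

lemma eps_subdiff_imp_subgrad:
  assumes "\<xi> \<in> eps_subdiff e \<Theta> x"
  shows "subgrad e \<xi> x"
proof -
  have *: "\<Theta> x + ereal (blinfun_apply \<xi> (z - x)) - ereal e \<le> \<Theta> z" for z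
    using assms unfolding eps_subdiff_def by blast
  obtain z where z: "z \<in> dom" using proper unfolding proper_fun_def by blast
  have x: "x \<in> dom" using *[of z] z unfolding in_dom_iff by (auto simp: \<Theta>_eq[OF z])
  show ?thesis unfolding subgrad_def using x *
    by (metis \<Theta>_eq ereal_less_eq(3) ereal_minus(1) plus_ereal.simps(1))
qed

text \<open>
  Comparing with any point \<open>z0\<close> of the domain shows that \<open>x\<close> has a finite value; the comparison with an
  arbitrary \<open>z\<close> is then the subgradient inequality.
\<close>

lemma subgrad_of_approx_minimizer:
  assumes "\<Theta> x - ereal (blinfun_apply \<xi> x) \<le> (INF z. \<Theta> z - ereal (blinfun_apply \<xi> z)) + ereal e"
  shows "subgrad e \<xi> x"
proof -
  have *: "\<Theta> x - ereal (blinfun_apply \<xi> x) \<le> (\<Theta> z - ereal (blinfun_apply \<xi> z)) + ereal e" for z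
    by (rule order_trans[OF assms]) (intro add_right_mono INF_lower UNIV_I)
  obtain z0 where z0: "z0 \<in> dom" using proper unfolding proper_fun_def by blast
  have x: "x \<in> dom" using *[of z0] unfolding in_dom_iff by (auto simp: \<Theta>_eq[OF z0])
  have "\<theta> x + blinfun_apply \<xi> (z - x) - e \<le> \<theta> z" if "z \<in> dom" for z
    using *[of z] by (simp add: \<Theta>_eq[OF that] \<Theta>_eq[OF x] blinfun.diff_right)
  then show ?thesis using x unfolding subgrad_def by blast
qed

lemma subgrad_mono: "subgrad e \<xi> x \<Longrightarrow> e \<le> e' \<Longrightarrow> subgrad e' \<xi> x"
  unfolding subgrad_def by force

lemma breg_nonneg: "subgrad e \<xi> x \<Longrightarrow> z \<in> dom \<Longrightarrow> 0 \<le> breg e \<xi> z x"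
  unfolding subgrad_def breg_def by force

text \<open>
  The subgradient inequality at the midpoint of \<open>x\<close> and \<open>z\<close>, combined with \<open>p\<close>-convexity there. The
  weight \<open>1/2\<close> doubles \<open>e\<close>, which accounts for the extra \<open>e\<close> on the right.
\<close>

lemma breg_lower:
  assumes x: "subgrad e \<xi> x" and z: "z \<in> dom"
  shows "c\<^sub>0 / 2 * norm (z - x) powr p \<le> breg e \<xi> z x + e"
proof -
  have xd: "x \<in> dom" using x unfolding subgrad_def by blast
  let ?m = "(1/2) *\<^sub>R z + (1 - 1/2) *\<^sub>R x"
  note m = pconvexD[OF z xd, of "1/2"]
  have "?m - x = (1/2) *\<^sub>R (z - x)" by (simp add: algebra_simps flip: scaleR_add_left)
  then have "\<theta> x + blinfun_apply \<xi> (z - x) / 2 - e \<le> \<theta> ?m"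
    using x m(1) unfolding subgrad_def by (auto simp: blinfun.scaleR_right dest!: bspec[where x="?m"])
  then show ?thesis using m(2) unfolding breg_def by (simp add: field_simps)
qed

lemma breg_three_point:
  "breg e' \<xi>' z x' = breg e \<xi> z x + breg e' \<xi>' x x' + blinfun_apply (\<xi> - \<xi>') (z - x) - e"
  unfolding breg_def by (simp add: blinfun.diff_left blinfun.diff_right)

lemma breg_swap:
  "breg e' \<xi>' x x' + breg e \<xi> x' x = blinfun_apply (\<xi> - \<xi>') (x - x') + e + e'"
  unfolding breg_def by (simp add: blinfun.diff_left blinfun.diff_right)

lemma young: "0 \<le> a \<Longrightarrow> 0 \<le> b \<Longrightarrow> b * a - c\<^sub>0 / 2 * a powr p \<le> K\<^sub>0 * b powr ps"
  unfolding K\<^sub>0_def by (rule young_pconvex[OF p ps c0])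

text \<open>
  The sum of the two Bregman distances between \<open>x\<close> and \<open>x'\<close> is linear in \<open>\<xi> - \<xi>'\<close> (\<open>breg_swap\<close>). Its other summand
  is at least \<open>c\<^sub>0 / 2 * norm (x - x') powr p\<close> up to \<open>e\<close>, and Young's inequality absorbs the distance \<open>norm (x - x')\<close>.
\<close>

lemma breg_upper:
  assumes x: "subgrad e \<xi> x" and x': "subgrad e' \<xi>' x'"
  shows "breg e' \<xi>' x x' \<le> K\<^sub>0 * norm (\<xi> - \<xi>') powr ps + 2 * e + e'"
proof -
  have "x' \<in> dom" using x' unfolding subgrad_def by blast
  have "blinfun_apply (\<xi> - \<xi>') (x - x') \<le> norm (\<xi> - \<xi>') * norm (x - x')"
    using norm_blinfun[of "\<xi> - \<xi>'" "x - x'"] by simp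
  then show ?thesis
    using breg_swap[of e' \<xi>' x x' e \<xi>] breg_lower[OF x \<open>x' \<in> dom\<close>] young[of "norm (x - x')" "norm (\<xi> - \<xi>')"]
    by (simp add: norm_minus_commute[of x' x])
qed

lemma subgrad_dist:
  assumes x: "subgrad e \<xi> x" and x': "subgrad e' \<xi>' x'"
  shows "c\<^sub>0 / 2 * norm (x - x') powr p \<le> K\<^sub>0 * norm (\<xi> - \<xi>') powr ps + 2 * e + 2 * e'"
  using breg_upper[OF x x'] breg_lower[OF x', of x] x unfolding subgrad_def by simp

end

section \<open>Consequences of the tangential cone condition\<close>

locale lk_setting = pconvex_functional \<Theta> p ps c\<^sub>0
  for \<Theta> :: "'a::banach \<Rightarrow> ereal" and p ps c\<^sub>0 :: real +
  fixes N :: nat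
    and Y :: "nat \<Rightarrow> 'b::banach set"
    and D :: "nat \<Rightarrow> 'a set"
    and F :: "nat \<Rightarrow> 'a \<Rightarrow> 'b"
    and y :: "nat \<Rightarrow> 'b"
    and L :: "nat \<Rightarrow> 'a \<Rightarrow> ('a \<Rightarrow>\<^sub>L 'b)"
    and S :: "real \<Rightarrow> ('a \<Rightarrow>\<^sub>L real) \<Rightarrow> 'a"
    and \<epsilon> :: "nat \<Rightarrow> real"
    and s \<rho> \<gamma> \<beta> \<beta>\<^sub>0 \<beta>\<^sub>1 \<tau> \<sigma> \<kappa> :: real
    and x\<^sub>0 :: 'a
    and \<xi>\<^sub>0 :: "'a \<Rightarrow>\<^sub>L real"
  assumes N: "0 < N"
    and s: "1 < s"
    and Y: "\<And>i. i < N \<Longrightarrow> subspace (Y i) \<and> uniformly_smooth_on (Y i)"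
    and F: "\<And>i z. i < N \<Longrightarrow> z \<in> D i \<Longrightarrow> F i z \<in> Y i"
    and y: "\<And>i. i < N \<Longrightarrow> y i \<in> Y i"
    and A1b: "0 < \<rho>" "\<xi>\<^sub>0 \<in> eps_subdiff 0 \<Theta> x\<^sub>0" "cball x\<^sub>0 (2 * \<rho>) \<subseteq> (\<Inter>i<N. D i)"
      "\<exists>x\<^sub>d. x\<^sub>d \<in> eff_dom \<Theta> \<and> solves_system N D F y x\<^sub>d \<and>
             bregman 0 \<Theta> \<xi>\<^sub>0 x\<^sub>d x\<^sub>0 \<le> ereal (1 / 4 * c\<^sub>0 * \<rho> powr p)"
    and A1c: "0 \<le> \<gamma>" "\<gamma> < 1"
      "\<And>i z h. i < N \<Longrightarrow> z \<in> cball x\<^sub>0 (2 * \<rho>) \<Longrightarrow> blinfun_apply (L i z) h \<in> Y i"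
      "\<And>i. i < N \<Longrightarrow> continuous_on (cball x\<^sub>0 (2 * \<rho>)) (L i)"
      "\<And>i z' z. i < N \<Longrightarrow> z' \<in> cball x\<^sub>0 (2 * \<rho>) \<Longrightarrow> z \<in> cball x\<^sub>0 (2 * \<rho>) \<Longrightarrow>
         norm (F i z' - F i z - blinfun_apply (L i z) (z' - z)) \<le> \<gamma> * norm (F i z' - F i z)"
    and A2: "\<And>e. 0 < e \<Longrightarrow> continuous_on UNIV (S e)"
      "\<And>e \<zeta>. 0 < e \<Longrightarrow> \<Theta> (S e \<zeta>) - ereal (blinfun_apply \<zeta> (S e \<zeta>))
                      \<le> (INF z. \<Theta> z - ereal (blinfun_apply \<zeta> z)) + ereal e"
    and eps: "\<And>n. 0 < \<epsilon> n" "summable \<epsilon>" "16 * (\<Sum>n. \<epsilon> n) \<le> c\<^sub>0 * \<rho> powr p"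
    and beta: "1 < \<beta>" "0 < \<beta>\<^sub>1" "0 < \<beta>\<^sub>0" and tau: "1 < \<tau>"
    and pos: "1 / \<beta> - \<gamma> - (1 + \<gamma>) / \<tau> - 2 / ps * (\<beta>\<^sub>0 / (2 * c\<^sub>0)) powr (ps - 1) > 0"
    and kappa: "\<kappa> = (if p \<ge> s then 1 else (\<beta> powr (p / (s - p)) - 1) powr ((p - s) / p))"
    and sigma: "0 < \<sigma>" "\<kappa> * \<beta>\<^sub>1 * \<sigma> \<le> 1"
begin

abbreviation B\<^sub>2 where "B\<^sub>2 \<equiv> cball x\<^sub>0 (2 * \<rho>)"

definition sol where "sol z \<longleftrightarrow> solves_system N D F y z \<and> z \<in> B\<^sub>2 \<and> z \<in> dom"

lemma solD: "sol z \<Longrightarrow> i < N \<Longrightarrow> F i z = y i" "sol z \<Longrightarrow> z \<in> B\<^sub>2" "sol z \<Longrightarrow> z \<in> dom"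
  unfolding sol_def solves_system_def by auto

lemma x0_ball: "x\<^sub>0 \<in> B\<^sub>2" using A1b(1) by simp

lemma tangential_cone:
  assumes "i < N" "z \<in> B\<^sub>2" "z' \<in> B\<^sub>2"
  shows "norm (blinfun_apply (L i z) (z' - z)) \<le> (1 + \<gamma>) * norm (F i z' - F i z)"
    "(1 - \<gamma>) * norm (F i z' - F i z) \<le> norm (blinfun_apply (L i z) (z' - z))"
proof -
  let ?f = "F i z' - F i z" and ?l = "blinfun_apply (L i z) (z' - z)"
  have "norm (?f - ?l) \<le> \<gamma> * norm ?f" using A1c(5)[OF assms(1,3,2)] .
  moreover have "norm ?l \<le> norm ?f + norm (?f - ?l)" "norm ?f \<le> norm ?l + norm (?f - ?l)"
    using norm_triangle_ineq4[of ?f "?f - ?l"] norm_triangle_ineq[of ?l "?f - ?l"] by auto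
  ultimately show "norm ?l \<le> (1 + \<gamma>) * norm ?f" "(1 - \<gamma>) * norm ?f \<le> norm ?l"
    by (auto simp: algebra_simps)
qed

definition Lb where "Lb = 1 + (\<Sum>i<N. 4 * (1 + \<gamma>) / (1 - \<gamma>) * norm (L i x\<^sub>0))"

text \<open>
  A continuous family need not be bounded on a ball of an infinite-dimensional space. Here the tangential cone
  condition at \<open>x\<^sub>0\<close> bounds \<open>F i\<close> on the ball, and the condition at \<open>z\<close> then bounds \<open>L i z\<close> on
  differences of points of the ball, hence in every direction.
\<close>

lemma L_bounded:
  assumes i: "i < N" and z: "z \<in> B\<^sub>2"
  shows "norm (L i z) \<le> Lb"
proof -
  define M where "M = norm (L i x\<^sub>0) * (2 * \<rho>) / (1 - \<gamma>)"
  have F0: "norm (F i w - F i x\<^sub>0) \<le> M" if w: "w \<in> B\<^sub>2" for w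
  proof -
    have "(1 - \<gamma>) * norm (F i w - F i x\<^sub>0) \<le> norm (blinfun_apply (L i x\<^sub>0) (w - x\<^sub>0))"
      by (rule tangential_cone(2)[OF i x0_ball w])
    also have "\<dots> \<le> norm (L i x\<^sub>0) * norm (w - x\<^sub>0)" by (rule norm_blinfun)
    also have "\<dots> \<le> norm (L i x\<^sub>0) * (2 * \<rho>)"
      using w by (intro mult_left_mono) (auto simp: dist_norm norm_minus_commute)
    finally show ?thesis using A1c(2) unfolding M_def by (simp add: pos_le_divide_eq mult.commute)
  qed
  have Lz: "norm (blinfun_apply (L i z) (w - z)) \<le> (1 + \<gamma>) * (2 * M)" if w: "w \<in> B\<^sub>2" for w
  proof -
    have "norm (F i w - F i z) \<le> norm (F i w - F i x\<^sub>0) + norm (F i z - F i x\<^sub>0)"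
      using norm_triangle_ineq4[of "F i w - F i x\<^sub>0" "F i z - F i x\<^sub>0"] by simp
    then have "norm (F i w - F i z) \<le> 2 * M" using F0[OF w] F0[OF z] by simp
    then have "(1 + \<gamma>) * norm (F i w - F i z) \<le> (1 + \<gamma>) * (2 * M)" using A1c by (intro mult_left_mono) auto
    then show ?thesis using tangential_cone(1)[OF i z w] by simp
  qed
  have "norm (L i z) \<le> 4 * (1 + \<gamma>) / (1 - \<gamma>) * norm (L i x\<^sub>0)"
  proof (rule norm_blinfun_bound)
    show "0 \<le> 4 * (1 + \<gamma>) / (1 - \<gamma>) * norm (L i x\<^sub>0)" using A1c by simp
    fix h
    show "norm (blinfun_apply (L i z) h) \<le> 4 * (1 + \<gamma>) / (1 - \<gamma>) * norm (L i x\<^sub>0) * norm h"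
    proof (cases "h = 0")
      case False
      define c where "c = 2 * \<rho> / norm h"
      have c: "0 < c" using False A1b(1) unfolding c_def by simp
      have w: "x\<^sub>0 + c *\<^sub>R h \<in> B\<^sub>2" using False A1b(1) unfolding c_def by (simp add: dist_norm)
      have "c *\<^sub>R h = (x\<^sub>0 + c *\<^sub>R h - z) - (x\<^sub>0 - z)" by simp
      then have "blinfun_apply (L i z) (c *\<^sub>R h)
          = blinfun_apply (L i z) (x\<^sub>0 + c *\<^sub>R h - z) - blinfun_apply (L i z) (x\<^sub>0 - z)"
        by (metis blinfun.diff_right)
      then have "norm (blinfun_apply (L i z) (c *\<^sub>R h)) \<le> (1 + \<gamma>) * (2 * M) + (1 + \<gamma>) * (2 * M)"
        using Lz[OF w] Lz[OF x0_ball] norm_triangle_ineq4 by (smt (verit, best))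
      then have "c * norm (blinfun_apply (L i z) h) \<le> 4 * (1 + \<gamma>) * M"
        using c by (simp add: blinfun.scaleR_right algebra_simps)
      also have "\<dots> = c * (4 * (1 + \<gamma>) / (1 - \<gamma>) * norm (L i x\<^sub>0) * norm h)"
        using False unfolding c_def M_def by simp
      finally show ?thesis using c by (rule mult_left_le_imp_le)
    qed simp
  qed
  also have "\<dots> \<le> (\<Sum>i<N. 4 * (1 + \<gamma>) / (1 - \<gamma>) * norm (L i x\<^sub>0))"
    using i A1c by (intro member_le_sum[where f="\<lambda>i. 4 * (1 + \<gamma>) / (1 - \<gamma>) * norm (L i x\<^sub>0)"]) auto
  also have "\<dots> \<le> Lb" unfolding Lb_def by simp
  finally show ?thesis .
qed

lemma Lb_pos: "0 < Lb"
proof -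
  have "0 \<le> (\<Sum>i<N. 4 * (1 + \<gamma>) / (1 - \<gamma>) * norm (L i x\<^sub>0))" using A1c by (intro sum_nonneg) auto
  then show ?thesis unfolding Lb_def by linarith
qed

lemma F_lipschitz:
  assumes "i < N" "z \<in> B\<^sub>2" "z' \<in> B\<^sub>2"
  shows "norm (F i z' - F i z) \<le> Lb / (1 - \<gamma>) * norm (z' - z)"
proof -
  have "(1 - \<gamma>) * norm (F i z' - F i z) \<le> norm (L i z) * norm (z' - z)"
    using tangential_cone(2)[OF assms] norm_blinfun[of "L i z" "z' - z"] by linarith
  also have "\<dots> \<le> Lb * norm (z' - z)" using L_bounded assms by (intro mult_right_mono) auto
  finally show ?thesis using A1c by (simp add: pos_le_divide_eq mult.commute)
qed

lemma F_tendsto: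
  assumes "i < N" "(w \<longlongrightarrow> z) G" "z \<in> B\<^sub>2" "\<forall>\<^sub>F k in G. w k \<in> B\<^sub>2"
  shows "((\<lambda>k. F i (w k)) \<longlongrightarrow> F i z) G"
proof (rule Lim_null_comparison[THEN LIM_zero_cancel])
  show "\<forall>\<^sub>F k in G. norm (F i (w k) - F i z) \<le> Lb / (1 - \<gamma>) * norm (w k - z)"
    using assms(4) by eventually_elim (use F_lipschitz assms in auto)
  show "((\<lambda>k. Lb / (1 - \<gamma>) * norm (w k - z)) \<longlongrightarrow> 0) G"
  proof -
    have "((\<lambda>k. Lb / (1 - \<gamma>) * norm (w k - z)) \<longlongrightarrow> Lb / (1 - \<gamma>) * norm (z - z)) G"
      by (intro tendsto_intros assms)
    then show ?thesis by simp
  qed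
qed

section \<open>Step sizes\<close>

text \<open>
  The factor written \<open>\<mu>'\<close> in the definition of the iteration, as a function of the norms \<open>a\<close> of the residual and \<open>b\<close>
  of the gradient.
\<close>

definition relax where
  "relax a b = (if b powr p = 0 then \<beta>\<^sub>1 else min (\<beta>\<^sub>0 * a powr (p * (s - 1)) / b powr p) \<beta>\<^sub>1)"

text \<open>
  A positive lower bound for the relaxation factor; it uses that the gradient is at most \<open>Lb * a powr (s - 1)\<close>.
\<close>

definition m\<^sub>0 where "m\<^sub>0 = min (\<beta>\<^sub>0 / Lb powr p) \<beta>\<^sub>1"

lemma m0_pos: "0 < m\<^sub>0" unfolding m\<^sub>0_def using beta Lb_pos by simp

lemma relax_le: "relax a b \<le> \<beta>\<^sub>1" unfolding relax_def by simp

lemma relax_nonneg: "0 \<le> relax a b" unfolding relax_def using beta by simp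

lemma relax_ge:
  assumes "0 \<le> a" "0 \<le> b" "b \<le> Lb * a powr (s - 1)"
  shows "m\<^sub>0 \<le> relax a b"
proof (cases "b = 0")
  case False
  then have b: "0 < b" using assms by simp
  have "0 < Lb * a powr (s - 1)" using b assms(3) by linarith
  then have a: "0 < a" using assms(1) by (cases "a = 0") auto
  have "b powr p \<le> (Lb * a powr (s - 1)) powr p" using assms b ps_props(3) by (intro powr_mono2) auto
  also have "\<dots> = Lb powr p * a powr (p * (s - 1))"
    using Lb_pos by (simp add: powr_mult powr_powr mult.commute)
  finally have "\<beta>\<^sub>0 / Lb powr p \<le> \<beta>\<^sub>0 * a powr (p * (s - 1)) / b powr p"
    using b beta Lb_pos by (simp add: divide_simps mult.commute)
  then show ?thesis unfolding m\<^sub>0_def relax_def by auto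
qed (simp add: relax_def m\<^sub>0_def)

text \<open>
  The left-hand side is \<open>norm (\<mu> *\<^sub>R g) powr ps\<close>, the quantity that enters \<open>breg_upper\<close>. One factor of the relaxation
  parameter is kept, the remaining power \<open>ps - 1\<close> is estimated by the first term of the minimum, which cancels
  \<open>b powr ps\<close>. The exponents of \<open>h\<close> then add up to 1 because \<open>ps / p = ps - 1\<close>.
\<close>

lemma relax_step:
  assumes a: "0 \<le> a" and b: "0 \<le> b" and h: "0 < h" "a powr p \<le> h"
  shows "(relax a b * h powr (1 - s / p) * b) powr ps \<le> \<beta>\<^sub>0 powr (ps - 1) * (relax a b * h)"
proof (cases "b = 0")
  case True
  then show ?thesis using relax_nonneg h by simp
next
  case False
  then have b0: "0 < b" using b by simp
  define m where "m = relax a b"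
  have m: "0 \<le> m" "m \<le> \<beta>\<^sub>0 * a powr (p * (s - 1)) / b powr p"
    unfolding m_def using relax_nonneg b0 by (simp, simp add: relax_def)
  have pp: "p * (ps - 1) = ps" "ps / p = ps - 1"
    using ps_props conjugate_exponent[OF p ps] by (auto simp: algebra_simps)
  have "m powr (ps - 1) \<le> (\<beta>\<^sub>0 * a powr (p * (s - 1)) / b powr p) powr (ps - 1)"
    using m ps_props by (intro powr_mono2) auto
  also have "\<dots> = \<beta>\<^sub>0 powr (ps - 1) * a powr (p * (s - 1) * (ps - 1)) / b powr (p * (ps - 1))"
    using beta by (simp add: powr_mult powr_divide powr_powr)
  also have "p * (s - 1) * (ps - 1) = p * ((s - 1) * (ps - 1))" by simp
  also have "a powr (p * ((s - 1) * (ps - 1))) = (a powr p) powr ((s - 1) * (ps - 1))" by (simp add: powr_powr)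
  finally have "m powr (ps - 1) \<le> \<beta>\<^sub>0 powr (ps - 1) * (a powr p) powr ((s - 1) * (ps - 1)) / b powr ps"
    unfolding pp .
  also have "\<dots> \<le> \<beta>\<^sub>0 powr (ps - 1) * h powr ((s - 1) * (ps - 1)) / b powr ps"
    using h s ps_props b0 by (intro divide_right_mono mult_left_mono powr_mono2) auto
  finally have "m powr (ps - 1) * b powr ps \<le> \<beta>\<^sub>0 powr (ps - 1) * h powr ((s - 1) * (ps - 1))"
    using b0 by (simp add: pos_le_divide_eq)
  then have "m * h powr ((1 - s / p) * ps) * (m powr (ps - 1) * b powr ps)
      \<le> m * h powr ((1 - s / p) * ps) * (\<beta>\<^sub>0 powr (ps - 1) * h powr ((s - 1) * (ps - 1)))"
    using m by (intro mult_left_mono) auto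
  also have "\<dots> = \<beta>\<^sub>0 powr (ps - 1) * (m * h powr ((1 - s / p) * ps + (s - 1) * (ps - 1)))"
    by (simp add: powr_add)
  also have "(1 - s / p) * ps + (s - 1) * (ps - 1) = ps - s * (ps / p) + (s - 1) * (ps - 1)"
    by (simp add: algebra_simps)
  also have "\<dots> = 1" unfolding pp(2) by (simp add: algebra_simps)
  also have "m * h powr ((1 - s / p) * ps) * (m powr (ps - 1) * b powr ps) = (m * h powr (1 - s / p) * b) powr ps"
  proof -
    have "m powr ps = m powr (1 + (ps - 1))" by simp
    also have "\<dots> = m * m powr (ps - 1)" using m by (simp only: powr_add powr_one)
    finally show ?thesis using m h b by (simp add: powr_mult powr_powr)
  qed
  finally show ?thesis using h unfolding m_def by simp
qed

text \<open>
  The bracket on the right-hand side is the decrease that the cone condition guarantees. The threshold for \<open>\<delta>\<close> turns the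
  noise term into the share \<open>(1 + \<gamma>) / \<tau>\<close> of \<open>h\<close>.
\<close>

lemma residual_descent:
  assumes a: "0 \<le> a" and e: "0 < e" and h: "h = a powr p + \<sigma> * e" and \<delta>: "0 \<le> \<delta>" "(\<tau> * \<delta>) powr p < h"
  shows "(1 / \<beta> - \<gamma> - (1 + \<gamma>) / \<tau>) * h - \<kappa> * (\<sigma> * e)
    \<le> h powr (1 - s / p) * (a powr s - a powr (s - 1) * (\<gamma> * a + (1 + \<gamma>) * \<delta>))"
proof -
  have h0: "0 < h" using h e sigma by (simp add: add_nonneg_pos)
  have p0: "0 < p" using p by simp
  have ah: "a \<le> h powr (1 / p)"
  proof -
    have "a = (a powr p) powr (1 / p)" using a p0 by (simp add: powr_powr)
    also have "\<dots> \<le> h powr (1 / p)" using h e sigma p0 by (intro powr_mono2) auto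
    finally show ?thesis .
  qed
  have \<delta>h: "\<delta> \<le> h powr (1 / p) / \<tau>"
  proof -
    have "\<tau> * \<delta> = ((\<tau> * \<delta>) powr p) powr (1 / p)" using \<delta> tau p0 by (simp add: powr_powr)
    also have "\<dots> \<le> h powr (1 / p)" using \<delta> p0 by (intro powr_mono2) auto
    finally show ?thesis using tau by (simp add: pos_le_divide_eq mult.commute)
  qed
  have "a powr (s - 1) \<le> (h powr (1 / p)) powr (s - 1)" using a ah s by (intro powr_mono2) auto
  then have as: "a powr (s - 1) \<le> h powr ((s - 1) / p)" by (simp add: powr_powr)
  have "h powr (1 - s / p) * (a powr (s - 1) * (\<gamma> * a + (1 + \<gamma>) * \<delta>))
    \<le> h powr (1 - s / p) * (h powr ((s - 1) / p) * (\<gamma> * h powr (1 / p) + (1 + \<gamma>) * (h powr (1 / p) / \<tau>)))"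
    using A1c a \<delta> ah \<delta>h as by (intro mult_mono add_mono) auto
  also have "\<dots> = (h powr (1 - s / p) * h powr ((s - 1) / p) * h powr (1 / p)) * (\<gamma> + (1 + \<gamma>) / \<tau>)"
    by (simp add: algebra_simps)
  also have "h powr (1 - s / p) * h powr ((s - 1) / p) * h powr (1 / p) = h powr (1 - s / p + (s - 1) / p + 1 / p)"
    by (simp only: powr_add)
  also have "1 - s / p + (s - 1) / p + 1 / p = 1" by (simp add: diff_divide_distrib)
  finally have "h powr (1 - s / p) * (a powr (s - 1) * (\<gamma> * a + (1 + \<gamma>) * \<delta>)) \<le> h * (\<gamma> + (1 + \<gamma>) / \<tau>)"
    using h0 by simp
  moreover have "h / \<beta> - \<kappa> * (\<sigma> * e) \<le> h powr (1 - s / p) * a powr s"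
    using p0 s a e sigma h h0 beta kappa by (intro perturbed_power_bound) auto
  ultimately show ?thesis by (simp add: algebra_simps)
qed

definition c\<^sub>3 where
  "c\<^sub>3 = 1 / \<beta> - \<gamma> - (1 + \<gamma>) / \<tau> - 2 / ps * (\<beta>\<^sub>0 / (2 * c\<^sub>0)) powr (ps - 1)"

lemma c3_eq: "c\<^sub>3 = 1 / \<beta> - \<gamma> - (1 + \<gamma>) / \<tau> - K\<^sub>0 * \<beta>\<^sub>0 powr (ps - 1)"
proof -
  have "(\<beta>\<^sub>0 / (2 * c\<^sub>0)) powr (ps - 1) = (1 / (2 * c\<^sub>0)) powr (ps - 1) * \<beta>\<^sub>0 powr (ps - 1)"
    using beta c0 by (simp flip: powr_mult)
  then show ?thesis unfolding c\<^sub>3_def K\<^sub>0_def by simp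
qed

lemma c3_pos: "0 < c\<^sub>3" unfolding c\<^sub>3_def using pos by simp

lemma K0_nonneg: "0 \<le> K\<^sub>0" unfolding K\<^sub>0_def using ps_props by simp

text \<open>
  The amount by which one step may increase the Bregman distance to a solution.
\<close>

definition w where "w k = 2 * \<epsilon> k + \<epsilon> (Suc k)"

lemma w_summable: "summable w"
  unfolding w_def using eps(2) by (intro summable_add summable_mult) (simp_all add: summable_Suc_iff)

lemma w_nonneg: "0 \<le> w k" unfolding w_def using eps(1) by (simp add: add_nonneg_nonneg less_imp_le)

lemma eps_le: "16 * \<epsilon> n \<le> c\<^sub>0 * \<rho> powr p"
proof -
  have "\<epsilon> n \<le> (\<Sum>n. \<epsilon> n)" using sum_le_suminf[OF eps(2), of "{n}"] eps(1) by (simp add: less_imp_le)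
  then show ?thesis using eps(3) by linarith
qed

lemma sum_w_le: "16 * (\<epsilon> 0 + sum w {..<n}) \<le> 3 * (c\<^sub>0 * \<rho> powr p)"
proof -
  have "\<epsilon> 0 + sum w {..<n} = 2 * sum \<epsilon> {..<n} + sum \<epsilon> {..<Suc n}"
    unfolding w_def sum.lessThan_Suc_shift by (simp add: sum.distrib sum_distrib_left)
  also have "\<dots> \<le> 2 * (\<Sum>n. \<epsilon> n) + (\<Sum>n. \<epsilon> n)"
    using eps by (intro add_mono mult_left_mono sum_le_suminf) (auto simp: less_imp_le)
  finally have "\<epsilon> 0 + sum w {..<n} \<le> 3 * (\<Sum>n. \<epsilon> n)" by simp
  then have "16 * (\<epsilon> 0 + sum w {..<n}) \<le> 3 * (16 * (\<Sum>n. \<epsilon> n))" by simp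
  also have "\<dots> \<le> 3 * (c\<^sub>0 * \<rho> powr p)" by (intro mult_left_mono eps(3)) simp
  finally show ?thesis .
qed

text \<open>
  In units of \<open>c\<^sub>0 * \<rho> powr p\<close>, the initial distance contributes at most \<open>1/4\<close>, the accumulated errors at most
  \<open>3/16\<close> and the \<open>\<epsilon>\<close> in \<open>breg_lower\<close> at most \<open>1/16\<close>. Together this is the \<open>1/2\<close> required here.
\<close>

lemma radius:
  assumes "c\<^sub>0 / 2 * norm (z - u) powr p \<le> 1 / 2 * (c\<^sub>0 * \<rho> powr p)"
  shows "norm (z - u) \<le> \<rho>"
proof (rule ccontr)
  assume "\<not> norm (z - u) \<le> \<rho>"
  then have "\<rho> powr p < norm (z - u) powr p" using A1b(1) ps_props by (intro powr_less_mono2) auto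
  then show False using assms c0 by simp
qed

lemma reference_solution:
  "\<exists>z. sol z \<and> norm (z - x\<^sub>0) \<le> \<rho> \<and> breg 0 \<xi>\<^sub>0 z x\<^sub>0 \<le> 1 / 4 * c\<^sub>0 * \<rho> powr p"
proof -
  obtain z where z: "z \<in> dom" "solves_system N D F y z" "bregman 0 \<Theta> \<xi>\<^sub>0 z x\<^sub>0 \<le> ereal (1 / 4 * c\<^sub>0 * \<rho> powr p)"
    using A1b(4) by blast
  have x0: "subgrad 0 \<xi>\<^sub>0 x\<^sub>0" using eps_subdiff_imp_subgrad[OF A1b(2)] .
  then have x0d: "x\<^sub>0 \<in> dom" unfolding subgrad_def by blast
  have D0: "breg 0 \<xi>\<^sub>0 z x\<^sub>0 \<le> 1 / 4 * c\<^sub>0 * \<rho> powr p" using z(3) bregman_eq[OF z(1) x0d] by simp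
  have "0 \<le> c\<^sub>0 * \<rho> powr p" using c0 by simp
  then have z0: "norm (z - x\<^sub>0) \<le> \<rho>" using breg_lower[OF x0 z(1)] D0 by (intro radius) linarith
  then have "sol z" using z A1b(1) unfolding sol_def by (simp add: dist_norm norm_minus_commute)
  then show ?thesis using z0 D0 by blast
qed

end

section \<open>The one-step estimate\<close>

text \<open>
  One run of the iteration. Exact data are the case \<open>\<delta> = 0\<close> and \<open>yd = y\<close>: the threshold \<open>(\<tau> * \<delta>) powr p\<close> is then 0,
  every step is active, and all estimates below apply to the exact iteration as well.
\<close>

locale lk_run = lk_setting +
  fixes \<delta> :: real and yd :: "nat \<Rightarrow> 'b" and \<xi> :: "nat \<Rightarrow> ('a \<Rightarrow>\<^sub>L real)" and x :: "nat \<Rightarrow> 'a" and q :: "nat \<Rightarrow> nat"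
  assumes \<delta>: "0 \<le> \<delta>"
    and data: "\<And>i. i < N \<Longrightarrow> yd i \<in> Y i \<and> norm (yd i - y i) \<le> \<delta>"
    and run: "landweber_kaczmarz N Y F L S \<epsilon> p s \<beta>\<^sub>0 \<beta>\<^sub>1 \<tau> \<sigma> x\<^sub>0 \<xi>\<^sub>0 \<delta> yd \<xi> x q"
begin

definition r where "r n = F (n mod N) (x n) - yd (n mod N)"
definition h where "h n = norm (r n) powr p + \<sigma> * \<epsilon> n"
definition g where "g n = adjoint_apply (L (n mod N) (x n)) (jmap (Y (n mod N)) s (r n))"
definition \<mu>' where "\<mu>' n = relax (norm (r n)) (norm (g n))"
definition active where "active n \<longleftrightarrow> (\<tau> * \<delta>) powr p < h n"
definition \<mu> where "\<mu> n = (if active n then \<mu>' n * h n powr (1 - s / p) else 0)"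

lemma run_simps:
  "x 0 = x\<^sub>0" "\<xi> 0 = \<xi>\<^sub>0"
  "q n = (if active n then 0 else (if n = 0 then 0 else q (n - 1)) + 1)"
  "\<xi> (Suc n) = \<xi> n - \<mu> n *\<^sub>R g n"
  "x (Suc n) = S (\<epsilon> (Suc n)) (\<xi> (Suc n))"
  using run unfolding landweber_kaczmarz_def Let_def
    r_def[symmetric] h_def[symmetric] g_def[symmetric] relax_def[symmetric] \<mu>'_def[symmetric]
    active_def[symmetric] \<mu>_def[symmetric] not_less[symmetric]
  by auto

lemma mod_N: "n mod N < N" using N by simp

lemma h_pos: "0 < h n" unfolding h_def using sigma eps by (simp add: add_nonneg_pos)

lemma h_ge: "norm (r n) powr p \<le> h n" "\<sigma> * \<epsilon> n \<le> h n"
  unfolding h_def using sigma eps(1)[of n] by (auto simp: less_imp_le)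

lemma subgrad_run: "subgrad (\<epsilon> n) (\<xi> n) (x n)"
proof (cases n)
  case 0
  then show ?thesis
    using subgrad_mono[OF eps_subdiff_imp_subgrad[OF A1b(2)]] eps(1)[of 0] run_simps(1,2) by simp
next
  case (Suc m)
  show ?thesis unfolding Suc run_simps(5)
    by (rule subgrad_of_approx_minimizer[OF A2(2)[OF eps(1)]])
qed

lemma x_dom: "x n \<in> dom" using subgrad_run unfolding subgrad_def by blast

abbreviation Dn where "Dn z n \<equiv> breg (\<epsilon> n) (\<xi> n) z (x n)"

context
  fixes n assumes ball: "x n \<in> B\<^sub>2"
begin

lemma r_in: "r n \<in> Y (n mod N)"
proof -
  have "x n \<in> D (n mod N)" using A1b(3) ball mod_N by blast
  then show ?thesis unfolding r_def using F[OF mod_N] data[OF mod_N] Y[OF mod_N] by (auto intro: subspace_diff)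
qed

lemma jmap_r: "jmap (Y (n mod N)) s (r n) \<in> duality_mapping_on (Y (n mod N)) s (r n)"
  using Y[OF mod_N] r_in s by (intro jmap_in) auto

lemma g_apply: "blinfun_apply (g n) v = jmap (Y (n mod N)) s (r n) (blinfun_apply (L (n mod N) (x n)) v)"
  unfolding g_def using Y[OF mod_N] jmap_r A1c(3)[OF mod_N ball]
  by (intro adjoint_apply_eq[where V="Y (n mod N)"]) (auto simp: duality_mapping_on_def)

lemma g_apply_le: "\<bar>blinfun_apply (g n) v\<bar> \<le> norm (r n) powr (s - 1) * norm (blinfun_apply (L (n mod N) (x n)) v)"
  unfolding g_apply using Y[OF mod_N] r_in s A1c(3)[OF mod_N ball] by (intro jmap_bound) auto

lemma g_norm: "norm (g n) \<le> Lb * norm (r n) powr (s - 1)"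
proof (rule norm_blinfun_bound)
  show "0 \<le> Lb * norm (r n) powr (s - 1)" using Lb_pos by simp
  fix v
  have "norm (blinfun_apply (L (n mod N) (x n)) v) \<le> norm (L (n mod N) (x n)) * norm v" by (rule norm_blinfun)
  also have "\<dots> \<le> Lb * norm v" using L_bounded[OF mod_N ball] by (intro mult_right_mono) auto
  finally have "norm (r n) powr (s - 1) * norm (blinfun_apply (L (n mod N) (x n)) v)
      \<le> norm (r n) powr (s - 1) * (Lb * norm v)" by (intro mult_left_mono) auto
  then show "norm (blinfun_apply (g n) v) \<le> Lb * norm (r n) powr (s - 1) * norm v"
    using g_apply_le[of v] by (simp add: ac_simps)
qed

lemma \<mu>'_ge: "m\<^sub>0 \<le> \<mu>' n" unfolding \<mu>'_def by (rule relax_ge[OF _ _ g_norm]) auto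

lemma \<xi>_increment: "norm (\<xi> n - \<xi> (Suc n)) powr ps \<le> \<beta>\<^sub>0 powr (ps - 1) * (if active n then \<mu>' n * h n else 0)"
proof (cases "active n")
  case True
  have "norm (\<xi> n - \<xi> (Suc n)) = \<mu>' n * h n powr (1 - s / p) * norm (g n)"
    using True relax_nonneg unfolding run_simps(4) \<mu>_def \<mu>'_def by simp
  then show ?thesis using True relax_step[OF _ _ h_pos h_ge(1), of n "norm (g n)"] unfolding \<mu>'_def by simp
qed (simp add: run_simps(4) \<mu>_def)

text \<open>
  By the cone condition \<open>L (z - x n)\<close> equals \<open>- r n\<close> up to an error of size \<open>\<gamma> * norm (r n) + (1 + \<gamma>) * \<delta>\<close>, and the duality
  mapping pairs with \<open>r n\<close> to \<open>norm (r n) powr s\<close>.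
\<close>

lemma descent_direction:
  assumes z: "sol z"
  shows "blinfun_apply (g n) (z - x n)
    \<le> - (norm (r n) powr s - norm (r n) powr (s - 1) * (\<gamma> * norm (r n) + (1 + \<gamma>) * \<delta>))"
proof -
  let ?i = "n mod N" let ?J = "jmap (Y ?i) s (r n)" let ?V = "Y ?i"
  define u where "u = blinfun_apply (L ?i (x n)) (z - x n) + r n"
  have "F ?i z = y ?i" using solD z mod_N by blast
  then have "u = - (F ?i z - F ?i (x n) - blinfun_apply (L ?i (x n)) (z - x n)) + (y ?i - yd ?i)"
    unfolding u_def r_def by simp
  then have "norm u \<le> norm (F ?i z - F ?i (x n) - blinfun_apply (L ?i (x n)) (z - x n)) + norm (y ?i - yd ?i)"
    by (metis norm_minus_cancel norm_triangle_ineq)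
  also have "\<dots> \<le> \<gamma> * norm (F ?i z - F ?i (x n)) + \<delta>"
    using A1c(5)[OF mod_N _ ball, of z n] solD(2)[OF z] data[OF mod_N] by (intro add_mono) (auto simp: norm_minus_commute)
  also have "\<gamma> * norm (F ?i z - F ?i (x n)) \<le> \<gamma> * (norm (r n) + \<delta>)"
  proof (rule mult_left_mono[OF _ A1c(1)])
    have "F ?i z - F ?i (x n) = - r n - (yd ?i - y ?i)" using \<open>F ?i z = y ?i\<close> unfolding r_def by simp
    then have "norm (F ?i z - F ?i (x n)) \<le> norm (- r n) + norm (yd ?i - y ?i)" by (metis norm_triangle_ineq4)
    then show "norm (F ?i z - F ?i (x n)) \<le> norm (r n) + \<delta>" using data[OF mod_N, of n] by simp
  qed
  finally have u: "norm u \<le> \<gamma> * norm (r n) + (1 + \<gamma>) * \<delta>" using A1c(1) by (simp add: algebra_simps)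
  have V: "subspace ?V" using Y[OF mod_N] by blast
  have Lin: "blinfun_apply (L ?i (x n)) (z - x n) \<in> ?V" using A1c(3)[OF mod_N ball] .
  have uV: "u \<in> ?V" unfolding u_def using Lin r_in V by (simp add: subspace_add)
  have Jd: "?J \<in> dual_on ?V" "?J (r n) = norm (r n) powr s" using jmap_r unfolding duality_mapping_on_def by auto
  have "?J u = ?J (blinfun_apply (L ?i (x n)) (z - x n)) + ?J (r n)"
    unfolding u_def using Jd(1) Lin r_in unfolding dual_on_def by blast
  then have "blinfun_apply (g n) (z - x n) = ?J u - norm (r n) powr s" using Jd(2) g_apply by simp
  moreover have "?J u \<le> norm (r n) powr (s - 1) * norm u"
    using jmap_bound[OF V _ r_in s uV] Y[OF mod_N] by force
  moreover have "norm (r n) powr (s - 1) * norm u \<le> norm (r n) powr (s - 1) * (\<gamma> * norm (r n) + (1 + \<gamma>) * \<delta>)"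
    using u by (intro mult_left_mono) auto
  ultimately show ?thesis by linarith
qed

text \<open>
  The terms of order \<open>h n\<close> combine to the coefficient \<open>c\<^sub>3\<close>. The condition \<open>\<kappa> * \<beta>\<^sub>1 * \<sigma> \<le> 1\<close> makes the defect from
  \<open>perturbed_power_bound\<close> at most \<open>\<epsilon> n\<close>, which is the second \<open>\<epsilon> n\<close> in \<open>w n\<close>.
\<close>

lemma one_step:
  assumes z: "sol z"
  shows "Dn z (Suc n) \<le> Dn z n + w n - (if active n then c\<^sub>3 * m\<^sub>0 * h n else 0)"
proof -
  have "Dn z (Suc n) = Dn z n + breg (\<epsilon> (Suc n)) (\<xi> (Suc n)) (x n) (x (Suc n))
      + blinfun_apply (\<xi> n - \<xi> (Suc n)) (z - x n) - \<epsilon> n" by (rule breg_three_point)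
  also have "breg (\<epsilon> (Suc n)) (\<xi> (Suc n)) (x n) (x (Suc n))
      \<le> K\<^sub>0 * norm (\<xi> n - \<xi> (Suc n)) powr ps + 2 * \<epsilon> n + \<epsilon> (Suc n)"
    by (rule breg_upper[OF subgrad_run subgrad_run])
  also have "K\<^sub>0 * norm (\<xi> n - \<xi> (Suc n)) powr ps
      \<le> K\<^sub>0 * (\<beta>\<^sub>0 powr (ps - 1) * (if active n then \<mu>' n * h n else 0))"
    by (rule mult_left_mono[OF \<xi>_increment K0_nonneg])
  finally have *: "Dn z (Suc n) \<le> Dn z n + K\<^sub>0 * (\<beta>\<^sub>0 powr (ps - 1) * (if active n then \<mu>' n * h n else 0))
      + \<mu> n * blinfun_apply (g n) (z - x n) + \<epsilon> n + \<epsilon> (Suc n)"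
    by (simp add: run_simps(4) blinfun.scaleR_left)
  show ?thesis
  proof (cases "active n")
    case False
    then show ?thesis using * eps(1)[of n] by (simp add: \<mu>_def w_def)
  next
    case True
    define c' where "c' = 1 / \<beta> - \<gamma> - (1 + \<gamma>) / \<tau>"
    define k' where "k' = K\<^sub>0 * \<beta>\<^sub>0 powr (ps - 1)"
    have c3: "c\<^sub>3 = c' - k'" unfolding c3_eq c'_def k'_def ..
    define G where "G = norm (r n) powr s - norm (r n) powr (s - 1) * (\<gamma> * norm (r n) + (1 + \<gamma>) * \<delta>)"
    have \<mu>'0: "0 \<le> \<mu>' n" unfolding \<mu>'_def by (rule relax_nonneg)
    have 1: "\<mu> n * blinfun_apply (g n) (z - x n) \<le> \<mu> n * (- G)"
      unfolding G_def using \<mu>'0 descent_direction[OF z] by (intro mult_left_mono) (auto simp: \<mu>_def)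
    have 2: "\<mu> n * G = \<mu>' n * (h n powr (1 - s / p) * G)" using True by (simp add: \<mu>_def)
    have 3: "\<mu>' n * (c' * h n - \<kappa> * (\<sigma> * \<epsilon> n)) \<le> \<mu>' n * (h n powr (1 - s / p) * G)"
      unfolding G_def c'_def using True \<delta> \<mu>'0 eps(1)
      by (intro mult_left_mono residual_descent) (auto simp: h_def active_def)
    have 4: "\<mu>' n * (\<kappa> * (\<sigma> * \<epsilon> n)) \<le> \<epsilon> n"
    proof -
      have "0 \<le> \<kappa>" unfolding kappa by simp
      then have "\<mu>' n * (\<kappa> * (\<sigma> * \<epsilon> n)) \<le> \<beta>\<^sub>1 * (\<kappa> * (\<sigma> * \<epsilon> n))"
        using sigma eps(1)[of n] relax_le unfolding \<mu>'_def by (intro mult_right_mono) auto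
      also have "\<dots> = (\<kappa> * \<beta>\<^sub>1 * \<sigma>) * \<epsilon> n" by simp
      also have "\<dots> \<le> 1 * \<epsilon> n" using sigma eps(1)[of n] by (intro mult_right_mono) auto
      finally show ?thesis by simp
    qed
    have 5: "c\<^sub>3 * m\<^sub>0 * h n \<le> c\<^sub>3 * \<mu>' n * h n"
      using c3_pos \<mu>'_ge h_pos[of n] by (intro mult_right_mono mult_left_mono) auto
    have "Dn z (Suc n) \<le> Dn z n + k' * (\<mu>' n * h n) + \<mu> n * blinfun_apply (g n) (z - x n) + \<epsilon> n + \<epsilon> (Suc n)"
      using * True unfolding k'_def by (simp add: mult.assoc)
    moreover have "c' * (\<mu>' n * h n) - \<epsilon> n \<le> \<mu> n * G"
      using 3 4 unfolding 2 by (simp add: algebra_simps)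
    moreover have "c\<^sub>3 * m\<^sub>0 * h n \<le> c' * (\<mu>' n * h n) - k' * (\<mu>' n * h n)"
      using 5 unfolding c3 by (simp add: algebra_simps)
    ultimately show ?thesis using 1 True unfolding w_def by simp
  qed
qed

end

text \<open>
  The one-step estimate needs \<open>x n\<close> in the ball and in turn bounds the distance of \<open>x (Suc n)\<close> to the reference
  solution by \<open>\<rho>\<close>. As that solution is within \<open>\<rho>\<close> of \<open>x\<^sub>0\<close>, the induction closes.
\<close>

lemma ball_invariance: "x n \<in> B\<^sub>2"
proof -
  obtain z where zs: "sol z" and z0: "norm (z - x\<^sub>0) \<le> \<rho>"
    and D0: "breg 0 \<xi>\<^sub>0 z x\<^sub>0 \<le> 1 / 4 * c\<^sub>0 * \<rho> powr p" using reference_solution by blast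
  have z: "z \<in> dom" by (rule solD(3)[OF zs])
  have "x n \<in> B\<^sub>2 \<and> Dn z n \<le> 1 / 4 * c\<^sub>0 * \<rho> powr p + (\<epsilon> 0 + sum w {..<n})"
  proof (induction n)
    case 0
    have "Dn z 0 = breg 0 \<xi>\<^sub>0 z x\<^sub>0 + \<epsilon> 0" unfolding breg_def run_simps(1,2) by simp
    then show ?case using D0 run_simps(1) x0_ball by simp
  next
    case (Suc n)
    have "0 \<le> c\<^sub>3 * m\<^sub>0 * h n" using c3_pos m0_pos h_pos[of n] by simp
    then have D: "Dn z (Suc n) \<le> 1 / 4 * c\<^sub>0 * \<rho> powr p + (\<epsilon> 0 + sum w {..<Suc n})"
      using one_step[OF conjunct1[OF Suc.IH] zs] conjunct2[OF Suc.IH] by (auto split: if_splits)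
    have "norm (z - x (Suc n)) \<le> \<rho>"
      using breg_lower[OF subgrad_run z, of "Suc n"] D sum_w_le[of "Suc n"] eps_le[of "Suc n"]
      by (intro radius) (simp del: sum.lessThan_Suc)
    then have "norm (x (Suc n) - x\<^sub>0) \<le> 2 * \<rho>"
      using z0 norm_triangle_ineq4[of "z - x\<^sub>0" "z - x (Suc n)"] by simp
    then show ?case using D by (simp add: dist_norm norm_minus_commute)
  qed
  then show ?thesis by blast
qed

lemma accumulated_descent:
  assumes z: "sol z" and mn: "m \<le> n"
  shows "Dn z n + c\<^sub>3 * m\<^sub>0 * (\<Sum>k\<in>{k. active k} \<inter> {m..<n}. h k) \<le> Dn z m + sum w {m..<n}"
  using mn
proof (induction n rule: dec_induct)
  case (step n)
  have "(\<Sum>k\<in>{k. active k} \<inter> {m..<Suc n}. h k)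
      = (\<Sum>k\<in>{k. active k} \<inter> {m..<n}. h k) + (if active n then h n else 0)"
    using step(1) by (simp add: atLeastLessThanSuc Int_insert_right)
  then show ?case using step one_step[OF ball_invariance z, of n] by (auto simp: algebra_simps split: if_splits)
qed simp

lemma quasi_monotone:
  assumes z: "sol z" and mn: "m \<le> n"
  shows "Dn z n \<le> Dn z m + sum w {m..<n}"
proof -
  have "0 \<le> c\<^sub>3 * m\<^sub>0 * (\<Sum>k\<in>{k. active k} \<inter> {m..<n}. h k)"
    using c3_pos m0_pos h_pos by (intro mult_nonneg_nonneg sum_nonneg) (auto simp: less_imp_le)
  then show ?thesis using accumulated_descent[OF z mn] by linarith
qed

lemma sum_w_le_suminf: "sum w {m..<n} \<le> suminf w"
  by (rule sum_le_suminf[OF w_summable]) (auto simp: w_nonneg)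

lemma active_sum_bounded:
  assumes z: "sol z" and A: "finite A" "A \<subseteq> {k. active k}"
  shows "c\<^sub>3 * m\<^sub>0 * sum h A \<le> Dn z 0 + suminf w"
proof -
  obtain n where n: "A \<subseteq> {..<n}" using A(1) finite_nat_iff_bounded by blast
  have "sum h A \<le> (\<Sum>k\<in>{k. active k} \<inter> {0..<n}. h k)"
    using A n h_pos by (intro sum_mono2) (auto simp: less_imp_le)
  then have "c\<^sub>3 * m\<^sub>0 * sum h A \<le> c\<^sub>3 * m\<^sub>0 * (\<Sum>k\<in>{k. active k} \<inter> {0..<n}. h k)"
    using c3_pos m0_pos by (intro mult_left_mono) auto
  then show ?thesis using accumulated_descent[OF z, of 0 n] breg_nonneg[OF subgrad_run solD(3)[OF z], of n]
      sum_w_le_suminf[of 0 n] by simp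
qed

end

section \<open>Finite termination\<close>

context lk_run
begin

text \<open>
  Each active step costs at least \<open>c\<^sub>3 * m\<^sub>0 * (\<tau> * \<delta>) powr p\<close> of a bounded budget.
\<close>

lemma finitely_many_active:
  assumes "0 < \<delta>"
  shows "finite {k. active k}"
proof (rule ccontr)
  assume inf: "infinite {k. active k}"
  obtain z where z: "sol z" using reference_solution by blast
  define t where "t = (\<tau> * \<delta>) powr p"
  have t: "0 < t" unfolding t_def using assms tau by simp
  have c: "0 < c\<^sub>3 * m\<^sub>0 * t" using c3_pos m0_pos t by simp
  obtain M :: nat where M: "Dn z 0 + suminf w < real M * (c\<^sub>3 * m\<^sub>0 * t)"
    using reals_Archimedean3[OF c] by blast
  obtain A where A: "finite A" "card A = M" "A \<subseteq> {k. active k}"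
    using infinite_arbitrarily_large[OF inf] by blast
  have "real M * t \<le> sum h A"
    using sum_mono[of A "\<lambda>_. t" h] A unfolding t_def active_def by (auto simp: less_imp_le subset_iff)
  then have "c\<^sub>3 * m\<^sub>0 * (real M * t) \<le> c\<^sub>3 * m\<^sub>0 * sum h A"
    using c3_pos m0_pos by (intro mult_left_mono) auto
  then show False using active_sum_bounded[OF z A(1,3)] M by (simp add: ac_simps)
qed

text \<open>
  After the last active step \<open>q\<close> counts up by 1, so it cannot skip \<open>N\<close>.
\<close>

lemma terminates:
  assumes "0 < \<delta>"
  shows "\<exists>n. q n = N"
proof (rule ccontr)
  assume "\<nexists>n. q n = N"
  then have ne: "q n \<noteq> N" for n by blast
  have lt: "q n < N" for n
  proof (induction n)
    case 0
    show ?case using ne[of 0] N run_simps(3)[of 0] by (auto split: if_splits)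
  next
    case (Suc n)
    then show ?case using ne[of "Suc n"] run_simps(3)[of "Suc n"] by (auto split: if_splits)
  qed
  obtain M where M: "\<And>k. active k \<Longrightarrow> k < M"
    using finitely_many_active[OF assms] unfolding finite_nat_set_iff_bounded by auto
  have "j \<le> q (M + j)" for j
  proof (induction j)
    case (Suc j)
    have "\<not> active (M + Suc j)" using M by force
    then show ?case using Suc run_simps(3)[of "M + Suc j"] by simp
  qed simp
  then show False using lt[of "M + N"] by (simp add: not_le[symmetric])
qed

text \<open>
  A positive counter means that the last step was inactive. Hence the stopping index cannot stay bounded as \<open>\<delta>\<close> tends to 0.
\<close>

lemma inactive_at_stop:
  assumes "0 < \<delta>"
  shows "\<sigma> * \<epsilon> (LEAST n. q n = N) \<le> (\<tau> * \<delta>) powr p"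
proof -
  have "q (LEAST n. q n = N) = N" using terminates[OF assms] by (rule LeastI_ex)
  then have "\<not> active (LEAST n. q n = N)" using run_simps(3)[of "LEAST n. q n = N"] N by (auto split: if_splits)
  then show ?thesis using h_ge(2) unfolding active_def by (meson leI order_trans)
qed

end

section \<open>Convergence for exact data\<close>

text \<open>
  Beyond any \<open>M\<close>, the first index at which \<open>E\<close> drops below its minimum over \<open>{..M}\<close> is a record.
\<close>

lemma record_lows:
  fixes E :: "nat \<Rightarrow> real"
  assumes pos: "\<And>m. 0 < E m" and lim: "E \<longlonglongrightarrow> 0"
  shows "infinite {l. \<forall>m\<le>l. E l \<le> E m}"
proof (unfold infinite_nat_iff_unbounded, intro allI)
  fix M
  define e where "e = Min (E ` {..M})"
  have e: "0 < e" unfolding e_def using pos by (subst Min_gr_iff) auto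
  have eM: "e \<le> E m" if "m \<le> M" for m unfolding e_def using that by (intro Min_le) auto
  have ex: "\<exists>l. E l < e" using order_tendstoD(2)[OF lim e] eventually_happens'[OF sequentially_bot] by blast
  define l where "l = (LEAST l. E l < e)"
  have l: "E l < e" unfolding l_def using ex by (rule LeastI_ex)
  have "E l \<le> E m" if "m \<le> l" for m
  proof (cases "m = l")
    case False
    then have "m < l" using that by simp
    then have "\<not> E m < e" unfolding l_def by (rule not_less_Least)
    then show ?thesis using l by linarith
  qed simp
  moreover have "M < l" using l eM by (meson leI not_le)
  ultimately show "\<exists>n>M. n \<in> {l. \<forall>m\<le>l. E l \<le> E m}" by blast
qed

context lk_run
begin

context
  assumes exact: "\<delta> = 0" "yd = y"
begin

lemma all_active: "active n"
  using h_pos exact unfolding active_def by simp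

lemma r_exact: "r k = F (k mod N) (x k) - y (k mod N)"
  unfolding r_def by (simp add: exact(2))

lemma h_summable: "summable h"
proof -
  obtain z where z: "sol z" using reference_solution by blast
  have c: "0 < c\<^sub>3 * m\<^sub>0" using c3_pos m0_pos by simp
  show ?thesis
  proof (rule summableI_nonneg_bounded)
    show "sum h {..<n} \<le> (Dn z 0 + suminf w) / (c\<^sub>3 * m\<^sub>0)" for n
      using active_sum_bounded[OF z, of "{..<n}"] all_active c by (simp add: pos_le_divide_eq mult.commute)
  qed (simp add: h_pos less_imp_le)
qed

text \<open>
  Up to a constant this bounds \<open>norm (x (Suc k) - x k) powr p\<close>: the term \<open>h k\<close> covers the dual increment and,
  because \<open>\<sigma> * \<epsilon> k \<le> h k\<close>, also the error \<open>\<epsilon> k\<close>.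
\<close>

definition u where "u k = h k + \<epsilon> (Suc k)"
definition E where "E m = sum u {m * N..<m * N + N}"

lemma u_pos: "0 < u k" unfolding u_def using h_pos eps(1) by (simp add: add_pos_pos)

lemma u_le_E: "m * N \<le> k \<Longrightarrow> k < m * N + N \<Longrightarrow> u k \<le> E m"
  unfolding E_def using u_pos by (intro member_le_sum) (auto simp: less_imp_le)

lemma E_pos: "0 < E m"
  using u_le_E[of m "m * N"] u_pos[of "m * N"] N by linarith

lemma E_summable: "summable E"
proof -
  have u: "summable u" unfolding u_def using h_summable eps(2) by (intro summable_add) (simp_all add: summable_Suc_iff)
  show ?thesis
  proof (rule summableI_nonneg_bounded)
    fix n
    have "sum E {..<n} = sum u {..<n * N}" unfolding E_def by (rule sum.nat_group)
    also have "\<dots> \<le> suminf u" using u u_pos by (intro sum_le_suminf) (auto simp: less_imp_le)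
    finally show "sum E {..<n} \<le> suminf u" .
  qed (simp add: E_pos less_imp_le)
qed

text \<open>
  For \<open>b\<close> in this set, the bound \<open>E b\<close> for the residuals at \<open>x (b * N)\<close> is also a bound by \<open>E m\<close> for every earlier cycle
  \<open>m\<close>. The sums over earlier cycles can thus absorb these residuals.
\<close>

definition R where "R = {l. \<forall>m\<le>l. E l \<le> E m}"

lemma R_infinite: "infinite R"
  unfolding R_def by (rule record_lows[OF E_pos summable_LIMSEQ_zero[OF E_summable]])

definition C\<^sub>2 where "C\<^sub>2 = 2 / c\<^sub>0 * (K\<^sub>0 * \<beta>\<^sub>0 powr (ps - 1) * \<beta>\<^sub>1 + 2 / \<sigma> + 2)"

lemma C2_nonneg: "0 \<le> C\<^sub>2" unfolding C\<^sub>2_def using c0 K0_nonneg beta sigma by simp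

lemma x_increment: "norm (x (Suc k) - x k) powr p \<le> C\<^sub>2 * u k"
proof -
  have "c\<^sub>0 / 2 * norm (x k - x (Suc k)) powr p
      \<le> K\<^sub>0 * norm (\<xi> k - \<xi> (Suc k)) powr ps + 2 * \<epsilon> k + 2 * \<epsilon> (Suc k)"
    by (rule subgrad_dist[OF subgrad_run subgrad_run])
  also have "K\<^sub>0 * norm (\<xi> k - \<xi> (Suc k)) powr ps \<le> K\<^sub>0 * (\<beta>\<^sub>0 powr (ps - 1) * (\<beta>\<^sub>1 * h k))"
  proof (rule mult_left_mono[OF _ K0_nonneg])
    have "\<mu>' k * h k \<le> \<beta>\<^sub>1 * h k" using relax_le h_pos[of k] unfolding \<mu>'_def by (intro mult_right_mono) auto
    then have "\<beta>\<^sub>0 powr (ps - 1) * (\<mu>' k * h k) \<le> \<beta>\<^sub>0 powr (ps - 1) * (\<beta>\<^sub>1 * h k)"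
      by (intro mult_left_mono) auto
    then show "norm (\<xi> k - \<xi> (Suc k)) powr ps \<le> \<beta>\<^sub>0 powr (ps - 1) * (\<beta>\<^sub>1 * h k)"
      using \<xi>_increment[OF ball_invariance, of k] all_active[of k] by simp
  qed
  also have "K\<^sub>0 * (\<beta>\<^sub>0 powr (ps - 1) * (\<beta>\<^sub>1 * h k)) + 2 * \<epsilon> k + 2 * \<epsilon> (Suc k)
      \<le> (K\<^sub>0 * \<beta>\<^sub>0 powr (ps - 1) * \<beta>\<^sub>1) * u k + 2 / \<sigma> * u k + 2 * u k"
  proof (intro add_mono)
    show "K\<^sub>0 * (\<beta>\<^sub>0 powr (ps - 1) * (\<beta>\<^sub>1 * h k)) \<le> (K\<^sub>0 * \<beta>\<^sub>0 powr (ps - 1) * \<beta>\<^sub>1) * u k"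
      using K0_nonneg beta eps(1)[of "Suc k"] unfolding u_def mult.assoc by (intro mult_left_mono) auto
    have "2 * \<epsilon> k = 2 / \<sigma> * (\<sigma> * \<epsilon> k)" using sigma by simp
    also have "\<dots> \<le> 2 / \<sigma> * u k"
      using h_ge(2)[of k] eps(1)[of "Suc k"] sigma unfolding u_def by (intro mult_left_mono) auto
    finally show "2 * \<epsilon> k \<le> 2 / \<sigma> * u k" .
    show "2 * \<epsilon> (Suc k) \<le> 2 * u k" using h_pos[of k] unfolding u_def by simp
  qed
  finally have "c\<^sub>0 / 2 * norm (x k - x (Suc k)) powr p
      \<le> (K\<^sub>0 * \<beta>\<^sub>0 powr (ps - 1) * \<beta>\<^sub>1 + 2 / \<sigma> + 2) * u k" by (simp add: algebra_simps)
  then have "2 / c\<^sub>0 * (c\<^sub>0 / 2 * norm (x k - x (Suc k)) powr p)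
      \<le> 2 / c\<^sub>0 * ((K\<^sub>0 * \<beta>\<^sub>0 powr (ps - 1) * \<beta>\<^sub>1 + 2 / \<sigma> + 2) * u k)" using c0 by (intro mult_left_mono) auto
  moreover have "2 / c\<^sub>0 * (c\<^sub>0 / 2 * norm (x k - x (Suc k)) powr p) = norm (x (Suc k) - x k) powr p"
    using c0 by (simp add: norm_minus_commute)
  ultimately show ?thesis unfolding C\<^sub>2_def by (simp only: mult.assoc)
qed

lemma r_le: "norm (r k) \<le> h k powr (1 / p)"
  by (rule le_root[OF _ h_ge(1)]) simp

definition C\<^sub>1 where "C\<^sub>1 = 1 + Lb / (1 - \<gamma>) * (real N * C\<^sub>2 powr (1 / p))"

lemma C1_nonneg: "0 \<le> C\<^sub>1" unfolding C\<^sub>1_def using Lb_pos A1c by simp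

text \<open>
  The \<open>i\<close>-th equation is only evaluated at \<open>x (b * N + i)\<close>. The distance of this iterate to \<open>x (b * N)\<close> is at most
  the sum of the increments within the cycle, and \<open>F i\<close> is Lipschitz on the ball.
\<close>

lemma cycle_residual:
  assumes i: "i < N"
  shows "norm (F i (x (b * N)) - y i) \<le> C\<^sub>1 * E b powr (1 / p)"
proof -
  define e where "e = E b powr (1 / p)"
  have step: "norm (x (Suc (b * N + j)) - x (b * N + j)) \<le> C\<^sub>2 powr (1 / p) * e" if "j < N" for j
  proof -
    have "norm (x (Suc (b * N + j)) - x (b * N + j)) powr p \<le> C\<^sub>2 * u (b * N + j)" by (rule x_increment)
    also have "\<dots> \<le> C\<^sub>2 * E b" using that C2_nonneg by (intro mult_left_mono u_le_E) auto
    finally have "norm (x (Suc (b * N + j)) - x (b * N + j)) \<le> (C\<^sub>2 * E b) powr (1 / p)" by (intro le_root) simp_all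
    then show ?thesis unfolding e_def using C2_nonneg E_pos[of b] by (simp add: powr_mult)
  qed
  have dist: "j \<le> N \<Longrightarrow> norm (x (b * N + j) - x (b * N)) \<le> real j * (C\<^sub>2 powr (1 / p) * e)" for j
  proof (induction j)
    case (Suc j)
    have "norm (x (b * N + Suc j) - x (b * N))
        \<le> norm (x (Suc (b * N + j)) - x (b * N + j)) + norm (x (b * N + j) - x (b * N))"
      using norm_triangle_ineq[of "x (Suc (b * N + j)) - x (b * N + j)" "x (b * N + j) - x (b * N)"] by simp
    then show ?case using Suc step[of j] by (simp add: algebra_simps)
  qed simp
  let ?k = "b * N + i"
  have ki: "?k mod N = i" using i by simp
  have "norm (F i (x ?k) - F i (x (b * N))) \<le> Lb / (1 - \<gamma>) * norm (x ?k - x (b * N))"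
    by (rule F_lipschitz[OF i ball_invariance ball_invariance])
  also have "\<dots> \<le> Lb / (1 - \<gamma>) * (real N * (C\<^sub>2 powr (1 / p) * e))"
  proof (rule mult_left_mono)
    have "norm (x ?k - x (b * N)) \<le> real i * (C\<^sub>2 powr (1 / p) * e)" using dist i by simp
    also have "\<dots> \<le> real N * (C\<^sub>2 powr (1 / p) * e)" using i unfolding e_def by (intro mult_right_mono) auto
    finally show "norm (x ?k - x (b * N)) \<le> real N * (C\<^sub>2 powr (1 / p) * e)" .
  qed (use Lb_pos A1c in simp)
  finally have 1: "norm (F i (x ?k) - F i (x (b * N))) \<le> Lb / (1 - \<gamma>) * (real N * (C\<^sub>2 powr (1 / p) * e))" .
  have "norm (r ?k) powr p \<le> E b"
    using h_ge(1)[of ?k] u_le_E[of b ?k] i eps(1)[of "Suc ?k"] unfolding u_def by auto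
  then have 2: "norm (F i (x ?k) - y i) \<le> e"
    unfolding e_def r_exact ki by (intro le_root) auto
  have "norm (F i (x (b * N)) - y i) \<le> norm (F i (x ?k) - y i) + norm (F i (x ?k) - F i (x (b * N)))"
    using norm_triangle_ineq4[of "F i (x ?k) - y i" "F i (x ?k) - F i (x (b * N))"] by simp
  then show ?thesis using 1 2 unfolding C\<^sub>1_def e_def[symmetric] by (simp add: algebra_simps)
qed

definition C where "C = real N * (\<beta>\<^sub>1 * (1 + \<gamma>) * (2 + C\<^sub>1))"

lemma C_nonneg: "0 \<le> C" unfolding C_def using A1c beta C1_nonneg by simp

text \<open>
  The cone condition bounds \<open>L (x (b * N) - z)\<close> by the residuals at \<open>x k\<close> and at \<open>x (b * N)\<close>, both of order
  \<open>E m powr (1 / p)\<close>, the latter because \<open>b\<close> is a record low. The dual step contributes the order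
  \<open>E m powr (1 - 1 / p)\<close>, so that the product is summable over \<open>m\<close>.
\<close>

lemma increment_pairing:
  assumes z: "sol z" and b: "b \<in> R" and k: "m * N \<le> k" "k < m * N + N" and mb: "m \<le> b"
  shows "\<bar>blinfun_apply (\<xi> (Suc k) - \<xi> k) (x (b * N) - z)\<bar> \<le> \<beta>\<^sub>1 * (1 + \<gamma>) * (2 + C\<^sub>1) * E m"
proof -
  let ?i = "k mod N" let ?v = "x (b * N) - z"
  define e where "e = E m powr (1 / p)"
  have hE: "h k \<le> E m" using u_le_E[OF k] eps(1)[of "Suc k"] unfolding u_def by simp
  have re: "norm (r k) \<le> e"
    unfolding e_def using hE h_ge(1)[of k] by (intro le_root) auto
  have bE: "E b powr (1 / p) \<le> e"
    unfolding e_def using b mb ps_props(3) E_pos[of b] by (intro powr_mono2) (auto simp: R_def less_imp_le)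
  have Fz: "F ?i z = y ?i" using solD(1)[OF z mod_N] .
  have "norm (F ?i (x (b * N)) - F ?i (x k)) \<le> norm (F ?i (x (b * N)) - y ?i) + norm (r k)"
    using norm_triangle_ineq4[of "F ?i (x (b * N)) - y ?i" "r k"] by (simp add: r_exact)
  also have "norm (F ?i (x (b * N)) - y ?i) \<le> C\<^sub>1 * e"
    using cycle_residual[OF mod_N, of k b] mult_left_mono[OF bE C1_nonneg] by linarith
  finally have 1: "norm (F ?i (x (b * N)) - F ?i (x k)) \<le> C\<^sub>1 * e + e" using re by simp
  have 2: "norm (F ?i z - F ?i (x k)) \<le> e"
    using re unfolding r_exact Fz by (simp add: norm_minus_commute)
  have "blinfun_apply (L ?i (x k)) ?v
      = blinfun_apply (L ?i (x k)) (x (b * N) - x k) - blinfun_apply (L ?i (x k)) (z - x k)"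
    by (simp flip: blinfun.diff_right)
  then have "norm (blinfun_apply (L ?i (x k)) ?v)
      \<le> norm (blinfun_apply (L ?i (x k)) (x (b * N) - x k)) + norm (blinfun_apply (L ?i (x k)) (z - x k))"
    by (simp only: norm_triangle_ineq4)
  also have "\<dots> \<le> (1 + \<gamma>) * (C\<^sub>1 * e + e) + (1 + \<gamma>) * e"
  proof (intro add_mono)
    show "norm (blinfun_apply (L ?i (x k)) (x (b * N) - x k)) \<le> (1 + \<gamma>) * (C\<^sub>1 * e + e)"
      using tangential_cone(1)[OF mod_N ball_invariance ball_invariance, of k k "b * N"] 1 A1c
        mult_left_mono[OF 1, of "1 + \<gamma>"] by linarith
    show "norm (blinfun_apply (L ?i (x k)) (z - x k)) \<le> (1 + \<gamma>) * e"
      using tangential_cone(1)[OF mod_N ball_invariance solD(2)[OF z], of k k] A1c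
        mult_left_mono[OF 2, of "1 + \<gamma>"] by linarith
  qed
  also have "\<dots> = (1 + \<gamma>) * (2 + C\<^sub>1) * e" by (simp add: algebra_simps)
  finally have Lv: "norm (blinfun_apply (L ?i (x k)) ?v) \<le> (1 + \<gamma>) * (2 + C\<^sub>1) * e" .
  have p0: "0 < p" by (rule ps_props(3))
  have "norm (r k) powr (s - 1) \<le> (h k powr (1 / p)) powr (s - 1)"
    using r_le s by (intro powr_mono2) auto
  then have rs: "norm (r k) powr (s - 1) \<le> h k powr ((s - 1) / p)" by (simp add: powr_powr)
  have "\<mu> k * norm (r k) powr (s - 1) \<le> \<beta>\<^sub>1 * h k powr (1 - s / p) * h k powr ((s - 1) / p)"
    unfolding \<mu>_def \<mu>'_def using all_active relax_le relax_nonneg rs beta by (auto intro!: mult_mono)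
  also have "\<dots> = \<beta>\<^sub>1 * h k powr (1 - s / p + (s - 1) / p)" by (simp add: powr_add)
  also have "1 - s / p + (s - 1) / p = 1 - 1 / p" by (simp add: diff_divide_distrib)
  also have "\<beta>\<^sub>1 * h k powr (1 - 1 / p) \<le> \<beta>\<^sub>1 * E m powr (1 - 1 / p)"
    using hE h_pos[of k] p beta by (intro mult_left_mono powr_mono2) (auto simp: less_imp_le)
  finally have \<mu>r: "\<mu> k * norm (r k) powr (s - 1) \<le> \<beta>\<^sub>1 * E m powr (1 - 1 / p)" .
  have \<mu>0: "0 \<le> \<mu> k" unfolding \<mu>_def \<mu>'_def using relax_nonneg by simp
  have "\<bar>blinfun_apply (\<xi> (Suc k) - \<xi> k) ?v\<bar> = \<mu> k * \<bar>blinfun_apply (g k) ?v\<bar>"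
    using \<mu>0 by (simp add: run_simps(4) blinfun.scaleR_left blinfun.minus_left abs_mult)
  also have "\<dots> \<le> \<mu> k * (norm (r k) powr (s - 1) * norm (blinfun_apply (L ?i (x k)) ?v))"
    using \<mu>0 g_apply_le[OF ball_invariance] by (intro mult_left_mono) auto
  also have "\<dots> \<le> (\<beta>\<^sub>1 * E m powr (1 - 1 / p)) * ((1 + \<gamma>) * (2 + C\<^sub>1) * e)"
    unfolding mult.assoc[symmetric, of "\<mu> k"] by (rule mult_mono[OF \<mu>r Lv]) (use beta in auto)
  also have "\<dots> = \<beta>\<^sub>1 * (1 + \<gamma>) * (2 + C\<^sub>1) * (E m powr (1 - 1 / p) * E m powr (1 / p))" unfolding e_def by simp
  also have "E m powr (1 - 1 / p) * E m powr (1 / p) = E m" using E_pos[of m] by (simp flip: powr_add)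
  finally show ?thesis .
qed

lemma pairing:
  assumes z: "sol z" and b: "b \<in> R" and ab: "a \<le> b"
  shows "\<bar>blinfun_apply (\<xi> (b * N) - \<xi> (a * N)) (x (b * N) - z)\<bar> \<le> C * sum E {a..<b}"
proof -
  let ?v = "x (b * N) - z"
  define c where "c = \<beta>\<^sub>1 * (1 + \<gamma>) * (2 + C\<^sub>1)"
  have cycle: "j \<le> N \<Longrightarrow> \<bar>blinfun_apply (\<xi> (m * N + j) - \<xi> (m * N)) ?v\<bar> \<le> real j * (c * E m)"
    if "m \<le> b" for m j
  proof (induction j)
    case (Suc j)
    have "blinfun_apply (\<xi> (m * N + Suc j) - \<xi> (m * N)) ?v
        = blinfun_apply (\<xi> (Suc (m * N + j)) - \<xi> (m * N + j)) ?v + blinfun_apply (\<xi> (m * N + j) - \<xi> (m * N)) ?v"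
      by (simp add: blinfun.diff_left)
    then show ?case
      using Suc increment_pairing[OF z b _ _ that, of "m * N + j"] unfolding c_def[symmetric]
      by (simp add: algebra_simps)
  qed simp
  have "m \<le> b \<Longrightarrow> \<bar>blinfun_apply (\<xi> (m * N) - \<xi> (a * N)) ?v\<bar> \<le> C * sum E {a..<m}" if "a \<le> m" for m
    using that
  proof (induction m rule: dec_induct)
    case (step m)
    have "\<bar>blinfun_apply (\<xi> (m * N + N) - \<xi> (m * N)) ?v\<bar> \<le> C * E m"
      using cycle[of m N] step unfolding C_def c_def by (simp add: ac_simps)
    moreover have "blinfun_apply (\<xi> (Suc m * N) - \<xi> (a * N)) ?v
        = blinfun_apply (\<xi> (m * N + N) - \<xi> (m * N)) ?v + blinfun_apply (\<xi> (m * N) - \<xi> (a * N)) ?v"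
      by (simp add: blinfun.diff_left add.commute)
    ultimately show ?case using step by (simp add: algebra_simps)
  qed simp
  then show ?thesis using ab by blast
qed

lemma Dn_convergent:
  assumes z: "sol z"
  shows "convergent (Dn z)"
proof -
  \<comment> \<open>Subtracting the accumulated errors makes the distance truly decreasing.\<close>
  define V where "V n = Dn z n - sum w {..<n}" for n
  have "decseq V"
  proof (rule decseq_SucI)
    fix n
    have "0 \<le> c\<^sub>3 * m\<^sub>0 * h n" using c3_pos m0_pos h_pos[of n] by simp
    then show "V (Suc n) \<le> V n" using one_step[OF ball_invariance z, of n] all_active[of n] unfolding V_def by simp
  qed
  moreover have "- suminf w \<le> V n" for n
    using breg_nonneg[OF subgrad_run solD(3)[OF z], of n] sum_w_le_suminf[of 0 n]
    unfolding V_def by (simp add: atLeast0LessThan)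
  ultimately have "convergent V" using decseq_convergent[of V "- suminf w"] unfolding convergent_def by metis
  moreover have "convergent (\<lambda>n. sum w {..<n})" using w_summable by (simp add: summable_iff_convergent)
  ultimately have "convergent (\<lambda>n. V n + sum w {..<n})" by (rule convergent_add)
  then show ?thesis unfolding V_def by simp
qed

text \<open>
  The three-point identity expresses the distance between two record iterates by the difference of their distances
  to one solution, which converge, and by the pairing just bounded.
\<close>

lemma near_diagonal:
  assumes \<eta>: "0 < \<eta>"
  shows "\<exists>K. \<forall>a\<ge>K. \<forall>b\<in>R. a \<le> b \<longrightarrow>
    breg (\<epsilon> (a * N)) (\<xi> (a * N)) (x (b * N)) (x (a * N)) \<le> \<eta> \<and> \<epsilon> (a * N) \<le> \<eta>"
proof -
  obtain z where z: "sol z" using reference_solution by blast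
  define e where "e = \<eta> / 3"
  have e: "0 < e" "0 < e / (C + 1)" unfolding e_def using \<eta> C_nonneg by auto
  have "Cauchy (Dn z)" using Dn_convergent[OF z] by (simp add: Cauchy_convergent_iff)
  then obtain K1 where K1: "\<And>m n. m \<ge> K1 \<Longrightarrow> n \<ge> K1 \<Longrightarrow> \<bar>Dn z m - Dn z n\<bar> < e"
    using e unfolding Cauchy_def dist_real_def by meson
  obtain K2 where K2: "\<And>m n. m \<ge> K2 \<Longrightarrow> norm (sum E {m..<n}) < e / (C + 1)"
    using E_summable e unfolding summable_Cauchy by meson
  have "\<forall>\<^sub>F n in sequentially. \<epsilon> n < e" using order_tendstoD(2)[OF summable_LIMSEQ_zero[OF eps(2)] e(1)] .
  then obtain K3 where K3: "\<And>n. n \<ge> K3 \<Longrightarrow> \<epsilon> n < e" unfolding eventually_sequentially by blast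
  show ?thesis
  proof (intro exI[of _ "max K1 (max K2 K3)"] allI impI ballI)
    fix a b assume a: "max K1 (max K2 K3) \<le> a" and b: "b \<in> R" and ab: "a \<le> b"
    have "a \<le> a * N" "b \<le> b * N" using N by auto
    then have aN: "k \<le> a * N" "k \<le> b * N" if "k \<le> a" for k using that ab by linarith+
    have "C * sum E {a..<b} \<le> (C + 1) * (e / (C + 1))"
      using K2[of a b] a C_nonneg E_pos by (intro mult_mono sum_nonneg) (auto simp: less_imp_le)
    then have "C * sum E {a..<b} \<le> e" using C_nonneg by simp
    then have "\<bar>blinfun_apply (\<xi> (b * N) - \<xi> (a * N)) (x (b * N) - z)\<bar> \<le> e" using pairing[OF z b ab] by linarith
    moreover have "blinfun_apply (\<xi> (b * N) - \<xi> (a * N)) (z - x (b * N))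
        = - blinfun_apply (\<xi> (b * N) - \<xi> (a * N)) (x (b * N) - z)" by (simp add: blinfun.diff_right)
    moreover have "Dn z (a * N) = Dn z (b * N) + breg (\<epsilon> (a * N)) (\<xi> (a * N)) (x (b * N)) (x (a * N))
        + blinfun_apply (\<xi> (b * N) - \<xi> (a * N)) (z - x (b * N)) - \<epsilon> (b * N)" by (rule breg_three_point)
    moreover have "\<bar>Dn z (a * N) - Dn z (b * N)\<bar> < e" using a by (intro K1 aN) auto
    moreover have "\<epsilon> (b * N) < e" "\<epsilon> (a * N) < e" using a by (auto intro!: K3 aN)
    ultimately show "breg (\<epsilon> (a * N)) (\<xi> (a * N)) (x (b * N)) (x (a * N)) \<le> \<eta> \<and> \<epsilon> (a * N) \<le> \<eta>"
      unfolding e_def by linarith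
  qed
qed

text \<open>
  The record iterates form a Cauchy sequence by \<open>near_diagonal\<close> and \<open>breg_lower\<close>. Passing to the limit in
  \<open>near_diagonal\<close> by lower semicontinuity gives at once that the limit lies in the effective domain and that the
  distances to it become small, at all cycles and not only at record ones.
\<close>

lemma exact_convergence:
  "\<exists>z. sol z \<and> (\<forall>\<eta>>0. \<exists>K. \<forall>a\<ge>K. Dn z (a * N) \<le> \<eta>)"
proof -
  define X where "X k = x (enumerate R k * N)" for k
  have en: "enumerate R k \<in> R" "k \<le> enumerate R k" "j \<le> k \<Longrightarrow> enumerate R j \<le> enumerate R k" for j k
    using R_infinite by (auto simp: enumerate_in_set le_enumerate intro!: monoD[OF strict_mono_mono] strict_mono_enumerate)
  have "Cauchy X"
  proof (rule CauchyI')
    fix e :: real assume e: "0 < e"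
    \<comment> \<open>With this choice \<open>breg_lower\<close> gives \<open>norm (x (b * N) - x (a * N)) powr p \<le> e powr p / 2\<close>.\<close>
    define \<eta> where "\<eta> = c\<^sub>0 / 8 * e powr p"
    have "0 < \<eta>" unfolding \<eta>_def using e c0 by simp
    then obtain K where K: "\<And>a b. a \<ge> K \<Longrightarrow> b \<in> R \<Longrightarrow> a \<le> b \<Longrightarrow>
        breg (\<epsilon> (a * N)) (\<xi> (a * N)) (x (b * N)) (x (a * N)) \<le> \<eta> \<and> \<epsilon> (a * N) \<le> \<eta>"
      using near_diagonal by meson
    have "dist (X m) (X n) < e" if mn: "K \<le> m" "m < n" for m n
    proof -
      define a b where "a = enumerate R m" and "b = enumerate R n"
      have ab: "K \<le> a" "b \<in> R" "a \<le> b" unfolding a_def b_def using en(1)[of n] en(2)[of m] en(3)[of m n] mn by auto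
      have "c\<^sub>0 / 2 * norm (x (b * N) - x (a * N)) powr p \<le> 2 * \<eta>"
        using breg_lower[OF subgrad_run x_dom, of "b * N" "a * N"] K[OF ab] by linarith
      then have "norm (x (b * N) - x (a * N)) powr p \<le> 1 / 2 * e powr p" unfolding \<eta>_def using c0 by simp
      also have "\<dots> < e powr p" using e by simp
      finally have "norm (x (b * N) - x (a * N)) < e"
        using powr_less_cancel2[of p] ps_props(3) e by (smt (verit) norm_ge_zero powr_mono2)
      then show ?thesis unfolding X_def a_def b_def by (simp add: dist_norm norm_minus_commute)
    qed
    then show "\<exists>M. \<forall>m\<ge>M. \<forall>n>m. dist (X m) (X n) < e" by blast
  qed
  then obtain z where Xz: "X \<longlonglongrightarrow> z" using Cauchy_convergent convergent_def by blast
  have Xball: "X k \<in> B\<^sub>2" for k unfolding X_def by (rule ball_invariance)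
  have zball: "z \<in> B\<^sub>2" using closed_sequentially[OF closed_cball _ Xz] Xball by blast
  have approx: "z \<in> dom \<and> Dn z (a * N) \<le> 2 * \<eta>"
    if \<eta>: "0 < \<eta>" and a: "\<And>b. b \<in> R \<Longrightarrow> a \<le> b \<Longrightarrow> breg (\<epsilon> (a * N)) (\<xi> (a * N)) (x (b * N)) (x (a * N)) \<le> \<eta>" for a \<eta>
  proof -
    let ?f = "\<lambda>v. \<theta> (x (a * N)) + blinfun_apply (\<xi> (a * N)) (v - x (a * N)) - \<epsilon> (a * N)"
    have "(\<lambda>k. ?f (X k)) \<longlonglongrightarrow> ?f z" by (intro tendsto_intros Xz)
    then have "\<forall>\<^sub>F k in sequentially. ?f (X k) < ?f z + \<eta>" using \<eta> by (intro order_tendstoD(2)) auto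
    moreover have "\<forall>\<^sub>F k in sequentially. a \<le> k" by (rule eventually_ge_at_top)
    ultimately have ev: "\<forall>\<^sub>F k in sequentially. \<theta> (X k) \<le> ?f z + 2 * \<eta>"
    proof eventually_elim
      case (elim k)
      have "breg (\<epsilon> (a * N)) (\<xi> (a * N)) (X k) (x (a * N)) \<le> \<eta>"
        unfolding X_def using en(1,2)[of k] elim(2) by (intro a) auto
      then show ?case using elim(1) unfolding breg_def by linarith
    qed
    have "\<forall>\<^sub>F k in sequentially. X k \<in> dom" unfolding X_def using x_dom by simp
    note lim = sublevel_limit[OF Xz sequentially_bot this ev]
    then show ?thesis unfolding breg_def by simp
  qed
  have small: "\<exists>K. \<forall>a\<ge>K. z \<in> dom \<and> Dn z (a * N) \<le> \<eta>" if "0 < \<eta>" for \<eta>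
  proof -
    have h2: "0 < \<eta> / 2" using that by simp
    obtain K where K: "\<And>a b. a \<ge> K \<Longrightarrow> b \<in> R \<Longrightarrow> a \<le> b \<Longrightarrow>
        breg (\<epsilon> (a * N)) (\<xi> (a * N)) (x (b * N)) (x (a * N)) \<le> \<eta> / 2"
      using near_diagonal[OF h2] by meson
    show ?thesis using approx[OF h2 K] by (intro exI[of _ K]) auto
  qed
  have zdom: "z \<in> dom" using small[of 1] by auto
  have "F i z = y i" if i: "i < N" for i
  proof -
    have "(\<lambda>k. F i (X k)) \<longlonglongrightarrow> F i z" using Xball by (intro F_tendsto[OF i Xz zball]) simp
    moreover have "(\<lambda>k. F i (X k)) \<longlonglongrightarrow> y i"
    proof (rule Lim_null_comparison[THEN LIM_zero_cancel])
      show "\<forall>\<^sub>F k in sequentially. norm (F i (X k) - y i) \<le> C\<^sub>1 * E (enumerate R k) powr (1 / p)"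
        unfolding X_def using cycle_residual[OF i] by simp
      have "filterlim (enumerate R) at_top sequentially"
        using filterlim_subseq strict_mono_enumerate R_infinite by blast
      then have "(\<lambda>k. E (enumerate R k)) \<longlonglongrightarrow> 0"
        using filterlim_compose[OF summable_LIMSEQ_zero[OF E_summable]] by blast
      then have "(\<lambda>k. C\<^sub>1 * E (enumerate R k) powr (1 / p)) \<longlonglongrightarrow> C\<^sub>1 * 0 powr (1 / p)"
        using ps_props(3) E_pos by (intro tendsto_mult tendsto_const tendsto_powr2) (auto simp: less_imp_le)
      then show "(\<lambda>k. C\<^sub>1 * E (enumerate R k) powr (1 / p)) \<longlonglongrightarrow> 0" by simp
    qed
    ultimately show ?thesis by (rule LIMSEQ_unique)
  qed
  then have "sol z" using zball zdom A1b(3) unfolding sol_def solves_system_def by blast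
  then show ?thesis using small by meson
qed

end
end

section \<open>Stability with respect to the noise level\<close>

context lk_setting
begin

text \<open>
  If \<open>b0 = 0\<close> the quotient tends to infinity wherever it is defined, so the minimum is eventually \<open>\<beta>\<^sub>1\<close>, in agreement with
  the convention for \<open>b = 0\<close>.
\<close>

lemma relax_tendsto:
  assumes a: "(a \<longlongrightarrow> a0) G" "0 < a0" and b: "(b \<longlongrightarrow> b0) G" "\<And>k. 0 \<le> b k"
  shows "((\<lambda>k. relax (a k) (b k)) \<longlongrightarrow> relax a0 b0) G"
proof (cases "b0 = 0")
  case True
  define A where "A = \<beta>\<^sub>0 * a0 powr (p * (s - 1))"
  have "0 < A" unfolding A_def using a beta by simp
  have lim: "((\<lambda>k. \<beta>\<^sub>0 * a k powr (p * (s - 1)) - \<beta>\<^sub>1 * b k powr p) \<longlongrightarrow> A - \<beta>\<^sub>1 * 0 powr p) G"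
    unfolding A_def using a b True ps_props(3)
    by (intro tendsto_diff tendsto_mult tendsto_const tendsto_powr[OF a(1) tendsto_const] tendsto_powr2) auto
  have "\<forall>\<^sub>F k in G. 0 < \<beta>\<^sub>0 * a k powr (p * (s - 1)) - \<beta>\<^sub>1 * b k powr p"
    by (rule order_tendstoD(1)[OF lim]) (use \<open>0 < A\<close> in simp)
  then have "\<forall>\<^sub>F k in G. relax (a k) (b k) = \<beta>\<^sub>1"
  proof eventually_elim
    case (elim k)
    show ?case
    proof (cases "b k powr p = 0")
      case False
      then have "0 < b k powr p" by simp
      then have "\<beta>\<^sub>1 \<le> \<beta>\<^sub>0 * a k powr (p * (s - 1)) / b k powr p" using elim by (simp add: pos_le_divide_eq)
      then show ?thesis unfolding relax_def by simp
    qed (simp add: relax_def)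
  qed
  moreover have "relax a0 b0 = \<beta>\<^sub>1" using True unfolding relax_def by simp
  ultimately show ?thesis by (simp add: tendsto_eventually)
next
  case False
  have ev: "\<forall>\<^sub>F k in G. b k \<noteq> 0" using b(1) False by (rule tendsto_imp_eventually_ne)
  have "((\<lambda>k. min (\<beta>\<^sub>0 * a k powr (p * (s - 1)) / b k powr p) \<beta>\<^sub>1)
      \<longlongrightarrow> min (\<beta>\<^sub>0 * a0 powr (p * (s - 1)) / b0 powr p) \<beta>\<^sub>1) G"
    using a b False by (intro tendsto_intros) auto
  moreover have "\<forall>\<^sub>F k in G. min (\<beta>\<^sub>0 * a k powr (p * (s - 1)) / b k powr p) \<beta>\<^sub>1 = relax (a k) (b k)"
    using ev by eventually_elim (simp add: relax_def)
  ultimately show ?thesis using False by (simp add: relax_def tendsto_cong)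
qed

text \<open>
  The dual increment \<open>\<mu> n *\<^sub>R g n\<close> as a function of the current iterate.
\<close>

definition update where
  "update \<delta> yd n z =
    (let i = n mod N; r = F i z - yd i; h = norm r powr p + \<sigma> * \<epsilon> n;
         g = adjoint_apply (L i z) (jmap (Y i) s r)
     in (if (\<tau> * \<delta>) powr p < h then relax (norm r) (norm g) * h powr (1 - s / p) else 0) *\<^sub>R g)"

text \<open>
  For exact data the step is active with a positive margin, so it is active for small \<open>\<delta>\<close>, and everything but the relaxation
  factor is continuous. That factor may jump where the residual vanishes, but it is bounded and multiplies
  a gradient which tends to 0 there.
\<close>

lemma update_tendsto:
  assumes yd: "\<And>i. i < N \<Longrightarrow> ((\<lambda>\<delta>. yd \<delta> i) \<longlongrightarrow> y i) (at_right 0)"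
      "\<And>\<delta> i. 0 < \<delta> \<Longrightarrow> i < N \<Longrightarrow> yd \<delta> i \<in> Y i"
    and v: "(v \<longlongrightarrow> z) (at_right (0::real))" "\<And>\<delta>. 0 < \<delta> \<Longrightarrow> v \<delta> \<in> B\<^sub>2" "z \<in> B\<^sub>2"
  shows "((\<lambda>\<delta>. update \<delta> (yd \<delta>) n (v \<delta>)) \<longlongrightarrow> update 0 y n z) (at_right 0)"
proof -
  define i where "i = n mod N"
  have i: "i < N" unfolding i_def using N by simp
  have V: "subspace (Y i)" "uniformly_smooth_on (Y i)" using Y[OF i] by auto
  have pos_ev: "\<forall>\<^sub>F \<delta> in at_right 0. (0::real) < \<delta>" by (simp add: eventually_at_right_less)
  have vB: "\<forall>\<^sub>F \<delta> in at_right 0. v \<delta> \<in> B\<^sub>2" using pos_ev by eventually_elim (rule v(2))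
  have FY: "F i u \<in> Y i" if "u \<in> B\<^sub>2" for u using F[OF i] A1b(3) that i by blast
  define r where "r \<delta> = F i (v \<delta>) - yd \<delta> i" for \<delta>
  define r0 where "r0 = F i z - y i"
  define h where "h \<delta> = norm (r \<delta>) powr p + \<sigma> * \<epsilon> n" for \<delta>
  define h0 where "h0 = norm r0 powr p + \<sigma> * \<epsilon> n"
  define g where "g \<delta> = adjoint_apply (L i (v \<delta>)) (jmap (Y i) s (r \<delta>))" for \<delta>
  define g0 where "g0 = adjoint_apply (L i z) (jmap (Y i) s r0)"
  have r0Y: "r0 \<in> Y i" unfolding r0_def using FY[OF v(3)] y[OF i] V by (simp add: subspace_diff)
  have rY: "\<forall>\<^sub>F \<delta> in at_right 0. r \<delta> \<in> Y i"
    using pos_ev unfolding r_def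
    by eventually_elim (use FY v(2) yd(2)[OF _ i] V in \<open>auto intro: subspace_diff\<close>)
  have r: "(r \<longlongrightarrow> r0) (at_right 0)"
    unfolding r_def r0_def by (intro tendsto_diff F_tendsto[OF i v(1,3) vB] yd(1)[OF i])
  have h: "(h \<longlongrightarrow> h0) (at_right 0)"
    unfolding h_def h0_def using ps_props(3)
    by (intro tendsto_add tendsto_powr2 tendsto_norm r tendsto_const) auto
  have h0: "0 < h0" unfolding h0_def using sigma eps by (simp add: add_nonneg_pos)
  have Lv: "((\<lambda>\<delta>. L i (v \<delta>)) \<longlongrightarrow> L i z) (at_right 0)"
    by (rule continuous_on_tendsto_compose[OF A1c(4)[OF i] v(1) v(3) vB])
  have LY: "\<forall>\<^sub>F \<delta> in at_right 0. \<forall>u. blinfun_apply (L i (v \<delta>)) u \<in> Y i"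
    using vB by eventually_elim (use A1c(3)[OF i] in blast)
  have g: "(g \<longlongrightarrow> g0) (at_right 0)"
    unfolding g_def g0_def by (rule adjoint_jmap_tendsto[OF V s r0Y rY r LY Lv A1c(3)[OF i v(3)]])
  have hp: "((\<lambda>\<delta>. h \<delta> powr (1 - s / p)) \<longlongrightarrow> h0 powr (1 - s / p)) (at_right 0)"
    using h h0 by (intro tendsto_intros) auto
  have thr: "((\<lambda>\<delta>. (\<tau> * \<delta>) powr p) \<longlongrightarrow> (\<tau> * 0) powr p) (at_right 0)"
  proof (intro tendsto_powr2 tendsto_intros)
    show "\<forall>\<^sub>F \<delta> in at_right 0. 0 \<le> \<tau> * \<delta>" using pos_ev by eventually_elim (use tau in simp)
  qed (use ps_props(3) in simp)
  have "((\<lambda>\<delta>. h \<delta> - (\<tau> * \<delta>) powr p) \<longlongrightarrow> h0 - (\<tau> * 0) powr p) (at_right 0)" by (intro tendsto_diff h thr)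
  then have "\<forall>\<^sub>F \<delta> in at_right 0. 0 < h \<delta> - (\<tau> * \<delta>) powr p" using h0 by (intro order_tendstoD(1)) auto
  then have act: "\<forall>\<^sub>F \<delta> in at_right 0.
      (relax (norm (r \<delta>)) (norm (g \<delta>)) * h \<delta> powr (1 - s / p)) *\<^sub>R g \<delta> = update \<delta> (yd \<delta>) n (v \<delta>)"
    by eventually_elim (simp add: update_def Let_def i_def[symmetric] r_def[symmetric] h_def[symmetric] g_def[symmetric])
  have u0: "update 0 y n z = (relax (norm r0) (norm g0) * h0 powr (1 - s / p)) *\<^sub>R g0"
    using h0 by (simp add: update_def Let_def i_def[symmetric] r0_def[symmetric] h0_def[symmetric] g0_def[symmetric])
  have "((\<lambda>\<delta>. (relax (norm (r \<delta>)) (norm (g \<delta>)) * h \<delta> powr (1 - s / p)) *\<^sub>R g \<delta>) \<longlongrightarrow> update 0 y n z) (at_right 0)"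
  proof (cases "r0 = 0")
    case False
    then show ?thesis unfolding u0 using g r
      by (intro tendsto_scaleR tendsto_mult relax_tendsto tendsto_norm hp) auto
  next
    case True
    have "blinfun_apply g0 u = 0" for u
    proof -
      have "jmap (Y i) s r0 \<in> dual_on (Y i)" using jmap_in[OF V r0Y s] unfolding duality_mapping_on_def by blast
      then have "blinfun_apply g0 u = jmap (Y i) s r0 (blinfun_apply (L i z) u)"
        unfolding g0_def using A1c(3)[OF i v(3)] by (intro adjoint_apply_eq[OF V(1)])
      then show ?thesis using jmap_bound[OF V r0Y s A1c(3)[OF i v(3)], of u] True by simp
    qed
    then have g00: "g0 = 0" by (intro blinfun_eqI) simp
    have "((\<lambda>\<delta>. (relax (norm (r \<delta>)) (norm (g \<delta>)) * h \<delta> powr (1 - s / p)) *\<^sub>R g \<delta>) \<longlongrightarrow> 0) (at_right 0)"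
    proof (rule Lim_null_comparison)
      show "\<forall>\<^sub>F \<delta> in at_right 0. norm ((relax (norm (r \<delta>)) (norm (g \<delta>)) * h \<delta> powr (1 - s / p)) *\<^sub>R g \<delta>)
          \<le> \<beta>\<^sub>1 * h \<delta> powr (1 - s / p) * norm (g \<delta>)"
        using relax_le relax_nonneg by (intro always_eventually allI) (auto simp: abs_mult intro!: mult_right_mono)
      have "((\<lambda>\<delta>. \<beta>\<^sub>1 * h \<delta> powr (1 - s / p) * norm (g \<delta>)) \<longlongrightarrow> \<beta>\<^sub>1 * h0 powr (1 - s / p) * norm g0) (at_right 0)"
        by (intro tendsto_mult tendsto_const hp tendsto_norm g)
      then show "((\<lambda>\<delta>. \<beta>\<^sub>1 * h \<delta> powr (1 - s / p) * norm (g \<delta>)) \<longlongrightarrow> 0) (at_right 0)" unfolding g00 by simp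
    qed
    then show ?thesis unfolding u0 g00 by simp
  qed
  then show ?thesis using act by (rule Lim_transform_eventually)
qed

lemma exact_run_exists:
  "\<exists>\<xi> x q. landweber_kaczmarz N Y F L S \<epsilon> p s \<beta>\<^sub>0 \<beta>\<^sub>1 \<tau> \<sigma> x\<^sub>0 \<xi>\<^sub>0 0 y \<xi> x q"
proof -
  define st where "st = rec_nat (\<xi>\<^sub>0, x\<^sub>0)
    (\<lambda>n a. let \<xi>' = fst a - update 0 y n (snd a) in (\<xi>', S (\<epsilon> (Suc n)) \<xi>'))"
  define \<xi> where "\<xi> n = fst (st n)" for n
  define x where "x n = snd (st n)" for n
  have base: "\<xi> 0 = \<xi>\<^sub>0" "x 0 = x\<^sub>0" unfolding \<xi>_def x_def st_def by auto
  have step: "\<xi> (Suc n) = \<xi> n - update 0 y n (x n)" "x (Suc n) = S (\<epsilon> (Suc n)) (\<xi> (Suc n))" for n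
    unfolding \<xi>_def x_def st_def by (auto simp: Let_def)
  have "0 < norm (F (n mod N) (x n) - y (n mod N)) powr p + \<sigma> * \<epsilon> n" for n
    using sigma eps by (simp add: add_nonneg_pos)
  then have "landweber_kaczmarz N Y F L S \<epsilon> p s \<beta>\<^sub>0 \<beta>\<^sub>1 \<tau> \<sigma> x\<^sub>0 \<xi>\<^sub>0 0 y \<xi> x (\<lambda>_. 0)"
    unfolding landweber_kaczmarz_def Let_def step(1) step(2)[unfolded step(1)] update_def relax_def[symmetric]
    by (simp add: base not_le)
  then show ?thesis by blast
qed

end

lemma (in lk_run) update_eq: "\<xi> (Suc n) = \<xi> n - update \<delta> yd n (x n)"
  unfolding run_simps(4) update_def Let_def r_def[symmetric] h_def[symmetric] g_def[symmetric]
    \<mu>'_def[symmetric] active_def[symmetric] \<mu>_def ..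

section \<open>Convergence of the stopped iterates\<close>

text \<open>
  The noisy runs for all \<open>\<delta> > 0\<close> together with the exact run to which they converge step by step.
\<close>

locale lk_family = lk_setting +
  fixes yd :: "real \<Rightarrow> nat \<Rightarrow> 'b" and \<xi> :: "real \<Rightarrow> nat \<Rightarrow> ('a \<Rightarrow>\<^sub>L real)"
    and x :: "real \<Rightarrow> nat \<Rightarrow> 'a" and q :: "real \<Rightarrow> nat \<Rightarrow> nat"
    and \<xi>e :: "nat \<Rightarrow> ('a \<Rightarrow>\<^sub>L real)" and xe :: "nat \<Rightarrow> 'a" and qe :: "nat \<Rightarrow> nat"
  assumes data: "\<And>\<delta> i. 0 < \<delta> \<Longrightarrow> i < N \<Longrightarrow> yd \<delta> i \<in> Y i \<and> norm (yd \<delta> i - y i) \<le> \<delta>"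
    and run: "\<And>\<delta>. 0 < \<delta> \<Longrightarrow>
      landweber_kaczmarz N Y F L S \<epsilon> p s \<beta>\<^sub>0 \<beta>\<^sub>1 \<tau> \<sigma> x\<^sub>0 \<xi>\<^sub>0 \<delta> (yd \<delta>) (\<xi> \<delta>) (x \<delta>) (q \<delta>)"
    and exact_run: "landweber_kaczmarz N Y F L S \<epsilon> p s \<beta>\<^sub>0 \<beta>\<^sub>1 \<tau> \<sigma> x\<^sub>0 \<xi>\<^sub>0 0 y \<xi>e xe qe"
begin

lemma noisy_run:
  assumes "0 < \<delta>"
  shows "lk_run \<Theta> p ps c\<^sub>0 N Y D F y L S \<epsilon> s \<rho> \<gamma> \<beta> \<beta>\<^sub>0 \<beta>\<^sub>1 \<tau> \<sigma> \<kappa> x\<^sub>0 \<xi>\<^sub>0 \<delta> (yd \<delta>) (\<xi> \<delta>) (x \<delta>) (q \<delta>)"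
  using assms data run by unfold_locales auto

sublocale ex: lk_run \<Theta> p ps c\<^sub>0 N Y D F y L S \<epsilon> s \<rho> \<gamma> \<beta> \<beta>\<^sub>0 \<beta>\<^sub>1 \<tau> \<sigma> \<kappa> x\<^sub>0 \<xi>\<^sub>0 0 y \<xi>e xe qe
  using y exact_run by unfold_locales auto

lemma pos_ev: "\<forall>\<^sub>F \<delta> in at_right 0. (0::real) < \<delta>" by (simp add: eventually_at_right_less)

lemma iterates_tendsto:
  "((\<lambda>\<delta>. \<xi> \<delta> n) \<longlongrightarrow> \<xi>e n) (at_right 0) \<and> ((\<lambda>\<delta>. x \<delta> n) \<longlongrightarrow> xe n) (at_right 0)"
proof (induction n)
  case 0
  have "\<forall>\<^sub>F \<delta> in at_right 0. \<xi> \<delta> 0 = \<xi>e 0" "\<forall>\<^sub>F \<delta> in at_right 0. x \<delta> 0 = xe 0"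
    using pos_ev by (eventually_elim; use lk_run.run_simps(1,2)[OF noisy_run] ex.run_simps(1,2) in simp)+
  then show ?case by (simp add: tendsto_eventually)
next
  case (Suc n)
  have yd: "((\<lambda>\<delta>. yd \<delta> i) \<longlongrightarrow> y i) (at_right 0)" if "i < N" for i
  proof (rule Lim_null_comparison[THEN LIM_zero_cancel])
    show "\<forall>\<^sub>F \<delta> in at_right 0. norm (yd \<delta> i - y i) \<le> \<delta>"
      using pos_ev by eventually_elim (use data that in blast)
    show "((\<lambda>\<delta>::real. \<delta>) \<longlongrightarrow> 0) (at_right 0)" by (rule tendsto_ident_at)
  qed
  have "((\<lambda>\<delta>. update \<delta> (yd \<delta>) n (x \<delta> n)) \<longlongrightarrow> update 0 y n (xe n)) (at_right 0)"
    using data lk_run.ball_invariance[OF noisy_run] Suc.IH ex.ball_invariance yd by (intro update_tendsto) auto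
  then have "((\<lambda>\<delta>. \<xi> \<delta> n - update \<delta> (yd \<delta>) n (x \<delta> n)) \<longlongrightarrow> \<xi>e (Suc n)) (at_right 0)"
    unfolding ex.update_eq using Suc.IH by (intro tendsto_diff) auto
  moreover have "\<forall>\<^sub>F \<delta> in at_right 0. \<xi> \<delta> n - update \<delta> (yd \<delta>) n (x \<delta> n) = \<xi> \<delta> (Suc n)"
    using pos_ev by eventually_elim (use lk_run.update_eq[OF noisy_run] in simp)
  ultimately have \<xi>: "((\<lambda>\<delta>. \<xi> \<delta> (Suc n)) \<longlongrightarrow> \<xi>e (Suc n)) (at_right 0)" by (rule Lim_transform_eventually)
  have "((\<lambda>\<delta>. S (\<epsilon> (Suc n)) (\<xi> \<delta> (Suc n))) \<longlongrightarrow> S (\<epsilon> (Suc n)) (\<xi>e (Suc n))) (at_right 0)"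
    by (rule continuous_on_tendsto_compose[OF A2(1)[OF eps(1)] \<xi>]) auto
  moreover have "\<forall>\<^sub>F \<delta> in at_right 0. S (\<epsilon> (Suc n)) (\<xi> \<delta> (Suc n)) = x \<delta> (Suc n)"
    using pos_ev by eventually_elim (use lk_run.run_simps(5)[OF noisy_run] in simp)
  ultimately have "((\<lambda>\<delta>. x \<delta> (Suc n)) \<longlongrightarrow> xe (Suc n)) (at_right 0)"
    unfolding ex.run_simps(5)[symmetric] by (rule Lim_transform_eventually)
  then show ?case using \<xi> by blast
qed

text \<open>
  Only an upper bound is available since \<open>\<Theta>\<close> is merely lower semicontinuous, and it enters with a negative sign at
  the iterate. An upper bound is what the final estimate uses.
\<close>

lemma bregman_upper_semicontinuous:
  assumes z: "z \<in> dom" and e: "0 < e"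
  shows "\<forall>\<^sub>F \<delta> in at_right 0. breg (\<epsilon> n) (\<xi> \<delta> n) z (x \<delta> n) < breg (\<epsilon> n) (\<xi>e n) z (xe n) + e"
proof -
  have e2: "0 < e / 2" using e by simp
  have "\<forall>\<^sub>F \<delta> in at_right 0. x \<delta> n \<in> dom"
    using pos_ev by eventually_elim (rule lk_run.x_dom[OF noisy_run])
  then have "\<forall>\<^sub>F \<delta> in at_right 0. \<theta> (xe n) - e / 2 < \<theta> (x \<delta> n)"
    using iterates_tendsto by (intro \<theta>_lsc[OF ex.x_dom _ e2]) auto
  moreover have "((\<lambda>\<delta>. blinfun_apply (\<xi> \<delta> n) (z - x \<delta> n)) \<longlongrightarrow> blinfun_apply (\<xi>e n) (z - xe n)) (at_right 0)"
    using iterates_tendsto[of n] by (intro blinfun.tendsto tendsto_diff tendsto_const) auto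
  then have "\<forall>\<^sub>F \<delta> in at_right 0. blinfun_apply (\<xi>e n) (z - xe n) - e / 2 < blinfun_apply (\<xi> \<delta> n) (z - x \<delta> n)"
    using e by (intro order_tendstoD(1)) auto
  ultimately show ?thesis unfolding breg_def by eventually_elim simp
qed

definition stop where "stop \<delta> = (LEAST n. q \<delta> n = N)"

lemma stop_at_top: "filterlim stop at_top (at_right 0)"
proof (unfold filterlim_at_top, intro allI)
  fix n
  have thr: "((\<lambda>\<delta>. (\<tau> * \<delta>) powr p) \<longlongrightarrow> (\<tau> * 0) powr p) (at_right 0)"
  proof (intro tendsto_powr2 tendsto_intros)
    show "\<forall>\<^sub>F \<delta> in at_right 0. 0 \<le> \<tau> * \<delta>" using pos_ev by eventually_elim (use tau in simp)
  qed (use ps_props(3) in simp)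
  have "\<forall>\<^sub>F \<delta> in at_right 0. \<forall>k\<in>{..<n}. (\<tau> * \<delta>) powr p < \<sigma> * \<epsilon> k"
    using sigma eps by (intro eventually_ball_finite ballI order_tendstoD(2)[OF thr]) auto
  with pos_ev show "\<forall>\<^sub>F \<delta> in at_right 0. n \<le> stop \<delta>"
  proof eventually_elim
    case (elim \<delta>)
    have "\<sigma> * \<epsilon> (stop \<delta>) \<le> (\<tau> * \<delta>) powr p"
      unfolding stop_def by (rule lk_run.inactive_at_stop[OF noisy_run[OF elim(1)] elim(1)])
    then show ?case using elim(2) by (meson lessThan_iff not_le)
  qed
qed

lemma stopped_convergence:
  "\<exists>z. sol z \<and> ((\<lambda>\<delta>. norm (x \<delta> (stop \<delta>) - z)) \<longlongrightarrow> 0) (at_right 0) \<and>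
    ((\<lambda>\<delta>. bregman (\<epsilon> (stop \<delta>)) \<Theta> (\<xi> \<delta> (stop \<delta>)) z (x \<delta> (stop \<delta>))) \<longlongrightarrow> 0) (at_right 0)"
proof -
  obtain z where z: "sol z" and small: "\<And>\<eta>. 0 < \<eta> \<Longrightarrow> \<exists>K. \<forall>a\<ge>K. breg (\<epsilon> (a * N)) (\<xi>e (a * N)) z (xe (a * N)) \<le> \<eta>"
    using ex.exact_convergence by auto
  have zd: "z \<in> dom" by (rule solD(3)[OF z])
  define B where "B \<delta> = breg (\<epsilon> (stop \<delta>)) (\<xi> \<delta> (stop \<delta>)) z (x \<delta> (stop \<delta>))" for \<delta>
  have B0: "\<forall>\<^sub>F \<delta> in at_right 0. 0 \<le> B \<delta>" unfolding B_def
    using pos_ev by eventually_elim (rule breg_nonneg[OF lk_run.subgrad_run[OF noisy_run] zd])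
  have Blim: "(B \<longlongrightarrow> 0) (at_right 0)"
  proof (rule tendstoI)
    fix \<eta> :: real assume \<eta>: "0 < \<eta>"
    then have \<eta>3: "0 < \<eta> / 3" by simp
    obtain K where K: "\<And>a. a \<ge> K \<Longrightarrow> breg (\<epsilon> (a * N)) (\<xi>e (a * N)) z (xe (a * N)) \<le> \<eta> / 3" using small[OF \<eta>3] by blast
    obtain M where M: "\<And>m n. m \<ge> M \<Longrightarrow> norm (sum w {m..<n}) < \<eta> / 3"
      using w_summable \<eta>3 unfolding summable_Cauchy by meson
    \<comment> \<open>The exact distances are known to be small along the multiples of \<open>N\<close>.\<close>
    define n where "n = max K M * N"
    have "max K M \<le> n" unfolding n_def using N by (cases N) (auto simp: max_def)
    then have n: "breg (\<epsilon> n) (\<xi>e n) z (xe n) \<le> \<eta> / 3" "M \<le> n"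
      using K[of "max K M"] unfolding n_def by auto
    have "\<forall>\<^sub>F \<delta> in at_right 0. n \<le> stop \<delta>" using stop_at_top unfolding filterlim_at_top by blast
    with pos_ev B0 bregman_upper_semicontinuous[OF zd \<eta>3, of n]
    show "\<forall>\<^sub>F \<delta> in at_right 0. dist (B \<delta>) 0 < \<eta>"
    proof eventually_elim
      case (elim \<delta>)
      have "B \<delta> \<le> breg (\<epsilon> n) (\<xi> \<delta> n) z (x \<delta> n) + sum w {n..<stop \<delta>}"
        unfolding B_def by (rule lk_run.quasi_monotone[OF noisy_run[OF elim(1)] z elim(4)])
      moreover have "sum w {n..<stop \<delta>} < \<eta> / 3" using M[OF n(2), of "stop \<delta>"] by simp
      ultimately have "B \<delta> < \<eta>" using elim(3) n(1) by linarith
      then show ?case using elim(2) by simp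
    qed
  qed
  have Beq: "\<forall>\<^sub>F \<delta> in at_right 0. ereal (B \<delta>) = bregman (\<epsilon> (stop \<delta>)) \<Theta> (\<xi> \<delta> (stop \<delta>)) z (x \<delta> (stop \<delta>))"
    unfolding B_def using pos_ev by eventually_elim (simp add: bregman_eq[OF zd lk_run.x_dom[OF noisy_run]])
  have "((\<lambda>\<delta>. ereal (B \<delta>)) \<longlongrightarrow> 0) (at_right 0)"
    using Blim by (simp add: zero_ereal_def)
  then have 1: "((\<lambda>\<delta>. bregman (\<epsilon> (stop \<delta>)) \<Theta> (\<xi> \<delta> (stop \<delta>)) z (x \<delta> (stop \<delta>))) \<longlongrightarrow> 0) (at_right 0)"
    using Beq by (rule Lim_transform_eventually)
  have "((\<lambda>\<delta>. \<epsilon> (stop \<delta>)) \<longlongrightarrow> 0) (at_right 0)"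
    by (rule filterlim_compose[OF summable_LIMSEQ_zero[OF eps(2)] stop_at_top])
  then have "((\<lambda>\<delta>. 2 / c\<^sub>0 * (B \<delta> + \<epsilon> (stop \<delta>))) \<longlongrightarrow> 2 / c\<^sub>0 * (0 + 0)) (at_right 0)"
    by (intro tendsto_mult tendsto_add Blim tendsto_const)
  then have "((\<lambda>\<delta>. (2 / c\<^sub>0 * (B \<delta> + \<epsilon> (stop \<delta>))) powr (1 / p)) \<longlongrightarrow> 0 powr (1 / p)) (at_right 0)"
  proof (intro tendsto_powr2 tendsto_const)
    show "\<forall>\<^sub>F \<delta> in at_right 0. 0 \<le> 2 / c\<^sub>0 * (B \<delta> + \<epsilon> (stop \<delta>))"
      using B0 by eventually_elim (use c0 eps(1) in \<open>auto intro: add_nonneg_nonneg simp: less_imp_le\<close>)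
  qed (use ps_props(3) in auto)
  then have "((\<lambda>\<delta>. (2 / c\<^sub>0 * (B \<delta> + \<epsilon> (stop \<delta>))) powr (1 / p)) \<longlongrightarrow> 0) (at_right 0)" by simp
  moreover have "\<forall>\<^sub>F \<delta> in at_right 0. norm (norm (x \<delta> (stop \<delta>) - z)) \<le> (2 / c\<^sub>0 * (B \<delta> + \<epsilon> (stop \<delta>))) powr (1 / p)"
    using pos_ev
  proof eventually_elim
    case (elim \<delta>)
    have "c\<^sub>0 / 2 * norm (z - x \<delta> (stop \<delta>)) powr p \<le> B \<delta> + \<epsilon> (stop \<delta>)"
      unfolding B_def by (rule breg_lower[OF lk_run.subgrad_run[OF noisy_run[OF elim]] zd])
    then have "norm (z - x \<delta> (stop \<delta>)) powr p \<le> 2 / c\<^sub>0 * (B \<delta> + \<epsilon> (stop \<delta>))"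
      using c0 by (simp add: field_simps)
    then have "norm (z - x \<delta> (stop \<delta>)) \<le> (2 / c\<^sub>0 * (B \<delta> + \<epsilon> (stop \<delta>))) powr (1 / p)"
      by (intro le_root) auto
    then show ?case by (simp add: norm_minus_commute)
  qed
  ultimately have "((\<lambda>\<delta>. norm (x \<delta> (stop \<delta>) - z)) \<longlongrightarrow> 0) (at_right 0)"
    by (rule Lim_null_comparison[rotated])
  then show ?thesis by (intro exI[of _ z] conjI z 1)
qed

end

theorem theorem3p8:
  fixes \<Theta> :: "'a::banach \<Rightarrow> ereal"
    and N :: nat
    and Y :: "nat \<Rightarrow> 'b::banach set"
    and D :: "nat \<Rightarrow> 'a set"
    and F :: "nat \<Rightarrow> 'a \<Rightarrow> 'b"
    and y :: "nat \<Rightarrow> 'b"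
    and L :: "nat \<Rightarrow> 'a \<Rightarrow> ('a \<Rightarrow>\<^sub>L 'b)"
    and S :: "real \<Rightarrow> ('a \<Rightarrow>\<^sub>L real) \<Rightarrow> 'a"
    and \<epsilon> :: "nat \<Rightarrow> real"
    and p ps s c\<^sub>0 \<rho> \<gamma> \<beta> \<beta>\<^sub>0 \<beta>\<^sub>1 \<tau> \<sigma> \<kappa> :: real
    and x\<^sub>0 :: 'a
    and \<xi>\<^sub>0 :: "'a \<Rightarrow>\<^sub>L real"
    and yd :: "real \<Rightarrow> nat \<Rightarrow> 'b"
    and \<xi> :: "real \<Rightarrow> nat \<Rightarrow> ('a \<Rightarrow>\<^sub>L real)"
    and x :: "real \<Rightarrow> nat \<Rightarrow> 'a"
    and q :: "real \<Rightarrow> nat \<Rightarrow> nat"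
    and stop :: "real \<Rightarrow> nat"
  assumes N: "0 < N"
    and p: "2 \<le> p" and ps: "1 / p + 1 / ps = 1" and s: "1 < s"
    and X: "reflexive_on (UNIV :: 'a set)"
    and Y: "\<And>i. i < N \<Longrightarrow> subspace (Y i) \<and> closed (Y i) \<and> reflexive_on (Y i) \<and> uniformly_smooth_on (Y i)"
    and F: "\<And>i z. i < N \<Longrightarrow> z \<in> D i \<Longrightarrow> F i z \<in> Y i"
    and y: "\<And>i. i < N \<Longrightarrow> y i \<in> Y i"
    and A1a: "0 < c\<^sub>0" "proper_fun \<Theta>" "lower_semicont \<Theta>" "p_convex p c\<^sub>0 \<Theta>"
    and A1b: "0 < \<rho>" "\<xi>\<^sub>0 \<in> eps_subdiff 0 \<Theta> x\<^sub>0" "cball x\<^sub>0 (2 * \<rho>) \<subseteq> (\<Inter>i<N. D i)"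
      "\<exists>x\<^sub>d. x\<^sub>d \<in> eff_dom \<Theta> \<and> solves_system N D F y x\<^sub>d \<and>
             bregman 0 \<Theta> \<xi>\<^sub>0 x\<^sub>d x\<^sub>0 \<le> ereal (1 / 4 * c\<^sub>0 * \<rho> powr p)"
    and A1c: "0 \<le> \<gamma>" "\<gamma> < 1"
      "\<And>i z h. i < N \<Longrightarrow> z \<in> cball x\<^sub>0 (2 * \<rho>) \<Longrightarrow> blinfun_apply (L i z) h \<in> Y i"
      "\<And>i. i < N \<Longrightarrow> continuous_on (cball x\<^sub>0 (2 * \<rho>)) (L i)"
      "\<And>i z' z. i < N \<Longrightarrow> z' \<in> cball x\<^sub>0 (2 * \<rho>) \<Longrightarrow> z \<in> cball x\<^sub>0 (2 * \<rho>) \<Longrightarrow>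
         norm (F i z' - F i z - blinfun_apply (L i z) (z' - z)) \<le> \<gamma> * norm (F i z' - F i z)"
    and A2: "\<And>e. 0 < e \<Longrightarrow> continuous_on UNIV (S e)"
      "\<And>e \<zeta>. 0 < e \<Longrightarrow> \<Theta> (S e \<zeta>) - ereal (blinfun_apply \<zeta> (S e \<zeta>))
                      \<le> (INF z. \<Theta> z - ereal (blinfun_apply \<zeta> z)) + ereal e"
    and eps: "\<And>n. 0 < \<epsilon> n" "summable \<epsilon>" "16 * (\<Sum>n. \<epsilon> n) \<le> c\<^sub>0 * \<rho> powr p"
    and beta: "1 < \<beta>" "\<beta> * \<gamma> < 1" "0 < \<beta>\<^sub>1" "0 < \<beta>\<^sub>0" and tau: "1 < \<tau>"
    and pos: "1 / \<beta> - \<gamma> - (1 + \<gamma>) / \<tau> - 2 / ps * (\<beta>\<^sub>0 / (2 * c\<^sub>0)) powr (ps - 1) > 0"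
    and kappa: "\<kappa> = (if p \<ge> s then 1 else (\<beta> powr (p / (s - p)) - 1) powr ((p - s) / p))"
    and sigma: "0 < \<sigma>" "\<kappa> * \<beta>\<^sub>1 * \<sigma> \<le> 1"
    and data: "\<And>\<delta> i. 0 < \<delta> \<Longrightarrow> i < N \<Longrightarrow> yd \<delta> i \<in> Y i \<and> norm (yd \<delta> i - y i) \<le> \<delta>"
    and run: "\<And>\<delta>. 0 < \<delta> \<Longrightarrow>
      landweber_kaczmarz N Y F L S \<epsilon> p s \<beta>\<^sub>0 \<beta>\<^sub>1 \<tau> \<sigma> x\<^sub>0 \<xi>\<^sub>0 \<delta> (yd \<delta>) (\<xi> \<delta>) (x \<delta>) (q \<delta>)"
    and stop: "\<And>\<delta>. 0 < \<delta> \<Longrightarrow> stop \<delta> = (LEAST n. q \<delta> n = N)"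
  shows "\<exists>x\<^sub>s. solves_system N D F y x\<^sub>s \<and> x\<^sub>s \<in> cball x\<^sub>0 (2 * \<rho>) \<inter> eff_dom \<Theta> \<and>
           ((\<lambda>\<delta>. norm (x \<delta> (stop \<delta>) - x\<^sub>s)) \<longlongrightarrow> 0) (at_right 0) \<and>
           ((\<lambda>\<delta>. bregman (\<epsilon> (stop \<delta>)) \<Theta> (\<xi> \<delta> (stop \<delta>)) x\<^sub>s (x \<delta> (stop \<delta>))) \<longlongrightarrow> 0) (at_right 0)"
proof -
  interpret lk_setting \<Theta> p ps c\<^sub>0 N Y D F y L S \<epsilon> s \<rho> \<gamma> \<beta> \<beta>\<^sub>0 \<beta>\<^sub>1 \<tau> \<sigma> \<kappa> x\<^sub>0 \<xi>\<^sub>0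
  proof unfold_locales
    show "subspace (Y i) \<and> uniformly_smooth_on (Y i)" if "i < N" for i using Y[OF that] by blast
  qed (fact p ps A1a N s F y A1b A1c A2 eps beta tau pos kappa sigma)+
  obtain \<xi>e xe qe where e: "landweber_kaczmarz N Y F L S \<epsilon> p s \<beta>\<^sub>0 \<beta>\<^sub>1 \<tau> \<sigma> x\<^sub>0 \<xi>\<^sub>0 0 y \<xi>e xe qe"
    using exact_run_exists by blast
  interpret fam: lk_family \<Theta> p ps c\<^sub>0 N Y D F y L S \<epsilon> s \<rho> \<gamma> \<beta> \<beta>\<^sub>0 \<beta>\<^sub>1 \<tau> \<sigma> \<kappa> x\<^sub>0 \<xi>\<^sub>0 yd \<xi> x q \<xi>e xe qe
    by unfold_locales (fact data run e)+
  obtain z where z: "sol z" "((\<lambda>\<delta>. norm (x \<delta> (fam.stop \<delta>) - z)) \<longlongrightarrow> 0) (at_right 0)"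
    "((\<lambda>\<delta>. bregman (\<epsilon> (fam.stop \<delta>)) \<Theta> (\<xi> \<delta> (fam.stop \<delta>)) z (x \<delta> (fam.stop \<delta>))) \<longlongrightarrow> 0) (at_right 0)"
    using fam.stopped_convergence by blast
  have ev: "\<forall>\<^sub>F \<delta> in at_right 0. fam.stop \<delta> = stop \<delta>"
    using fam.pos_ev by eventually_elim (simp add: fam.stop_def stop)
  show ?thesis
  proof (intro exI[of _ z] conjI)
    show "solves_system N D F y z" "z \<in> cball x\<^sub>0 (2 * \<rho>) \<inter> eff_dom \<Theta>" using z(1) unfolding sol_def by auto
    show "((\<lambda>\<delta>. norm (x \<delta> (stop \<delta>) - z)) \<longlongrightarrow> 0) (at_right 0)"
      by (rule Lim_transform_eventually[OF z(2)]) (use ev in \<open>eventually_elim, simp\<close>)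
    show "((\<lambda>\<delta>. bregman (\<epsilon> (stop \<delta>)) \<Theta> (\<xi> \<delta> (stop \<delta>)) z (x \<delta> (stop \<delta>))) \<longlongrightarrow> 0) (at_right 0)"
      by (rule Lim_transform_eventually[OF z(3)]) (use ev in \<open>eventually_elim, simp\<close>)
  qed
qed

end
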